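(* Let $N$ be a positive integer and let $L$ be the largest integer whose square divides $N$. Let $$f=\prod_{m\in\mathcal{D}_N}\ \prod_{h=0}^{\ell(m)-1}F_{m,h}^{e_{m,h}}\quad\text{for some } e_{m,h}\in\mathbf{Z}.$$ Then $f^L$ is a modular function on $X_0(N)$ if all the following conditions are satisfied: (1) the order of $f$ at the cusp $\infty$ is an integer; (2) the order of $f$ at the cusp $0$ is an integer; (3) the order of $f$ at the cusp $\left(\begin{smallmatrix}1\\N_0\end{smallmatrix}\right)$ is an integer, where $N_0$ is the odd part of $N$; (4) for each odd prime divisor $p$ of $N$, $$\sum_{m:\,m''=p^r}\ \sum_{h=0}^{\ell(m)-1}e_{m,h}\equiv0\pmod2,$$ where the first sum runs over all $m\in\mathcal{D}_N$ such that $m''$ is a power of $p$.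
   Context: $X_0(N)$ is the modular curve attached to $\Gamma_0(N)$. $\zeta_n=e^{2\pi i/n}$, and $q^x=e^{2\pi i x\tau}$ for $\tau$ in the upper half plane. $\mathcal{D}_N$ is the set of positive divisors of $N$ different from $N$. For a positive divisor $m$ of $N$, $\ell=\ell(m)$ is the largest integer whose square divides $N/m$; put $m'=N/m$, $m''=m'/\ell(m)=N/(m\ell(m))$, $N'=N/\ell(m)$. For integers $g,h$ not both congruent to $0$ modulo $N$, $$E_{g,h}(\tau)=q^{B_2(g/N)/2}\prod_{n=1}^\infty\left(1-\zeta_N^h q^{n-1+g/N}\right)\left(1-\zeta_N^{-h}q^{n-g/N}\right),\qquad B_2(x)=x^2-x+\tfrac16 .$$ For each $m\in\mathcal{D}_N$ fix a set $S_{m''}\subset\{1,\dots,m''-1\}$ of representatives of $(\mathbf{Z}/m''\mathbf{Z})^\times/\{\pm1\}$, and for $\alpha\in S_{m''}$ let $\delta\in\{1,\dots,m''-1\}$ be the integer with $\alpha\delta\equiv1\pmod{m''}$. For an integer $h$, if $m''\ne2$ set $$F_{m,h}(\tau)=\prod_{\alpha\in S_{m''}}E_{\alpha m\ell,\ \delta hN'}(N'\tau),$$ and if $m''=2$ set $F_{m,h}(\tau)=E_{m\ell,hN'}(N'\tau)^{1/2}$, where the square root is the one with leading coefficient $1$, namely $q^{-N'/48}\prod_{n\ge1}(1-\zeta_{\ell}^{h}q^{N'(n-1/2)})$ (here $\ell\in\{1,2\}$). Cusps and orders: a cusp of $X_0(N)$ is written $\left(\begin{smallmatrix}a\\c\end{smallmatrix}\right)$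 (the class of $a/c$) with $c$ a positive divisor of $N$ and $a$ an integer prime to $N$; $\infty=\left(\begin{smallmatrix}1\\N\end{smallmatrix}\right)$ and $0=\left(\begin{smallmatrix}1\\1\end{smallmatrix}\right)$. Its width is $N/\gcd(c^2,N)$. For a product $f$ of integral powers of the functions $F_{m,h}$ (each of which is invariant under $\Gamma_0(N)$ up to roots of unity), the order of $f$ at $\left(\begin{smallmatrix}a\\c\end{smallmatrix}\right)$ is the rational number $\frac{N}{\gcd(c^2,N)}A$, where $q^A$ is the leading power in the Fourier expansion of $f(\gamma\tau)$ for any $\gamma=\left(\begin{smallmatrix}a&b\\c&d\end{smallmatrix}\right)\in\mathrm{SL}(2,\mathbf{Z})$. *)

theory Defs
  imports
    "HOL-Complex_Analysis.Complex_Analysis"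
    "HOL-Number_Theory.Number_Theory"
begin

definition upper_half_plane :: "complex set" where
  "upper_half_plane = {\<tau>. Im \<tau> > 0}"

definition mobius :: "int \<Rightarrow> int \<Rightarrow> int \<Rightarrow> int \<Rightarrow> complex \<Rightarrow> complex" where
  "mobius a b c d \<tau> = (of_int a * \<tau> + of_int b) / (of_int c * \<tau> + of_int d)"

text \<open>The functions $q^x$ and the roots of unity $\zeta_n^h$.\<close>

definition qpow :: "real \<Rightarrow> complex \<Rightarrow> complex" where
  "qpow x \<tau> = exp (2 * of_real pi * \<i> * of_real x * \<tau>)"

definition zeta_pow :: "nat \<Rightarrow> int \<Rightarrow> complex" where
  "zeta_pow n h = exp (2 * of_real pi * \<i> * of_int h / of_nat n)"


definition proper_divisors :: "nat \<Rightarrow> nat set" where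
  "proper_divisors N = {m. 0 < m \<and> m dvd N \<and> m \<noteq> N}"

definition max_square_root_divisor :: "nat \<Rightarrow> nat" where
  "max_square_root_divisor k = Max {l. l\<^sup>2 dvd k}"

text \<open>For \<open>m dvd N\<close>: \<open>ell N m\<close>, \<open>mdd N m\<close> and \<open>Nd N m\<close> are
  $\ell(m)$, $m'' = N/(m\ell(m))$ and $N' = N/\ell(m)$; the divisions are exact.\<close>

definition ell :: "nat \<Rightarrow> nat \<Rightarrow> nat" where
  "ell N m = max_square_root_divisor (N div m)"

definition mdd :: "nat \<Rightarrow> nat \<Rightarrow> nat" where
  "mdd N m = N div (m * ell N m)"

definition Nd :: "nat \<Rightarrow> nat \<Rightarrow> nat" where
  "Nd N m = N div ell N m"

text \<open>\<open>A\<close> is a set of representatives in \<open>{1, \<dots>, k - 1}\<close> of the units modulo \<open>k\<close> up to sign.\<close>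

definition unit_reps_mod_sign :: "nat \<Rightarrow> nat set \<Rightarrow> bool" where
  "unit_reps_mod_sign k A \<longleftrightarrow>
     A \<subseteq> {1..<k} \<and> (\<forall>s\<in>A. coprime s k) \<and>
     (\<forall>a::int. coprime a (int k) \<longrightarrow>
        (\<exists>!s. s \<in> A \<and> ([int s = a] (mod int k) \<or> [int s = - a] (mod int k))))"


definition B2 :: "real \<Rightarrow> real" where
  "B2 x = x\<^sup>2 - x + 1 / 6"

text \<open>The infinite products are indexed from 0, so the index \<open>n\<close> here is $n - 1$ in
  $\prod_{n \ge 1} (1 - \zeta_N^h q^{n-1+g/N}) (1 - \zeta_N^{-h} q^{n-g/N})$.\<close>

definition Efun :: "nat \<Rightarrow> int \<Rightarrow> int \<Rightarrow> complex \<Rightarrow> complex" where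
  "Efun N g h \<tau> =
     qpow (B2 (of_int g / of_nat N) / 2) \<tau> *
     (\<Prod>n. (1 - zeta_pow N h * qpow (real n + of_int g / of_nat N) \<tau>) *
           (1 - zeta_pow N (- h) * qpow (real n + 1 - of_int g / of_nat N) \<tau>))"

text \<open>\<open>S k\<close> is the chosen set of representatives of the units modulo \<open>k\<close> up to sign.
  If $m'' = 2$, the function is the square root of \<open>Efun N (m * ell N m) (h * Nd N m)\<close>
  at $N'\tau$ with leading coefficient 1, given by its product expansion.
  If $\alpha$ is coprime to $m'' > 1$, the value of \<^const>\<open>modular_inverse\<close> lies in
  $\{1, \dots, m'' - 1\}$.\<close>

definition Ffun :: "nat \<Rightarrow> (nat \<Rightarrow> nat set) \<Rightarrow> nat \<Rightarrow> int \<Rightarrow> complex \<Rightarrow> complex" where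
  "Ffun N S m h \<tau> =
     (if mdd N m = 2 then
        qpow (- real (Nd N m) / 48) \<tau> *
        (\<Prod>n. 1 - zeta_pow (ell N m) h * qpow (real (Nd N m) * (real n + 1 / 2)) \<tau>)
      else
        (\<Prod>\<alpha>\<in>S (mdd N m).
           Efun N (int (\<alpha> * m * ell N m))
                  (modular_inverse (int (mdd N m)) (int \<alpha>) * h * int (Nd N m))
                  (of_nat (Nd N m) * \<tau>)))"

definition Fprod :: "nat \<Rightarrow> (nat \<Rightarrow> nat set) \<Rightarrow> (nat \<Rightarrow> nat \<Rightarrow> int) \<Rightarrow> complex \<Rightarrow> complex" where
  "Fprod N S e \<tau> =
     (\<Prod>m\<in>proper_divisors N. \<Prod>h<ell N m. Ffun N S m (int h) \<tau> powi e m h)"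


text \<open>\<open>f\<close> has the Fourier expansion $\sum_{n \ge 0} a_n q^{A + n/M}$ near \<open>\<i>\<infinity>\<close>.\<close>

definition has_fourier_expansion ::
    "(complex \<Rightarrow> complex) \<Rightarrow> real \<Rightarrow> nat \<Rightarrow> (nat \<Rightarrow> complex) \<Rightarrow> bool" where
  "has_fourier_expansion f A M a \<longleftrightarrow>
     M > 0 \<and>
     (\<exists>Y>0. \<forall>\<tau>. Im \<tau> > Y \<longrightarrow> (\<lambda>n. a n * qpow (A + real n / real M) \<tau>) sums f \<tau>)"

definition has_leading_power :: "(complex \<Rightarrow> complex) \<Rightarrow> real \<Rightarrow> bool" where
  "has_leading_power f A \<longleftrightarrow> (\<exists>M a. has_fourier_expansion f A M a \<and> a 0 \<noteq> 0)"

text \<open>The leading power does not depend on the matrix with first column \<open>(a, c)\<close>: two of them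
  differ by an integer translation of the argument, which preserves leading powers.\<close>

definition cusp_order :: "nat \<Rightarrow> (complex \<Rightarrow> complex) \<Rightarrow> int \<Rightarrow> nat \<Rightarrow> real" where
  "cusp_order N f a c =
     real N / real (gcd (c\<^sup>2) N) *
     (THE A. \<forall>b d. a * d - b * int c = 1 \<longrightarrow>
               has_leading_power (\<lambda>\<tau>. f (mobius a b (int c) d \<tau>)) A)"

text \<open>Meromorphic functions are represented with the value 0 at their poles, so that pointwise
  invariance is invariance as a meromorphic function. Meromorphy at all cusps is finiteness of
  the principal part of the Fourier expansion of \<open>f \<circ> \<gamma>\<close> for all \<open>\<gamma>\<close> in SL(2,Z).\<close>

definition modular_function_X0 :: "nat \<Rightarrow> (complex \<Rightarrow> complex) \<Rightarrow> bool" where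
  "modular_function_X0 N f \<longleftrightarrow>
     f nicely_meromorphic_on upper_half_plane \<and>
     (\<forall>a b c d. a * d - b * c = 1 \<longrightarrow> int N dvd c \<longrightarrow>
        (\<forall>\<tau>\<in>upper_half_plane. f (mobius a b c d \<tau>) = f \<tau>)) \<and>
     (\<forall>a b c d. a * d - b * c = 1 \<longrightarrow>
        (\<exists>(k::int) M u. has_fourier_expansion (\<lambda>\<tau>. f (mobius a b c d \<tau>))
                          (of_int k / of_nat M) M u))"

definition odd_part :: "nat \<Rightarrow> nat" where
  "odd_part N = N div 2 ^ multiplicity 2 N"

end

theory Submission
  imports Defs "HOL-Real_Asymp.Real_Asymp"
begin

text \<open>
  Up to a constant, $E_{g,h}$ is the Siegel function of the vector $(g/N, h/N)$, so it transforms
  under SL(2,Z) through the action on vectors, with an explicit root of unity; each $F_{m,h}$ is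
  therefore multiplied by roots of unity under $\tau \mapsto \tau + 1$ and under the parabolic
  element fixing $0$, and the order conditions at \<open>\<infinity>\<close> and $0$ say that these two
  multipliers of $f$ are $1$.  Multiplying by the two parabolic elements one may assume that a
  matrix of \<open>\<Gamma>\<^sub>0(N)\<close> has highly divisible off-diagonal entries and diagonal entries congruent to
  $1$ modulo $4$.  For such a matrix the explicit formula leaves only signs in the multiplier of
  $F_{m,h}^L$.  They disappear if $L$ is even; if $L$ is odd, a Gauss lemma argument shows that
  they are $1$ unless $m''$ is a power of an odd prime $p$, where they are Legendre symbols modulo
  $p$ whose product is $1$ by condition (4).  The exceptional function with $m'' = 2$ has an even
  exponent because of the order condition at $0$.
\<close>

section \<open>Siegel functions\<close>

text \<open>The pairing of \<alpha> with its inverse \<delta> in F_{m,h} is what makes the product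
  stable. A normalised matrix sends the index (\<alpha>/m'', \<delta>h/l) to (a\<alpha>/m'',
  d\<delta>h/l) up to integers, and since ad is 1 modulo m'', this is, up to sign and integer
  shifts, the index of another representative. Sign changes and shifts cost signs and l-th roots of
  unity; as l divides L, the L-th power keeps only the signs. The divisors 24N of b and 24N^2 of c
  survive the conjugation by tau -> N' tau: the new entries are still divisible by 12 and clear the
  denominators m'' and l. The congruence modulo 4 removes the last trace of the eta multiplier,
  whose exponent is then 3(1 - d) modulo 12. For m'' = 2 the function is a square root, but it is
  again a Siegel function, of first index 1/4 at 2N' tau, so that no branch has to be followed for
  holomorphy and for the behaviour at the cusps. The cusp 0 has to be treated before infinity: the
  order at infinity is read off from the matrix with rows (1, 0), (N, 1), which can be removed only
  once the multiplier at 0 is known to be 1.\<close>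

definition qexp :: "complex \<Rightarrow> complex" where
  "qexp z = exp (2 * of_real pi * \<i> * z)"

text \<open>The q-Pochhammer symbol (x; p)_infinity. With both arguments free, Siegel functions, the
  theta function and the square root for m'' = 2 all become values of one function.\<close>

definition qpoch :: "complex \<Rightarrow> complex \<Rightarrow> complex" where
  "qpoch x p = (\<Prod>n. 1 - x * p ^ n)"

lemma qexp_add: "qexp (z + w) = qexp z * qexp w"
  by (simp add: qexp_def exp_add ring_distribs)

lemma qexp_minus: "qexp (- z) = inverse (qexp z)"
  by (simp add: qexp_def exp_minus)

lemma qexp_diff: "qexp (z - w) = qexp z / qexp w"
  by (simp add: qexp_def exp_diff ring_distribs)

lemma qexp_nonzero [simp]: "qexp z \<noteq> 0"
  by (simp add: qexp_def)

lemma qexp_0 [simp]: "qexp 0 = 1"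
  by (simp add: qexp_def)

lemma qexp_power: "qexp z ^ n = qexp (of_nat n * z)"
  unfolding qexp_def by (subst exp_of_nat_mult [symmetric]) (simp add: algebra_simps)

lemma qexp_of_int [simp]: "qexp (of_int n) = 1"
proof -
  have "qexp (of_int n) = exp (of_real (of_int n * (2 * pi)) * \<i>)"
    by (simp add: qexp_def algebra_simps)
  also have "\<dots> = 1"
    using exp_eq_1[of "of_real (of_int n * (2 * pi)) * \<i>"] by auto
  finally show ?thesis .
qed

lemma qexp_Ints: "z \<in> \<int> \<Longrightarrow> qexp z = 1"
  by (auto elim: Ints_cases)

lemma qexp_1 [simp]: "qexp 1 = 1"
  using qexp_of_int[of 1] by simp

lemma qexp_eq_1_iff: "qexp z = 1 \<longleftrightarrow> z \<in> \<int>"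
proof
  assume "qexp z = 1"
  then obtain n :: int where "Re (2 * of_real pi * \<i> * z) = 0" "Im (2 * of_real pi * \<i> * z) = of_int (2 * n) * pi"
    by (auto simp: qexp_def exp_eq_1)
  then have "Re z = of_int n" "Im z = 0"
    by auto
  then have "z = of_int n"
    by (simp add: complex_eq_iff)
  then show "z \<in> \<int>" by simp
qed (rule qexp_Ints)

lemma qexp_eq_iff: "qexp z = qexp w \<longleftrightarrow> z - w \<in> \<int>"
  using qexp_eq_1_iff[of "z - w"] by (simp add: qexp_diff)

lemma qexp_half: "qexp (1 / 2) = -1"
  by (simp add: qexp_def)

lemma qexp_quarter: "qexp (1 / 4) = \<i>"
proof -
  have "qexp (1 / 4) = exp (\<i> * of_real (pi / 2))"
    by (simp add: qexp_def algebra_simps)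
  also have "\<dots> = \<i>"
    by (simp only: exp_Euler cos_of_real sin_of_real) (simp add: complex_eq_iff)
  finally show ?thesis .
qed

lemma qexp_half_int: "qexp (of_int n / 2) = (-1) ^ nat \<bar>n\<bar>"
proof (cases "n \<ge> 0")
  case True
  then have "qexp (of_int n / 2) = qexp (1/2) ^ nat n"
    by (simp add: qexp_power)
  then show ?thesis using True by (simp add: qexp_half)
next
  case False
  then have "qexp (of_int n / 2) = inverse (qexp (1/2) ^ nat (-n))"
    by (simp add: qexp_power flip: qexp_minus)
  then show ?thesis using False by (simp add: qexp_half power_inverse [symmetric])
qed

lemma norm_qexp: "norm (qexp z) = exp (- 2 * pi * Im z)"
  by (simp add: qexp_def norm_exp_eq_Re)

lemma norm_qexp_less_1_iff: "norm (qexp z) < 1 \<longleftrightarrow> Im z > 0"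
  by (simp add: norm_qexp zero_less_mult_iff)

lemma qpow_eq_qexp: "qpow x \<tau> = qexp (of_real x * \<tau>)"
  by (simp add: qpow_def qexp_def algebra_simps)

lemma zeta_pow_eq_qexp: "zeta_pow n h = qexp (of_int h / of_nat n)"
  by (simp add: zeta_pow_def qexp_def)

lemma holomorphic_on_qexp [holomorphic_intros]:
  "f holomorphic_on A \<Longrightarrow> (\<lambda>z. qexp (f z)) holomorphic_on A"
  unfolding qexp_def by (intro holomorphic_intros)

lemma continuous_on_qexp [continuous_intros]:
  "continuous_on A f \<Longrightarrow> continuous_on A (\<lambda>z. qexp (f z))"
  unfolding qexp_def by (intro continuous_intros)

section \<open>Convergence, holomorphy and identities of the q-Pochhammer symbol\<close>

lemma convergent_prod_qpoch:
  assumes "norm p < 1"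
  shows "convergent_prod (\<lambda>n. 1 - x * p ^ n :: complex)"
proof -
  have "summable (\<lambda>n. norm (1 - x * p ^ n - 1))"
    using assms by (auto simp: norm_mult norm_power intro!: summable_mult summable_geometric)
  then show ?thesis
    using abs_convergent_prod_conv_summable abs_convergent_prod_imp_convergent_prod
      summable_imp_abs_convergent_prod by blast
qed

lemma qpoch_LIMSEQ:
  assumes "norm p < 1"
  shows "(\<lambda>N. \<Prod>n<N. 1 - x * p ^ n) \<longlonglongrightarrow> qpoch x p"
  using convergent_prod_LIMSEQ[OF convergent_prod_qpoch[OF assms, of x]]
  by (simp add: qpoch_def LIMSEQ_lessThan_iff_atMost)

lemma qpoch_rec:
  assumes "norm p < 1"
  shows "qpoch x p = (1 - x) * qpoch (x * p) p"
proof -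
  have "(\<lambda>N. \<Prod>n<Suc N. 1 - x * p ^ n) \<longlonglongrightarrow> qpoch x p"
    using qpoch_LIMSEQ[OF assms, of x] LIMSEQ_Suc by blast
  moreover have "(\<lambda>N. (1 - x) * (\<Prod>n<N. 1 - x * p * p ^ n)) \<longlonglongrightarrow> (1 - x) * qpoch (x * p) p"
    by (intro tendsto_intros qpoch_LIMSEQ assms)
  moreover have "(\<Prod>n<Suc N. 1 - x * p ^ n) = (1 - x) * (\<Prod>n<N. 1 - x * p * p ^ n)" for N
    by (subst prod.lessThan_Suc_shift) (simp add: mult_ac)
  ultimately show ?thesis
    using LIMSEQ_unique by simp
qed

lemma qpoch_eq_0_iff:
  assumes "norm p < 1"
  shows "qpoch x p = 0 \<longleftrightarrow> (\<exists>n. x * p ^ n = 1)"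
proof -
  have "(\<lambda>n. 1 - x * p ^ n) has_prod qpoch x p"
    using convergent_prod_qpoch[OF assms] by (simp add: qpoch_def convergent_prod_has_prod)
  from has_prod_eq_0_iff[OF this] show ?thesis
    by (simp add: image_iff eq_commute[of 0])
qed

lemma qpoch_0_left [simp]: "qpoch 0 p = 1"
  by (simp add: qpoch_def)

lemma qpoch_0_right [simp]: "qpoch x 0 = 1 - x"
  using qpoch_rec[of 0 x] by simp

text \<open>The partial products converge uniformly on closed balls: compactness bounds
  \<open>X\<close> and keeps the norm of \<open>P\<close> below a constant less than 1, so a
  geometric series majorises the factors.\<close>

lemma holomorphic_on_qpoch [holomorphic_intros]:
  assumes A: "open A" and X: "X holomorphic_on A" and P: "P holomorphic_on A"
    and less: "\<And>z. z \<in> A \<Longrightarrow> norm (P z) < 1"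
  shows "(\<lambda>z. qpoch (X z) (P z)) holomorphic_on A"
proof (rule holomorphic_uniform_sequence[OF A])
  fix n
  show "(\<lambda>z. \<Prod>k<n. 1 - X z * P z ^ k) holomorphic_on A"
    by (intro holomorphic_intros X P)
next
  fix z assume z: "z \<in> A"
  obtain d where d: "d > 0" "cball z d \<subseteq> A"
    using A z open_contains_cball by blast
  have cX: "continuous_on (cball z d) X" and cP: "continuous_on (cball z d) P"
    using X P d holomorphic_on_imp_continuous_on continuous_on_subset by blast+
  have "compact (cball z d)" "cball z d \<noteq> {}"
    using d by auto
  from continuous_attains_sup[OF this continuous_on_norm[OF cX]]
    continuous_attains_sup[OF this continuous_on_norm[OF cP]]
  obtain x y where xy: "x \<in> cball z d" "\<And>w. w \<in> cball z d \<Longrightarrow> norm (X w) \<le> norm (X x)"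
      "y \<in> cball z d" "\<And>w. w \<in> cball z d \<Longrightarrow> norm (P w) \<le> norm (P y)"
    by blast
  have Py: "norm (P y) < 1"
    using less xy d by blast
  have "uniformly_convergent_on (cball z d) (\<lambda>N w. \<Prod>k<N. 1 - X w * P w ^ k)"
  proof (rule uniformly_convergent_on_prod')
    show "uniformly_convergent_on (cball z d) (\<lambda>N w. \<Sum>k<N. norm (1 - X w * P w ^ k - 1))"
    proof (rule Weierstrass_m_test')
      show "norm (norm (1 - X w * P w ^ k - 1)) \<le> norm (X x) * norm (P y) ^ k"
        if "w \<in> cball z d" for k w
        using xy(2,4)[OF that] by (auto simp: norm_mult norm_power intro!: mult_mono power_mono)
      show "summable (\<lambda>k. norm (X x) * norm (P y) ^ k)"
        using Py by (intro summable_mult summable_geometric) auto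
    qed
  qed (auto intro!: continuous_intros cX cP)
  then obtain g where g: "uniform_limit (cball z d) (\<lambda>N w. \<Prod>k<N. 1 - X w * P w ^ k) g sequentially"
    by (auto simp: uniformly_convergent_on_def)
  have "g w = qpoch (X w) (P w)" if "w \<in> cball z d" for w
    using LIMSEQ_unique tendsto_uniform_limitI[OF g that] qpoch_LIMSEQ less d that by blast
  with g have "uniform_limit (cball z d) (\<lambda>N w. \<Prod>k<N. 1 - X w * P w ^ k)
                 (\<lambda>w. qpoch (X w) (P w)) sequentially"
    by (subst uniform_limit_cong'[where i = g and g = "\<lambda>N w. \<Prod>k<N. 1 - X w * P w ^ k"]) auto
  then show "\<exists>d>0. cball z d \<subseteq> A \<and> uniform_limit (cball z d) (\<lambda>N w. \<Prod>k<N. 1 - X w * P w ^ k)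
                 (\<lambda>w. qpoch (X w) (P w)) sequentially"
    using d by blast
qed

text \<open>Euler's identity between partitions into odd and into distinct parts. At finite level,
  (1 + x^n)(1 - x^n) supplies the even exponents and the first product the odd ones; the limit is
  then divided by the nonzero \<open>qpoch x x\<close>. It fixes the value 2 in
  \<open>siegel_two_torsion_product\<close>.\<close>

lemma qpoch_Euler:
  assumes x: "norm x < 1"
  shows "qpoch x (x\<^sup>2) * qpoch (- x) x = 1"
proof -
  have x2: "norm (x\<^sup>2) < 1"
    using x by (simp add: norm_power power_less_one_iff)
  define a where "a N = (\<Prod>n<N. 1 - x * (x\<^sup>2) ^ n) * (\<Prod>n<N. 1 - (-x) * x ^ n)" for N
  have fin: "a N * (\<Prod>n<N. 1 - x * x ^ n) = (\<Prod>n<2*N. 1 - x * x ^ n)" for N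
  proof (induction N)
    case (Suc N)
    have "a (Suc N) * (\<Prod>n<Suc N. 1 - x * x ^ n)
        = (a N * (\<Prod>n<N. 1 - x * x ^ n)) * ((1 - x * x ^ (2*N)) * (1 - x * x ^ (2*N+1)))"
      by (simp add: a_def power_mult [symmetric] algebra_simps power_add power_mult power2_eq_square power_mult_distrib)
    also have "\<dots> = (\<Prod>n<2 * Suc N. 1 - x * x ^ n)"
      by (subst Suc.IH) (simp add: mult_ac)
    finally show ?case .
  qed (simp add: a_def)
  have "a \<longlonglongrightarrow> qpoch x (x\<^sup>2) * qpoch (-x) x"
    unfolding a_def by (intro tendsto_intros qpoch_LIMSEQ x x2)
  moreover have L: "(\<lambda>N. \<Prod>n<N. 1 - x * x ^ n) \<longlonglongrightarrow> qpoch x x"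
    by (intro qpoch_LIMSEQ x)
  ultimately have "(\<lambda>N. a N * (\<Prod>n<N. 1 - x * x ^ n)) \<longlonglongrightarrow> qpoch x (x\<^sup>2) * qpoch (-x) x * qpoch x x"
    by (intro tendsto_mult)
  moreover have "(\<lambda>N. \<Prod>n<2*N. 1 - x * x ^ n) \<longlonglongrightarrow> qpoch x x"
    using LIMSEQ_subseq_LIMSEQ[OF L, of "\<lambda>N. 2 * N"] by (simp add: strict_mono_def o_def)
  ultimately have "qpoch x (x\<^sup>2) * qpoch (-x) x * qpoch x x = qpoch x x"
    unfolding fin by (rule LIMSEQ_unique)
  moreover have "qpoch x x \<noteq> 0"
  proof -
    have "x * x ^ n \<noteq> 1" for n
    proof
      assume "x * x ^ n = 1"
      then have "norm x ^ Suc n = 1"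
        by (metis norm_one norm_power power_Suc)
      then show False
        using x power_Suc_less_one[of "norm x" n] by (cases "x = 0") auto
    qed
    then show ?thesis using qpoch_eq_0_iff[OF x] by blast
  qed
  ultimately show ?thesis by simp
qed

text \<open>The Siegel function of (u, v) without its customary constant factor depending on u and
  v. In this normalisation it is exactly periodic in \<open>v\<close>, and only shifts of
  \<open>u\<close> produce a factor.\<close>

definition siegel :: "real \<Rightarrow> real \<Rightarrow> complex \<Rightarrow> complex" where
  "siegel u v \<tau> = qexp (of_real (B2 u / 2) * \<tau>) *
     qpoch (qexp (of_real u * \<tau> + of_real v)) (qexp \<tau>) *
     qpoch (qexp (\<tau> - of_real u * \<tau> - of_real v)) (qexp \<tau>)"

section \<open>Elementary laws of Siegel functions in their two indices\<close>

lemma in_upper_half_plane [simp]: "\<tau> \<in> upper_half_plane \<longleftrightarrow> Im \<tau> > 0"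
  by (simp add: upper_half_plane_def)

lemma open_upper_half_plane: "open upper_half_plane"
  unfolding upper_half_plane_def by (rule open_halfspace_Im_gt)

lemma Efun_eq_siegel:
  assumes "Im \<tau> > 0"
  shows "Efun N g h \<tau> = siegel (of_int g / of_nat N) (of_int h / of_nat N) \<tau>"
proof -
  define q where "q = qexp \<tau>"
  have q: "norm q < 1" using assms by (simp add: q_def norm_qexp_less_1_iff)
  define x where "x = qexp (of_real (of_int g / of_nat N) * \<tau> + of_real (of_int h / of_nat N))"
  define y where "y = qexp (\<tau> - of_real (of_int g / of_nat N) * \<tau> - of_real (of_int h / of_nat N))"
  have "(1 - zeta_pow N h * qpow (real n + of_int g / of_nat N) \<tau>) *
           (1 - zeta_pow N (- h) * qpow (real n + 1 - of_int g / of_nat N) \<tau>)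
      = (1 - x * q ^ n) * (1 - y * q ^ n)" for n
    unfolding x_def y_def q_def zeta_pow_eq_qexp qpow_eq_qexp qexp_power qexp_add [symmetric]
    by (intro arg_cong2[where f = "(*)"] arg_cong2[where f = "(-)"] arg_cong[where f = qexp] refl)
       (simp_all add: algebra_simps)
  then have "(\<Prod>n. (1 - zeta_pow N h * qpow (real n + of_int g / of_nat N) \<tau>) *
           (1 - zeta_pow N (- h) * qpow (real n + 1 - of_int g / of_nat N) \<tau>)) = qpoch x q * qpoch y q"
    unfolding qpoch_def by (subst prodinf_mult) (auto intro: convergent_prod_qpoch q)
  then show ?thesis
    unfolding Efun_def siegel_def x_def y_def q_def qpow_eq_qexp by simp
qed

lemma siegel_add_int_right [simp]: "siegel u (v + of_int n) \<tau> = siegel u v \<tau>"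
  by (simp add: siegel_def qexp_add qexp_diff)

text \<open>Jacobi's theta function up to an exponential in \<open>z\<close> and a factor depending
  on tau alone. The inversion formula is proved by complex analysis in \<open>z\<close>, for which
  the real indices (u, v) are unsuitable.\<close>

definition jtheta :: "complex \<Rightarrow> complex \<Rightarrow> complex" where
  "jtheta \<tau> z = qpoch (qexp z) (qexp \<tau>) * qpoch (qexp (\<tau> - z)) (qexp \<tau>)"

lemma siegel_eq_jtheta:
  "siegel u v \<tau> = qexp (of_real (B2 u / 2) * \<tau>) * jtheta \<tau> (of_real u * \<tau> + of_real v)"
  by (simp add: siegel_def jtheta_def algebra_simps)

lemma jtheta_add_tau:
  assumes "Im \<tau> > 0"
  shows "jtheta \<tau> (z + \<tau>) = - qexp (- z) * jtheta \<tau> z"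
proof -
  have q: "norm (qexp \<tau>) < 1" using assms by (simp add: norm_qexp_less_1_iff)
  have "jtheta \<tau> (z + \<tau>) = qpoch (qexp z * qexp \<tau>) (qexp \<tau>) * qpoch (qexp (-z)) (qexp \<tau>)"
    by (simp add: jtheta_def qexp_add)
  also have "qpoch (qexp (-z)) (qexp \<tau>) = (1 - qexp (-z)) * qpoch (qexp (\<tau> - z)) (qexp \<tau>)"
    by (subst qpoch_rec[OF q]) (simp add: qexp_diff qexp_minus field_simps)
  also have "1 - qexp (-z) = - qexp (-z) * (1 - qexp z)"
    by (simp add: qexp_minus field_simps)
  finally show ?thesis
    by (simp add: jtheta_def qpoch_rec[OF q, of "qexp z"])
qed

lemma jtheta_minus: "jtheta \<tau> (- z) = jtheta \<tau> (z + \<tau>)"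
  by (simp add: jtheta_def add.commute)

text \<open>Since B2(u + 1) - B2(u) = 2u, the prefactor cancels exactly the part of the quasi-period
  of the theta function that depends on tau.\<close>

lemma siegel_add_1_left:
  assumes "Im \<tau> > 0"
  shows "siegel (u + 1) v \<tau> = - qexp (- of_real v) * siegel u v \<tau>"
proof -
  define z where "z = of_real u * \<tau> + of_real v"
  have "qexp (of_real (B2 (u + 1) / 2) * \<tau>) * qexp (- z) = qexp (of_real (B2 u / 2) * \<tau>) * qexp (- of_real v)"
    unfolding z_def qexp_add [symmetric]
    by (rule arg_cong[where f = qexp]) (simp add: B2_def power2_eq_square field_simps)
  moreover have "of_real (u + 1) * \<tau> + of_real v = z + \<tau>"
    by (simp add: z_def algebra_simps)
  ultimately show ?thesis
    unfolding siegel_eq_jtheta z_def [symmetric] by (simp add: jtheta_add_tau[OF assms])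
qed

lemma siegel_minus:
  assumes "Im \<tau> > 0"
  shows "siegel (- u) (- v) \<tau> = - qexp (- of_real v) * siegel u v \<tau>"
proof -
  define z where "z = of_real u * \<tau> + of_real v"
  have "qexp (of_real (B2 (- u) / 2) * \<tau>) * qexp (- z) = qexp (of_real (B2 u / 2) * \<tau>) * qexp (- of_real v)"
    unfolding z_def qexp_add [symmetric]
    by (rule arg_cong[where f = qexp]) (simp add: B2_def power2_eq_square field_simps)
  moreover have "of_real (- u) * \<tau> + of_real (- v) = - z"
    by (simp add: z_def)
  ultimately show ?thesis
    unfolding siegel_eq_jtheta z_def [symmetric] by (simp add: jtheta_minus jtheta_add_tau[OF assms])
qed

lemma siegel_translate:
  "siegel u v (\<tau> + of_int n) = qexp (of_real (of_int n * B2 u / 2)) * siegel u (v + of_int n * u) \<tau>"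
proof -
  have [simp]: "qexp (\<tau> + of_int n) = qexp \<tau>"
    by (simp add: qexp_add)
  have "qexp (of_real (B2 u / 2) * (\<tau> + of_int n)) = qexp (of_real (of_int n * B2 u / 2)) * qexp (of_real (B2 u / 2) * \<tau>)"
    unfolding qexp_add [symmetric]
    by (rule arg_cong[where f = qexp]) (simp add: field_simps)
  moreover have "qexp (of_real u * (\<tau> + of_int n) + of_real v) = qexp (of_real u * \<tau> + of_real (v + of_int n * u))"
    by (simp add: algebra_simps)
  moreover have "qexp (\<tau> + of_int n - of_real u * (\<tau> + of_int n) - of_real v)
      = qexp (\<tau> - of_real u * \<tau> - of_real (v + of_int n * u))"
    unfolding qexp_eq_iff by (simp add: algebra_simps)
  ultimately show ?thesis
    by (simp only: siegel_def mult.assoc \<open>qexp (\<tau> + of_int n) = qexp \<tau>\<close>)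
qed

text \<open>A factor vanishes only if its exponent is an integer, and the imaginary part then forces
  the coefficient of tau to be 0. The first product covers the integers u <= 0, the second the
  integers u >= 1.\<close>

lemma siegel_eq_0_iff:
  assumes "Im \<tau> > 0"
  shows "siegel u v \<tau> = 0 \<longleftrightarrow> u \<in> \<int> \<and> v \<in> \<int>"
proof -
  have q: "norm (qexp \<tau>) < 1" using assms by (simp add: norm_qexp_less_1_iff)
  have key: "of_real s * \<tau> + of_real t \<in> \<int> \<longleftrightarrow> s = 0 \<and> t \<in> \<int>" for s t
  proof
    assume "of_real s * \<tau> + of_real t \<in> \<int>"
    then obtain n :: int where n: "of_real s * \<tau> + of_real t = of_int n"
      by (elim Ints_cases)
    from arg_cong[OF n, of Im] assms have "s = 0" by simp
    with arg_cong[OF n, of Re] show "s = 0 \<and> t \<in> \<int>" by simp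
  qed (auto elim!: Ints_cases)
  have "siegel u v \<tau> = 0 \<longleftrightarrow>
      (\<exists>n::nat. of_real (u + n) * \<tau> + of_real v \<in> \<int>) \<or> (\<exists>n::nat. of_real (1 - u + n) * \<tau> + of_real (-v) \<in> \<int>)"
    unfolding siegel_def mult_eq_0_iff qpoch_eq_0_iff[OF q] qexp_power qexp_add [symmetric] qexp_eq_1_iff
    by (simp add: algebra_simps)
  also have "\<dots> \<longleftrightarrow> (\<exists>n::nat. u + n = 0 \<and> v \<in> \<int>) \<or> (\<exists>n::nat. 1 - u + n = 0 \<and> v \<in> \<int>)"
    unfolding key by simp
  also have "\<dots> \<longleftrightarrow> u \<in> \<int> \<and> v \<in> \<int>"
  proof (intro iffI; elim disjE exE conjE)
    fix n :: nat assume "u + n = 0" "v \<in> \<int>"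
    then have "u = of_int (- int n)" by simp
    then show "u \<in> \<int> \<and> v \<in> \<int>" using \<open>v \<in> \<int>\<close> by (metis Ints_of_int)
  next
    fix n :: nat assume "1 - u + n = 0" "v \<in> \<int>"
    then have "u = of_int (1 + int n)" by simp
    then show "u \<in> \<int> \<and> v \<in> \<int>" using \<open>v \<in> \<int>\<close> by (metis Ints_of_int)
  next
    assume uv: "u \<in> \<int>" "v \<in> \<int>"
    then obtain k :: int where k: "u = of_int k" by (elim Ints_cases)
    show "(\<exists>n::nat. u + n = 0 \<and> v \<in> \<int>) \<or> (\<exists>n::nat. 1 - u + n = 0 \<and> v \<in> \<int>)"
    proof (cases "k \<le> 0")
      case True
      then show ?thesis using k uv by (intro disjI1 exI[of _ "nat (-k)"]) auto
    next
      case False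
      then show ?thesis using k uv by (intro disjI2 exI[of _ "nat (k - 1)"]) auto
    qed
  qed
  finally show ?thesis .
qed

lemma holomorphic_on_siegel [holomorphic_intros]: "siegel u v holomorphic_on upper_half_plane"
  unfolding siegel_def [abs_def]
  by (intro holomorphic_intros open_upper_half_plane) (auto simp: norm_qexp_less_1_iff)

section \<open>Inversion and the modular transformation law\<close>

lemma jtheta_eq_siegel:
  assumes "z = of_real u * \<tau> + of_real v"
  shows "jtheta \<tau> z = siegel u v \<tau> / qexp (of_real (B2 u / 2) * \<tau>)"
  by (simp add: siegel_eq_jtheta assms)

lemma holomorphic_on_jtheta [holomorphic_intros]:
  assumes "Im \<tau> > 0" "f holomorphic_on A"
  shows "(\<lambda>z. jtheta \<tau> (f z)) holomorphic_on A"
proof -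
  have "jtheta \<tau> holomorphic_on UNIV"
    unfolding jtheta_def [abs_def]
    by (intro holomorphic_intros) (use assms in \<open>auto simp: norm_qexp_less_1_iff\<close>)
  from holomorphic_on_compose_gen[OF assms(2) this] show ?thesis
    by (simp add: o_def)
qed

lemma jtheta_add_1: "jtheta \<tau> (z + 1) = jtheta \<tau> z"
proof -
  have "qexp (\<tau> - (z + 1)) = qexp (\<tau> - z)"
    unfolding qexp_eq_iff by simp
  then show ?thesis by (simp add: jtheta_def qexp_add)
qed

lemma jtheta_sub_tau:
  assumes "Im \<tau> > 0"
  shows "jtheta \<tau> (z - \<tau>) = - qexp (z - \<tau>) * jtheta \<tau> z"
  using jtheta_add_tau[OF assms, of "z - \<tau>"] by (simp add: qexp_minus qexp_diff field_simps)

section \<open>Inversion of the theta function through Liouville's theorem\<close>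

lemma complex_lattice_coords:
  assumes "Im \<tau> > 0"
  obtains u v :: real where "z = of_real u * \<tau> + of_real v"
proof
  show "z = of_real (Im z / Im \<tau>) * \<tau> + of_real (Re z - Im z / Im \<tau> * Re \<tau>)"
    using assms by (simp add: complex_eq_iff)
qed

lemma jtheta_eq_0_iff:
  assumes "Im \<tau> > 0"
  shows "jtheta \<tau> z = 0 \<longleftrightarrow> (\<exists>m n :: int. z = of_int m * \<tau> + of_int n)"
proof -
  obtain u v where z: "z = of_real u * \<tau> + of_real v"
    using complex_lattice_coords[OF assms] .
  have "jtheta \<tau> z = 0 \<longleftrightarrow> u \<in> \<int> \<and> v \<in> \<int>"
    using siegel_eq_0_iff[OF assms, of u v] by (simp add: jtheta_eq_siegel[OF z])
  also have "\<dots> \<longleftrightarrow> (\<exists>m n :: int. z = of_int m * \<tau> + of_int n)"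
  proof
    assume "\<exists>m n :: int. z = of_int m * \<tau> + of_int n"
    then obtain m n :: int where mn: "z = of_int m * \<tau> + of_int n" by blast
    have "Im z = u * Im \<tau>" "Im z = m * Im \<tau>" by (simp add: z) (simp add: mn)
    then have u: "u = of_int m" using assms by simp
    with z mn have "complex_of_real v = of_int n" by simp
    then have "v = of_int n" by (metis of_real_eq_iff of_real_of_int_eq)
    with u show "u \<in> \<int> \<and> v \<in> \<int>" by simp
  next
    assume "u \<in> \<int> \<and> v \<in> \<int>"
    then obtain m n :: int where "u = of_int m" "v = of_int n" by (auto elim!: Ints_cases)
    then show "\<exists>m n :: int. z = of_int m * \<tau> + of_int n" unfolding z by auto
  qed
  finally show ?thesis .
qed

lemma Im_minus_inverse_pos:
  assumes "Im \<tau> > 0"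
  shows "Im (- 1 / \<tau>) > 0"
  using assms by (auto simp: Im_divide field_simps sum_power2_gt_zero_iff)

lemma lattice_periodic:
  fixes R :: "complex \<Rightarrow> 'a"
  assumes per1: "\<And>z. R (z + 1) = R z" and per2: "\<And>z. R (z + \<tau>) = R z"
  shows "R (z + (of_int m * \<tau> + of_int n)) = R z"
proof -
  have 1: "R (z + of_int n) = R z" for z and n :: int
  proof (induction n rule: int_induct[where k = 0])
    case (step1 i)
    then show ?case using per1[of "z + of_int i"] by (simp add: add.assoc)
  next
    case (step2 i)
    then show ?case using per1[of "z + of_int (i - 1)"] by (simp add: algebra_simps)
  qed auto
  have 2: "R (z + of_int n * \<tau>) = R z" for z and n :: int
  proof (induction n rule: int_induct[where k = 0])
    case (step1 i)
    then show ?case using per2[of "z + of_int i * \<tau>"] by (simp add: algebra_simps)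
  next
    case (step2 i)
    then show ?case using per2[of "z + of_int (i - 1) * \<tau>"] by (simp add: algebra_simps)
  qed auto
  show ?thesis using 1 2 by (simp flip: add.assoc)
qed

text \<open>Every value is already taken on the compact period parallelogram \<open>K\<close>, so
  the function is bounded.\<close>

lemma entire_doubly_periodic_imp_constant:
  assumes hol: "R holomorphic_on UNIV" and \<tau>: "Im \<tau> > 0"
    and per1: "\<And>z. R (z + 1) = R z" and per2: "\<And>z. R (z + \<tau>) = R z"
  shows "R constant_on UNIV"
proof (rule Liouville_theorem[OF hol])
  define K where "K = (\<lambda>p. of_real (fst p) * \<tau> + of_real (snd p)) ` ({0..1} \<times> {0..1::real})"
  have "compact K"
    unfolding K_def by (intro compact_continuous_image compact_Times continuous_intros) auto
  moreover have "continuous_on K R"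
    using hol holomorphic_on_imp_continuous_on holomorphic_on_subset by blast
  ultimately have "bounded (R ` K)"
    by (intro compact_imp_bounded compact_continuous_image)
  moreover have "range R \<subseteq> R ` K"
  proof safe
    fix z
    obtain u v where z: "z = of_real u * \<tau> + of_real v"
      using complex_lattice_coords[OF \<tau>] .
    define w where "w = of_real (frac u) * \<tau> + of_real (frac v)"
    have "z = w + (of_int \<lfloor>u\<rfloor> * \<tau> + of_int \<lfloor>v\<rfloor>)"
      by (simp add: z w_def frac_def algebra_simps)
    then have "R z = R w" using lattice_periodic[of R, OF per1 per2] by simp
    moreover have "w \<in> K"
      unfolding K_def w_def
      by (rule image_eqI[of _ _ "(frac u, frac v)"]) (auto simp: less_imp_le frac_lt_1)
    ultimately show "R z \<in> R ` K" by blast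
  qed
  ultimately show "bounded (range R)"
    by (rule bounded_subset)
qed

text \<open>Dividing both functions by z turns the quotient into one of difference quotients with
  nonzero limit below. Boundedness is all that Riemann's theorem on removable singularities
  requires.\<close>

lemma eventually_norm_quotient_bounded:
  fixes f g :: "complex \<Rightarrow> complex"
  assumes f: "f holomorphic_on UNIV" "f 0 = 0"
    and g: "(g has_field_derivative g') (at 0)" "g 0 = 0" "g' \<noteq> 0"
  shows "\<exists>B. eventually (\<lambda>z. norm (f z / g z) \<le> B) (at 0)"
proof -
  have "(f has_field_derivative deriv f 0) (at 0)"
    using f holomorphic_derivI by blast
  then have "(\<lambda>z. (f z / z) / (g z / z)) \<midarrow>0\<rightarrow> deriv f 0 / g'"
    using f g by (intro tendsto_divide) (auto simp: has_field_derivative_iff)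
  then have "eventually (\<lambda>z. dist ((f z / z) / (g z / z)) (deriv f 0 / g') < 1) (at 0)"
    by (rule tendstoD) simp
  moreover have "eventually (\<lambda>z::complex. z \<noteq> 0) (at 0)"
    by (simp add: eventually_at_filter)
  ultimately have "eventually (\<lambda>z. norm (f z / g z) \<le> norm (deriv f 0 / g') + 1) (at 0)"
  proof eventually_elim
    case (elim z)
    then have "dist (f z / g z) (deriv f 0 / g') < 1" by simp
    then show ?case
      using norm_triangle_ineq2[of "f z / g z" "deriv f 0 / g'"] by (simp add: dist_norm)
  qed
  then show ?thesis by blast
qed

text \<open>The zero at the origin is simple because it comes from the single factor 1 - qexp z;
  hence dividing by the theta function creates no pole where the numerator vanishes too.\<close>

lemma jtheta_has_nonzero_derivative:
  assumes "Im \<tau> > 0"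
  obtains D where "(jtheta \<tau> has_field_derivative D) (at 0)" "D \<noteq> 0"
proof -
  have q: "norm (qexp \<tau>) < 1" using assms by (simp add: norm_qexp_less_1_iff)
  define H where "H z = qpoch (qexp z * qexp \<tau>) (qexp \<tau>) * qpoch (qexp (\<tau> - z)) (qexp \<tau>)" for z
  have H: "H holomorphic_on UNIV"
    unfolding H_def [abs_def] by (intro holomorphic_intros) (use q in auto)
  have eq: "jtheta \<tau> = (\<lambda>z. (1 - qexp z) * H z)"
    by (rule ext) (simp add: jtheta_def H_def qpoch_rec[OF q, of "qexp z" for z])
  have "qpoch (qexp \<tau>) (qexp \<tau>) \<noteq> 0"
    unfolding qpoch_eq_0_iff[OF q] qexp_power qexp_add [symmetric] qexp_eq_1_iff
  proof safe
    fix n :: nat assume "\<tau> + of_nat n * \<tau> \<in> \<int>"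
    then have "Im (\<tau> + of_nat n * \<tau>) = 0" by (metis Ints_cases Im_complex_of_real of_real_of_int_eq)
    then have "(1 + real n) * Im \<tau> = 0" by (simp add: algebra_simps)
    then show False using assms by (simp add: add_nonneg_eq_0_iff)
  qed
  then have H0: "H 0 \<noteq> 0" by (simp add: H_def)
  have dq: "((\<lambda>z. 1 - qexp z) has_field_derivative - (2 * of_real pi * \<i>)) (at 0)"
    unfolding qexp_def by (auto intro!: derivative_eq_intros)
  have "(jtheta \<tau> has_field_derivative - (2 * of_real pi * \<i>) * H 0 + deriv H 0 * (1 - qexp 0)) (at 0)"
    unfolding eq by (intro DERIV_mult dq holomorphic_derivI[OF H]) auto
  moreover have "- (2 * of_real pi * \<i>) * H 0 + deriv H 0 * (1 - qexp 0) \<noteq> 0"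
    using H0 by simp
  ultimately show ?thesis using that by blast
qed

text \<open>The quotient of the two sides is an elliptic function without poles.\<close>

lemma jtheta_modular:
  assumes \<tau>: "Im \<tau> > 0"
  obtains C where "\<And>z. jtheta (- 1 / \<tau>) (z / \<tau>)
     = C * qexp (z\<^sup>2 / (2 * \<tau>) + z * (1 / \<tau> - 1) / 2) * jtheta \<tau> z"
proof -
  have \<tau>0: "\<tau> \<noteq> 0" using \<tau> by auto
  have \<tau>': "Im (- 1 / \<tau>) > 0" using \<tau> by (rule Im_minus_inverse_pos)
  \<comment> \<open>The quadratic exponent is chosen so that \<open>f\<close> obeys the same two
    translation laws as \<open>jtheta \<tau>\<close>, under 1 and under tau.\<close>
  define Q where "Q z = z\<^sup>2 / (2 * \<tau>) + z * (1 / \<tau> - 1) / 2" for z :: complex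
  define f where "f z = jtheta (- 1 / \<tau>) (z / \<tau>) / qexp (Q z)" for z
  define \<Lambda> where "\<Lambda> = {z. jtheta \<tau> z = 0}"
  have f_hol: "f holomorphic_on UNIV"
    unfolding f_def [abs_def] Q_def using \<tau>' \<tau>0 by (intro holomorphic_intros) auto
  have f0: "f 0 = 0"
    using jtheta_eq_0_iff[OF \<tau>', of 0] by (auto simp: f_def intro: exI[of _ 0])
  have f1: "f (z + 1) = f z" for z
  proof -
    have eq: "(z + 1) / \<tau> = z / \<tau> - (- 1 / \<tau>)"
      using \<tau>0 by (simp add: field_simps)
    have "jtheta (- 1 / \<tau>) ((z + 1) / \<tau>) = - qexp (z / \<tau> - (- 1 / \<tau>)) * jtheta (- 1 / \<tau>) (z / \<tau>)"
      unfolding eq by (rule jtheta_sub_tau[OF \<tau>'])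
    moreover have "qexp (Q (z + 1)) = - qexp (z / \<tau> - (- 1 / \<tau>)) * qexp (Q z)"
    proof -
      \<comment> \<open>The sign is written as \<open>qexp (1 / 2)\<close>, so that the claim
        becomes the integrality of a difference of exponents.\<close>
      have "- qexp (z / \<tau> - (- 1 / \<tau>)) * qexp (Q z) = qexp (1 / 2 + (z / \<tau> - (- 1 / \<tau>)) + Q z)"
        by (simp add: qexp_add qexp_half)
      moreover have "1 / 2 + (z / \<tau> - (- 1 / \<tau>)) + Q z - Q (z + 1) = of_int 1"
        using \<tau>0 by (simp add: Q_def field_simps power2_eq_square)
      ultimately show ?thesis
        by (metis Ints_of_int qexp_eq_iff)
    qed
    ultimately show ?thesis by (simp add: f_def)
  qed
  have f2: "f (z + \<tau>) = - qexp (- z) * f z" for z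
  proof -
    have "(z + \<tau>) / \<tau> = z / \<tau> + 1"
      using \<tau>0 by (simp add: field_simps)
    then have "jtheta (- 1 / \<tau>) ((z + \<tau>) / \<tau>) = jtheta (- 1 / \<tau>) (z / \<tau>)"
      by (simp add: jtheta_add_1)
    moreover have "qexp (Q z) = - qexp (- z) * qexp (Q (z + \<tau>))"
    proof -
      have "- qexp (- z) * qexp (Q (z + \<tau>)) = qexp (1 / 2 + (- z) + Q (z + \<tau>))"
        by (simp only: qexp_add qexp_half) simp
      moreover have "1 / 2 + (- z) + Q (z + \<tau>) - Q z = of_int 1"
        using \<tau>0 by (simp add: Q_def field_simps power2_eq_square)
      ultimately show ?thesis
        by (metis Ints_of_int qexp_eq_iff)
    qed
    ultimately show ?thesis by (simp add: f_def field_simps)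
  qed
  define r where "r z = f z / jtheta \<tau> z" for z
  have r1: "r (z + 1) = r z" for z
    by (simp add: r_def f1 jtheta_add_1)
  have r2: "r (z + \<tau>) = r z" for z
    by (simp add: r_def f2 jtheta_add_tau[OF \<tau>])
  have \<Lambda>1: "z + 1 \<in> \<Lambda> \<longleftrightarrow> z \<in> \<Lambda>" and \<Lambda>2: "z + \<tau> \<in> \<Lambda> \<longleftrightarrow> z \<in> \<Lambda>" for z
    by (simp_all add: \<Lambda>_def jtheta_add_1 jtheta_add_tau[OF \<tau>])
  have cont: "continuous_on UNIV (jtheta \<tau>)"
    using holomorphic_on_jtheta[OF \<tau>, of "\<lambda>z. z" UNIV] holomorphic_on_imp_continuous_on by fastforce
  have open_L: "open (- \<Lambda>)"
  proof -
    have "- \<Lambda> = jtheta \<tau> -` (- {0})" by (auto simp: \<Lambda>_def)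
    then show ?thesis using open_vimage[OF _ cont, of "- {0}"] open_Compl[of "{0::complex}"] by simp
  qed
  have r_hol: "r holomorphic_on - \<Lambda>"
    unfolding r_def [abs_def] using f_hol \<tau>
    by (intro holomorphic_intros) (auto simp: \<Lambda>_def elim: holomorphic_on_subset)
  have zero_L: "0 \<in> \<Lambda>"
    unfolding \<Lambda>_def mem_Collect_eq jtheta_eq_0_iff[OF \<tau>] by (intro exI[of _ 0]) simp
  obtain D where D: "(jtheta \<tau> has_field_derivative D) (at 0)" "D \<noteq> 0"
    using jtheta_has_nonzero_derivative[OF \<tau>] .
  \<comment> \<open>The nonzero derivative isolates 0 among the zeros, so that \<open>r\<close> is
    holomorphic on a punctured ball.\<close>
  obtain \<epsilon> where \<epsilon>: "\<epsilon> > 0" "ball 0 \<epsilon> \<inter> \<Lambda> \<subseteq> {0}"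
  proof -
    have "(\<lambda>z. jtheta \<tau> z / z) \<midarrow>0\<rightarrow> D"
      using D(1) zero_L by (simp add: has_field_derivative_iff \<Lambda>_def)
    from tendsto_imp_eventually_ne[OF this D(2)]
    have "eventually (\<lambda>z. jtheta \<tau> z / z \<noteq> 0) (at 0)" .
    then obtain d where "d > 0" "\<And>z. z \<noteq> 0 \<Longrightarrow> dist z 0 < d \<Longrightarrow> jtheta \<tau> z / z \<noteq> 0"
      by (auto simp: eventually_at)
    then show ?thesis by (intro that[of d]) (fastforce simp: \<Lambda>_def)+
  qed
  have "r holomorphic_on ball 0 \<epsilon> - {0}"
    using r_hol \<epsilon> by (elim holomorphic_on_subset) blast
  moreover have "\<exists>B. eventually (\<lambda>z. norm (r z) \<le> B) (at 0)"
    unfolding r_def using eventually_norm_quotient_bounded[OF f_hol f0 D(1) _ D(2)] zero_L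
    by (simp add: \<Lambda>_def)
  ultimately obtain g where g: "g holomorphic_on ball 0 \<epsilon>" "\<And>z. z \<in> ball 0 \<epsilon> - {0} \<Longrightarrow> g z = r z"
    using holomorphic_on_extend_bounded[of r "ball 0 \<epsilon>" 0] \<epsilon>(1) by auto
  \<comment> \<open>By periodicity the value found at 0 fits at every lattice point, so one local
    extension \<open>g\<close> removes all singularities.\<close>
  define R where "R z = (if z \<in> \<Lambda> then g 0 else r z)" for z
  have R1: "R (z + 1) = R z" and R2: "R (z + \<tau>) = R z" for z
    by (simp_all add: R_def r1 r2 \<Lambda>1 \<Lambda>2)
  note R_per = lattice_periodic[of R, OF R1 R2]
  have R_ball: "R holomorphic_on ball 0 \<epsilon>"
    by (rule holomorphic_transform[OF g(1)]) (use g(2) \<epsilon> zero_L in \<open>auto simp: R_def\<close>)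
  have "R holomorphic_on UNIV"
  proof -
    have "R analytic_on {z}" for z
    proof (cases "z \<in> \<Lambda>")
      case True
      then obtain m n :: int where z: "z = of_int m * \<tau> + of_int n"
        using jtheta_eq_0_iff[OF \<tau>] by (auto simp: \<Lambda>_def)
      have "(\<lambda>w. R (w - z)) holomorphic_on ball z \<epsilon>"
      proof -
        have "(R \<circ> (\<lambda>w. w - z)) holomorphic_on ball z \<epsilon>"
          by (rule holomorphic_on_compose_gen[OF _ R_ball])
             (auto intro!: holomorphic_intros simp: dist_norm norm_minus_commute)
        then show ?thesis by (simp add: o_def)
      qed
      moreover have "R (w - z) = R w" for w
        using R_per[of "w - z" m n] by (simp add: z [symmetric])
      ultimately have "R holomorphic_on ball z \<epsilon>" by simp
      then show ?thesis
        using \<epsilon>(1) by (simp add: analytic_at_ball) blast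
    next
      case False
      have "R holomorphic_on - \<Lambda>"
        by (rule holomorphic_transform[OF r_hol]) (auto simp: R_def)
      then show ?thesis
        using False open_L analytic_at by blast
    qed
    then have "R analytic_on UNIV"
      using analytic_on_analytic_at by blast
    then show ?thesis by (rule analytic_imp_holomorphic)
  qed
  from entire_doubly_periodic_imp_constant[OF this \<tau> R1 R2]
  obtain C where C: "\<And>z. R z = C" by (auto simp: constant_on_def)
  show ?thesis
  proof
    fix z
    show "jtheta (- 1 / \<tau>) (z / \<tau>) = C * qexp (z\<^sup>2 / (2 * \<tau>) + z * (1 / \<tau> - 1) / 2) * jtheta \<tau> z"
    proof (cases "z \<in> \<Lambda>")
      case True
      then obtain m n :: int where "z = of_int m * \<tau> + of_int n"
        using jtheta_eq_0_iff[OF \<tau>] by (auto simp: \<Lambda>_def)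
      then have "z / \<tau> = of_int (- n) * (- 1 / \<tau>) + of_int m"
        using \<tau>0 by (simp add: field_simps)
      then have "jtheta (- 1 / \<tau>) (z / \<tau>) = 0"
        unfolding jtheta_eq_0_iff[OF \<tau>'] by blast
      then show ?thesis using True by (simp add: \<Lambda>_def)
    next
      case False
      then have "f z = C * jtheta \<tau> z"
        using C[of z] by (auto simp: R_def r_def \<Lambda>_def field_simps)
      then show ?thesis by (simp add: f_def Q_def field_simps)
    qed
  qed
qed

text \<open>Completing the square: the exponents of both prefactors and of the theta inversion add
  up to a term in tau alone, a real constant, and the prefactor of the new Siegel function. The term
  in tau alone is absorbed into \<open>C\<close>, which may therefore depend on tau but not on the
  index.\<close>

lemma siegel_inversion_up_to_constant:
  assumes \<tau>: "Im \<tau> > 0"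
  obtains C where "\<And>u v. siegel u v (- 1 / \<tau>)
     = C * qexp (of_real ((u + v - 2 * u * v) / 2)) * siegel v (- u) \<tau>"
proof -
  have \<tau>0: "\<tau> \<noteq> 0" using \<tau> by auto
  obtain C where C: "\<And>z. jtheta (- 1 / \<tau>) (z / \<tau>)
     = C * qexp (z\<^sup>2 / (2 * \<tau>) + z * (1 / \<tau> - 1) / 2) * jtheta \<tau> z"
    using jtheta_modular[OF \<tau>] by blast
  show ?thesis
  proof
    fix u v :: real
    define z where "z = of_real v * \<tau> - of_real u"
    define X where "X = z\<^sup>2 / (2 * \<tau>) + z * (1 / \<tau> - 1) / 2"
    have "of_real u * (- 1 / \<tau>) + of_real v = z / \<tau>"
      using \<tau>0 by (simp add: z_def field_simps)
    then have 1: "siegel u v (- 1 / \<tau>) = qexp (of_real (B2 u / 2) * (- 1 / \<tau>)) * (C * qexp X * jtheta \<tau> z)"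
      by (simp only: siegel_eq_jtheta C X_def)
    have 2: "siegel v (- u) \<tau> = qexp (of_real (B2 v / 2) * \<tau>) * jtheta \<tau> z"
      by (simp add: siegel_eq_jtheta z_def)
    have "of_real (B2 u / 2) * (- 1 / \<tau>) + X =
        (- 1 / (12 * \<tau>) - \<tau> / 12) + of_real ((u + v - 2 * u * v) / 2) + of_real (B2 v / 2) * \<tau>"
      using \<tau>0 unfolding X_def z_def B2_def
      by (simp add: field_simps power2_eq_square)
    then have 3: "qexp (of_real (B2 u / 2) * (- 1 / \<tau>)) * qexp X =
        qexp (- 1 / (12 * \<tau>) - \<tau> / 12) * qexp (of_real ((u + v - 2 * u * v) / 2)) * qexp (of_real (B2 v / 2) * \<tau>)"
      by (simp only: qexp_add [symmetric])
    have "siegel u v (- 1 / \<tau>) = C * (qexp (of_real (B2 u / 2) * (- 1 / \<tau>)) * qexp X) * jtheta \<tau> z"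
      unfolding 1 by (simp only: mult_ac)
    then show "siegel u v (- 1 / \<tau>)
       = (C * qexp (- 1 / (12 * \<tau>) - \<tau> / 12)) * qexp (of_real ((u + v - 2 * u * v) / 2)) * siegel v (- u) \<tau>"
      unfolding 2 3 by (simp only: mult_ac)
  qed
qed

lemma qpoch_mult_minus:
  assumes "norm p < 1"
  shows "qpoch x p * qpoch (- x) p = qpoch (x\<^sup>2) (p\<^sup>2)"
proof -
  have p2: "norm (p\<^sup>2) < 1"
    using assms by (simp add: norm_power power_less_one_iff)
  have "(1 - x * p ^ n) * (1 - (- x) * p ^ n) = 1 - x\<^sup>2 * (p\<^sup>2) ^ n" for n
    by (simp add: power2_eq_square power_mult_distrib algebra_simps)
  then have eq: "(\<Prod>n<N. 1 - x * p ^ n) * (\<Prod>n<N. 1 - (- x) * p ^ n) = (\<Prod>n<N. 1 - x\<^sup>2 * (p\<^sup>2) ^ n)" for N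
    by (simp add: prod.distrib [symmetric])
  have "(\<lambda>N. (\<Prod>n<N. 1 - x * p ^ n) * (\<Prod>n<N. 1 - (- x) * p ^ n)) \<longlonglongrightarrow> qpoch x p * qpoch (- x) p"
    by (intro tendsto_mult qpoch_LIMSEQ assms)
  moreover have "(\<lambda>N. \<Prod>n<N. 1 - x\<^sup>2 * (p\<^sup>2) ^ n) \<longlonglongrightarrow> qpoch (x\<^sup>2) (p\<^sup>2)"
    by (intro qpoch_LIMSEQ p2)
  ultimately show ?thesis
    unfolding eq by (rule LIMSEQ_unique)
qed

text \<open>The three factors are the squares of the Weber functions, whose product is the square
  root of 2. The powers of q cancel and Euler's identity disposes of the products; the 2 is the
  factor 1 - (-1) of \<open>siegel 0 (1/2)\<close>.\<close>

lemma siegel_two_torsion_product: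
  assumes "Im \<tau> > 0"
  shows "siegel (1/2) 0 \<tau> * siegel 0 (1/2) \<tau> * siegel (1/2) (1/2) \<tau> = 2"
proof -
  define x where "x = qexp (\<tau> / 2)"
  have x2: "qexp \<tau> = x\<^sup>2" by (simp add: x_def qexp_power)
  have q: "norm (x\<^sup>2) < 1" using assms by (simp add: norm_qexp_less_1_iff flip: x2)
  have half: "qexp (\<tau> - \<tau> / 2) = x"
    unfolding x_def by (rule arg_cong[where f = qexp]) (simp add: field_simps)
  have minus: "qexp (\<tau> / 2 + 1 / 2) = - x" "qexp (\<tau> - \<tau> / 2 - 1 / 2) = - x" "qexp (\<tau> - 1 / 2) = - x\<^sup>2"
    unfolding qexp_add qexp_diff qexp_half x2 by (auto simp: x_def power2_eq_square)
  have 1: "siegel (1/2) 0 \<tau> = qexp (- \<tau> / 24) * qpoch x (x\<^sup>2) * qpoch x (x\<^sup>2)"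
    using half by (simp add: siegel_def x2 B2_def power2_eq_square[of "1/2"] x_def)
  have 2: "siegel 0 (1/2) \<tau> = qexp (\<tau> / 12) * (2 * qpoch (- x\<^sup>2) (x\<^sup>2)) * qpoch (- x\<^sup>2) (x\<^sup>2)"
    using qpoch_rec[OF q, of "-1"] minus by (simp add: siegel_def x2 B2_def qexp_half)
  have 3: "siegel (1/2) (1/2) \<tau> = qexp (- \<tau> / 24) * qpoch (- x) (x\<^sup>2) * qpoch (- x) (x\<^sup>2)"
    using minus by (simp add: siegel_def x2 B2_def power2_eq_square[of "1/2"])
  have 4: "qpoch x (x\<^sup>2) * qpoch (- x) (x\<^sup>2) * qpoch (- x\<^sup>2) (x\<^sup>2) = 1"
    using qpoch_Euler[OF q] by (simp add: qpoch_mult_minus[OF q])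
  have 5: "qexp (- \<tau> / 24) * qexp (\<tau> / 12) * qexp (- \<tau> / 24) = 1"
    unfolding qexp_add [symmetric] by (simp add: field_simps)
  have "siegel (1/2) 0 \<tau> * siegel 0 (1/2) \<tau> * siegel (1/2) (1/2) \<tau>
      = 2 * (qexp (- \<tau> / 24) * qexp (\<tau> / 12) * qexp (- \<tau> / 24)) *
        (qpoch x (x\<^sup>2) * qpoch (- x) (x\<^sup>2) * qpoch (- x\<^sup>2) (x\<^sup>2))\<^sup>2"
    unfolding 1 2 3 by (simp only: power2_eq_square mult_ac)
  then show ?thesis by (simp only: 4 5) simp
qed

text \<open>The product over the three points of order two is constant, which determines \<open>C ^ 3\<close>;
  the continuous function \<open>C\<close> is then constant, with the value \<open>- \<i>\<close> at the fixed point \<open>\<i>\<close>.\<close>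

theorem siegel_inversion:
  assumes \<tau>: "Im \<tau> > 0"
  shows "siegel u v (- 1 / \<tau>) = - \<i> * qexp (of_real ((u + v - 2 * u * v) / 2)) * siegel v (- u) \<tau>"
proof -
  \<comment> \<open>Inversion sends (1/2, 1/2) to (1/2, -1/2), which is the same index modulo
    integers in \<open>v\<close>; so \<open>C\<close> compares one function at two points. The \<i>
    is the value of the known root of unity at this index.\<close>
  define C where "C \<tau> = siegel (1/2) (1/2) (- 1 / \<tau>) / (\<i> * siegel (1/2) (1/2) \<tau>)" for \<tau>
  have nz: "siegel (1/2) (1/2) \<tau> \<noteq> 0" if "Im \<tau> > 0" for \<tau>
    using siegel_two_torsion_product[OF that] by auto
  have neg: "siegel u (- (1 / 2)) \<tau> = siegel u (1 / 2) \<tau>" for u \<tau>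
    using siegel_add_int_right[of u "- (1 / 2)" 1 \<tau>] by (simp del: siegel_add_int_right)
  have C: "siegel u v (- 1 / \<tau>) = C \<tau> * qexp (of_real ((u + v - 2 * u * v) / 2)) * siegel v (- u) \<tau>"
    if \<tau>: "Im \<tau> > 0" for u v \<tau>
  proof -
    obtain C' where C': "\<And>u v. siegel u v (- 1 / \<tau>)
       = C' * qexp (of_real ((u + v - 2 * u * v) / 2)) * siegel v (- u) \<tau>"
      using siegel_inversion_up_to_constant[OF \<tau>] by blast
    have "siegel (1/2) (1/2) (- 1 / \<tau>) = C' * \<i> * siegel (1/2) (1/2) \<tau>"
      using C'[of "1/2" "1/2"] by (simp add: neg qexp_quarter)
    then have "C \<tau> = C'"
      using nz[OF \<tau>] by (simp add: C_def field_simps)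
    with C' show ?thesis by simp
  qed
  \<comment> \<open>Inversion permutes the three points of order two, each with root of unity \<i>;
    their product contributes \<i>^3 = -\<i>.\<close>
  have C3: "C \<tau> ^ 3 = \<i>" if \<tau>: "Im \<tau> > 0" for \<tau>
  proof -
    have \<tau>': "Im (- 1 / \<tau>) > 0" using \<tau> by (rule Im_minus_inverse_pos)
    have "siegel (1/2) 0 (- 1 / \<tau>) * siegel 0 (1/2) (- 1 / \<tau>) * siegel (1/2) (1/2) (- 1 / \<tau>)
        = - \<i> * C \<tau> ^ 3 * (siegel (1/2) 0 \<tau> * siegel 0 (1/2) \<tau> * siegel (1/2) (1/2) \<tau>)"
      unfolding C[OF \<tau>] by (simp add: neg qexp_quarter power3_eq_cube algebra_simps)
    then have "2 * (- \<i> * C \<tau> ^ 3) = 2 * 1"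
      unfolding siegel_two_torsion_product[OF \<tau>] siegel_two_torsion_product[OF \<tau>'] by (simp add: mult_ac)
    then have "- \<i> * C \<tau> ^ 3 = 1"
      by (metis mult_cancel_left zero_neq_numeral)
    then have "\<i> * (- \<i> * C \<tau> ^ 3) = \<i>" by (simp only: mult_1_right)
    then show ?thesis by simp
  qed
  have "continuous_on upper_half_plane C"
  proof -
    have "continuous_on upper_half_plane (siegel (1/2) (1/2))"
      by (intro holomorphic_on_imp_continuous_on holomorphic_intros)
    moreover from this have "continuous_on upper_half_plane (\<lambda>\<tau>. siegel (1/2) (1/2) (- 1 / \<tau>))"
      by (rule continuous_on_compose2) (use Im_minus_inverse_pos in \<open>auto intro!: continuous_intros\<close>)
    ultimately show ?thesis
      unfolding C_def by (intro continuous_intros) (use nz in auto)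
  qed
  moreover have "connected upper_half_plane"
    unfolding upper_half_plane_def by (intro convex_connected convex_halfspace_Im_gt)
  moreover have "finite (C ` upper_half_plane)"
    by (rule finite_subset[of _ "{z. z ^ 3 = \<i>}"]) (auto simp: C3 intro: finite_nth_roots)
  ultimately have "C constant_on upper_half_plane"
    using continuous_finite_range_constant by blast
  then have "C \<tau> = C \<i>"
    using \<tau> unfolding constant_on_def by force
  moreover have "C \<i> = - \<i>"
    using nz[of \<i>] by (simp add: C_def)
  ultimately show ?thesis using C[OF \<tau>] by simp
qed

text \<open>Euclid's algorithm on the bottom row. The generators multiply from the right, which for
  Moebius maps means substituting tau + 1, tau - 1 or -1/tau into the argument.\<close>

lemma SL2Z_induct [consumes 1, case_names id T T_inv S]:
  fixes a b c d :: int
  assumes det: "a * d - b * c = 1"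
    and id: "P 1 0 0 1"
    and T: "\<And>a b c d. a * d - b * c = 1 \<Longrightarrow> P a b c d \<Longrightarrow> P a (a + b) c (c + d)"
    and T_inv: "\<And>a b c d. a * d - b * c = 1 \<Longrightarrow> P a b c d \<Longrightarrow> P a (b - a) c (d - c)"
    and S: "\<And>a b c d. a * d - b * c = 1 \<Longrightarrow> P a b c d \<Longrightarrow> P b (- a) d (- c)"
  shows "P a b c d"
proof -
  have T_int: "P a (b + k * a) c (d + k * c)" if "P a b c d" "a * d - b * c = 1" for a b c d k
  proof (induction k rule: int_induct[where k = 0])
    case (step1 i)
    have "a * (d + i * c) - (b + i * a) * c = 1" using that(2) by (simp add: algebra_simps)
    from T[OF this step1(2)] show ?case by (simp add: algebra_simps)
  next
    case (step2 i)
    have "a * (d + i * c) - (b + i * a) * c = 1" using that(2) by (simp add: algebra_simps)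
    from T_inv[OF this step2(2)] show ?case by (simp add: algebra_simps)
  qed (use that in auto)
  \<comment> \<open>S has order 4, so its inverse is S applied three times.\<close>
  have S3: "P a b c d" if "P b (- a) d (- c)" "a * d - b * c = 1" for a b c d
  proof -
    have "P (- a) (- b) (- c) (- d)"
      using S[OF _ that(1)] that(2) by (simp add: algebra_simps)
    then have "P (- b) a (- d) c"
      using S[of "- a" "- d" "- b" "- c"] that(2) by (simp add: algebra_simps)
    then show ?thesis
      using S[of "- b" c a "- d"] that(2) by (simp add: algebra_simps)
  qed
  show ?thesis
    using det
  proof (induction "nat \<bar>c\<bar>" arbitrary: a b c d rule: less_induct)
    case less
    show ?case
    proof (cases "c = 0")
      case True
      with less.prems have "a = 1 \<and> d = 1 \<or> a = -1 \<and> d = -1"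
        using zmult_eq_1_iff[of a d] by auto
      moreover have "P (- 1) 0 0 (- 1)"
        using S[OF _ S[OF _ id]] by simp
      from T_int[OF this, of "- b"] have "P (- 1) b 0 (- 1)" by simp
      moreover have "P 1 b 0 1"
        using T_int[OF id, of b] by simp
      ultimately show ?thesis using True by auto
    next
      case False
      \<comment> \<open>The sign of \<open>c\<close> is built in because the remainder is taken
        modulo \<open>\<bar>c\<bar>\<close> while \<open>k\<close> multiplies
        \<open>c\<close>.\<close>
      define k where "k = - sgn c * (d div \<bar>c\<bar>)"
      have k: "d + k * c = d mod \<bar>c\<bar>"
        unfolding k_def using div_mult_mod_eq[of d "\<bar>c\<bar>"] abs_sgn[of c]
        by (metis (no_types, opaque_lifting) add.commute add_diff_cancel_right' diff_minus_eq_add linordered_idom_class.abs_sgn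
            minus_mult_left mult.assoc mult.commute uminus_add_conv_diff)
      have det': "a * (d + k * c) - (b + k * a) * c = 1"
        using less.prems by (simp add: algebra_simps)
      have "nat \<bar>d + k * c\<bar> < nat \<bar>c\<bar>"
        unfolding k using False by simp
      moreover have "(b + k * a) * (- c) - (- a) * (d + k * c) = 1"
        using det' by (simp add: algebra_simps)
      ultimately have "P (b + k * a) (- a) (d + k * c) (- c)"
        by (rule less.hyps)
      then have "P a (b + k * a) c (d + k * c)"
        using S3 det' by blast
      from T_int[OF this det', of "- k"] show ?thesis by simp
    qed
  qed
qed

text \<open>\<open>exp (2 * pi * \<i> * eta_exp a b c d / 12)\<close> is the multiplier of the square of the
  Dedekind eta function.\<close>

definition eta_exp :: "int \<Rightarrow> int \<Rightarrow> int \<Rightarrow> int \<Rightarrow> int" where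
  "eta_exp a b c d = (1 - c * c) * (b * d + 3 * (c - 1) * d + c + 3) + c * (a + d - 3)"

lemma eta_exp_cong:
  assumes "[a = a'] (mod m)" "[b = b'] (mod m)" "[c = c'] (mod m)" "[d = d'] (mod m)"
  shows "[eta_exp a b c d = eta_exp a' b' c' d'] (mod m)"
  unfolding eta_exp_def by (intro cong_add cong_mult cong_diff cong_refl assms)

text \<open>Both sides depend only on residues, so evaluation over all quadruples decides the claim.
  Working modulo 3 and 4 separately leaves 81 + 256 quadruples instead of 12^4. Right multiplication
  by T adds 1; S adds -3, which stands for the factor -\<i>.\<close>

lemma eta_exp_cocycle_mod_3_4:
  fixes a b c d :: int
  assumes m: "m = 3 \<or> m = 4" and det: "a * d - b * c = 1"
  shows "[eta_exp a (a + b) c (c + d) = eta_exp a b c d + 1] (mod m)"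
    and "[eta_exp b (- a) d (- c) = eta_exp a b c d - 3] (mod m)"
proof -
  have fin: "\<forall>m\<in>set [3, 4]. \<forall>a\<in>set [0..m-1]. \<forall>b\<in>set [0..m-1]. \<forall>c\<in>set [0..m-1]. \<forall>d\<in>set [0..m-1].
     (a * d - b * c - 1) mod m = 0 \<longrightarrow>
     (eta_exp a (a + b) c (c + d) - eta_exp a b c d - 1) mod m = 0 \<and>
     (eta_exp b (- a) d (- c) - eta_exp a b c d + 3) mod m = 0"
    by code_simp
  have r: "[x mod m = x] (mod m)" "x mod m \<in> set [0..m-1]" "m \<in> set [3, 4]" for x :: int
    using m by auto
  have "[a mod m * (d mod m) - b mod m * (c mod m) - 1 = a * d - b * c - 1] (mod m)"
    by (intro cong_diff cong_mult cong_refl r)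
  then have "(a mod m * (d mod m) - b mod m * (c mod m) - 1) mod m = 0"
    using det by (simp add: cong_def)
  with fin r have
    1: "[eta_exp (a mod m) (a mod m + b mod m) (c mod m) (c mod m + d mod m) - eta_exp (a mod m) (b mod m) (c mod m) (d mod m) - 1 = 0] (mod m)"
    and 2: "[eta_exp (b mod m) (- (a mod m)) (d mod m) (- (c mod m)) - eta_exp (a mod m) (b mod m) (c mod m) (d mod m) + 3 = 0] (mod m)"
    unfolding cong_def by (metis mod_0)+
  have "[eta_exp (a mod m) (a mod m + b mod m) (c mod m) (c mod m + d mod m) - eta_exp (a mod m) (b mod m) (c mod m) (d mod m) - 1
       = eta_exp a (a + b) c (c + d) - eta_exp a b c d - 1] (mod m)"
    by (intro cong_diff eta_exp_cong cong_add cong_refl r)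
  with 1 show "[eta_exp a (a + b) c (c + d) = eta_exp a b c d + 1] (mod m)"
    by (metis cong_diff_iff_cong_0 cong_sym_eq cong_trans diff_diff_add)
  have "[eta_exp (b mod m) (- (a mod m)) (d mod m) (- (c mod m)) - eta_exp (a mod m) (b mod m) (c mod m) (d mod m) + 3
       = eta_exp b (- a) d (- c) - eta_exp a b c d + 3] (mod m)"
    by (intro cong_diff eta_exp_cong cong_add cong_refl r cong_uminus)
  with 2 show "[eta_exp b (- a) d (- c) = eta_exp a b c d - 3] (mod m)"
    by (metis cong_diff_iff_cong_0 cong_sym_eq cong_trans diff_diff_eq2 add.commute add_diff_eq)
qed

lemma eta_exp_cocycle:
  fixes a b c d :: int
  assumes det: "a * d - b * c = 1"
  shows "[eta_exp a (a + b) c (c + d) = eta_exp a b c d + 1] (mod 12)"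
    and "[eta_exp b (- a) d (- c) = eta_exp a b c d - 3] (mod 12)"
proof -
  have *: "[x = y] (mod 12)" if "[x = y] (mod 3)" "[x = y] (mod 4)" for x y :: int
    using that unfolding cong_iff_dvd_diff by presburger
  show "[eta_exp a (a + b) c (c + d) = eta_exp a b c d + 1] (mod 12)"
    and "[eta_exp b (- a) d (- c) = eta_exp a b c d - 3] (mod 12)"
    by (intro * eta_exp_cocycle_mod_3_4[OF _ det]; simp)+
qed

lemma qexp_eq_if_cong_12:
  assumes "[x = y] (mod (12::int))" "r - s = of_int (x - y) / 12"
  shows "qexp (of_real r) = qexp (of_real s)"
proof -
  obtain k where "x - y = 12 * k"
    using assms(1) by (auto simp: cong_iff_dvd_diff)
  then have "of_real r - of_real s = (of_int k :: complex)"
    using assms(2) by (simp flip: of_real_diff)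
  then show ?thesis unfolding qexp_eq_iff by simp
qed

section \<open>Moebius maps and the general transformation law\<close>

lemma mobius_denominator_nonzero:
  fixes c d :: int
  assumes "Im \<tau> > 0" "c \<noteq> 0 \<or> d \<noteq> 0"
  shows "of_int c * \<tau> + of_int d \<noteq> 0"
proof
  assume *: "of_int c * \<tau> + of_int d = 0"
  from arg_cong[OF *, of Im] assms have "c = 0" by simp
  with * assms show False by simp
qed

lemma Im_mobius:
  assumes "a * d - b * c = 1"
  shows "Im (mobius a b c d \<tau>) = Im \<tau> / (norm (of_int c * \<tau> + of_int d))\<^sup>2"
proof -
  have "real_of_int a * real_of_int d - real_of_int b * real_of_int c = 1"
    using assms by (simp flip: of_int_mult of_int_diff)
  then have "Im \<tau> * (real_of_int a * real_of_int d - real_of_int b * real_of_int c) = Im \<tau>"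
    by simp
  then show ?thesis
    unfolding mobius_def Im_divide cmod_power2 by (simp add: algebra_simps)
qed

lemma Im_mobius_pos:
  assumes "a * d - b * c = 1" "Im \<tau> > 0"
  shows "Im (mobius a b c d \<tau>) > 0"
proof -
  have "c \<noteq> 0 \<or> d \<noteq> 0" using assms(1) by auto
  from mobius_denominator_nonzero[OF assms(2) this] show ?thesis
    using assms by (simp add: Im_mobius)
qed

text \<open>Klein forms transform without a multiplier.  The first summand comes from the square of the
  eta function, the second from normalising the leading coefficient of the product of the two.\<close>

definition siegel_exp :: "int \<Rightarrow> int \<Rightarrow> int \<Rightarrow> int \<Rightarrow> real \<Rightarrow> real \<Rightarrow> real" where
  "siegel_exp a b c d u v = of_int (eta_exp a b c d) / 12 +
     ((u * of_int a + v * of_int c) * (u * of_int b + v * of_int d) - u * v + v - (u * of_int b + v * of_int d)) / 2"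

text \<open>Induction on the generators, with \<open>siegel_translate\<close> for T and its inverse
  and \<open>siegel_inversion\<close> for S. In each step the quadratic and linear parts of the
  exponent match exactly; only the eta parts differ, by a multiple of 12.\<close>

theorem siegel_mobius:
  assumes det: "a * d - b * c = 1" and \<tau>: "Im \<tau> > 0"
  shows "siegel u v (mobius a b c d \<tau>) = qexp (of_real (siegel_exp a b c d u v)) *
           siegel (u * of_int a + v * of_int c) (u * of_int b + v * of_int d) \<tau>"
  using det \<tau>
proof (induction arbitrary: \<tau> rule: SL2Z_induct)
  case id
  then show ?case by (simp add: mobius_def siegel_exp_def eta_exp_def)
next
  case (T a b c d)
  define u' v' where "u' = u * of_int a + v * of_int c" and "v' = u * of_int b + v * of_int d"
  have "mobius a (a + b) c (c + d) \<tau> = mobius a b c d (\<tau> + 1)"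
    by (simp add: mobius_def algebra_simps)
  also have "siegel u v \<dots> = qexp (of_real (siegel_exp a b c d u v)) * siegel u' v' (\<tau> + of_int 1)"
    using T.IH[of "\<tau> + 1"] T.prems by (simp add: u'_def v'_def)
  also have "\<dots> = qexp (of_real (siegel_exp a b c d u v + B2 u' / 2)) * siegel u' (v' + u') \<tau>"
    unfolding siegel_translate by (simp add: qexp_add)
  also have "qexp (of_real (siegel_exp a b c d u v + B2 u' / 2)) = qexp (of_real (siegel_exp a (a + b) c (c + d) u v))"
    by (rule qexp_eq_if_cong_12[OF cong_sym[OF eta_exp_cocycle(1)[OF T.hyps]]])
       (simp add: siegel_exp_def B2_def u'_def power2_eq_square field_simps)
  finally show ?case by (simp add: u'_def v'_def algebra_simps)
next
  case (T_inv a b c d)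
  define u' v' where "u' = u * of_int a + v * of_int c" and "v' = u * of_int b + v * of_int d"
  have det: "a * (d - c) - (b - a) * c = 1" using T_inv.hyps by (simp add: algebra_simps)
  have "mobius a (b - a) c (d - c) \<tau> = mobius a b c d (\<tau> - 1)"
    by (simp add: mobius_def algebra_simps)
  also have "siegel u v \<dots> = qexp (of_real (siegel_exp a b c d u v)) * siegel u' v' (\<tau> + of_int (- 1))"
    using T_inv.IH[of "\<tau> - 1"] T_inv.prems by (simp add: u'_def v'_def)
  also have "\<dots> = qexp (of_real (siegel_exp a b c d u v - B2 u' / 2)) * siegel u' (v' - u') \<tau>"
  proof -
    have "qexp (of_real (siegel_exp a b c d u v)) * qexp (of_real (of_int (- 1) * B2 u' / 2))
        = qexp (of_real (siegel_exp a b c d u v - B2 u' / 2))"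
      unfolding qexp_add [symmetric] of_real_add [symmetric] by simp
    moreover have "v' + of_int (- 1) * u' = v' - u'" by simp
    ultimately show ?thesis
      unfolding siegel_translate by (simp only: mult.assoc [symmetric])
  qed
  also have "qexp (of_real (siegel_exp a b c d u v - B2 u' / 2)) = qexp (of_real (siegel_exp a (b - a) c (d - c) u v))"
    using eta_exp_cocycle(1)[OF det]
    by (intro qexp_eq_if_cong_12[of "eta_exp a b c d" "eta_exp a (b - a) c (d - c) + 1"])
       (simp_all add: siegel_exp_def B2_def u'_def power2_eq_square field_simps)
  finally show ?case by (simp add: u'_def v'_def algebra_simps)
next
  case (S a b c d)
  define u' v' where "u' = u * of_int a + v * of_int c" and "v' = u * of_int b + v * of_int d"
  have \<tau>0: "\<tau> \<noteq> 0" using S.prems by auto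
  have "mobius b (- a) d (- c) \<tau> = mobius a b c d (- 1 / \<tau>)"
    using \<tau>0 by (simp add: mobius_def divide_simps)
  also have "siegel u v \<dots> = qexp (of_real (siegel_exp a b c d u v)) * siegel u' v' (- 1 / \<tau>)"
    using S.IH[OF Im_minus_inverse_pos[OF S.prems]] by (simp only: u'_def v'_def)
  also have "\<dots> = qexp (of_real (siegel_exp a b c d u v - 1 / 4 + (u' + v' - 2 * u' * v') / 2)) * siegel v' (- u') \<tau>"
  proof -
    have "qexp (of_real (r - 1 / 4 + s)) = qexp (of_real r) * (- \<i>) * qexp (of_real s)" for r s
      unfolding of_real_add of_real_diff qexp_add qexp_diff by (simp add: qexp_quarter)
    then show ?thesis
      unfolding siegel_inversion[OF S.prems] by (simp only: mult_ac)
  qed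
  also have "qexp (of_real (siegel_exp a b c d u v - 1 / 4 + (u' + v' - 2 * u' * v') / 2))
      = qexp (of_real (siegel_exp b (- a) d (- c) u v))"
    by (rule qexp_eq_if_cong_12[OF cong_sym[OF eta_exp_cocycle(2)[OF S.hyps]]])
       (simp add: siegel_exp_def u'_def v'_def field_simps)
  finally show ?case by (simp add: u'_def v'_def algebra_simps)
qed

section \<open>Expansions at the cusps\<close>

lemma siegel_add_int_left:
  assumes "Im \<tau> > 0"
  shows "siegel (u + of_int n) v \<tau> = qexp (of_real (of_int n * (1 / 2 - v))) * siegel u v \<tau>"
proof -
  have *: "siegel (u + 1) v \<tau> = qexp (of_real (1 / 2 - v)) * siegel u v \<tau>" for u
  proof -
    have "qexp (of_real (1 / 2 - v)) = - qexp (- of_real v)"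
      unfolding of_real_diff qexp_diff by (simp add: qexp_half qexp_minus inverse_eq_divide)
    then show ?thesis by (simp only: siegel_add_1_left[OF assms])
  qed
  show ?thesis
  proof (induction n rule: int_induct[where k = 0])
    case (step1 i)
    have "siegel (u + of_int (i + 1)) v \<tau> = siegel (u + of_int i + 1) v \<tau>"
      by (simp add: add_ac)
    also have "\<dots> = qexp (of_real (1 / 2 - v)) * qexp (of_real (of_int i * (1 / 2 - v))) * siegel u v \<tau>"
      by (simp only: * step1(2) mult.assoc)
    also have "qexp (of_real (1 / 2 - v)) * qexp (of_real (of_int i * (1 / 2 - v)))
        = qexp (of_real (of_int (i + 1) * (1 / 2 - v)))"
      unfolding qexp_add [symmetric] of_real_add [symmetric] by (simp add: algebra_simps add_divide_distrib)
    finally show ?case .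
  next
    case (step2 i)
    have "siegel (u + of_int i) v \<tau> = siegel (u + of_int (i - 1) + 1) v \<tau>"
      by (simp add: add_ac)
    then have "siegel (u + of_int (i - 1)) v \<tau>
        = qexp (- of_real (1 / 2 - v)) * qexp (of_real (of_int i * (1 / 2 - v))) * siegel u v \<tau>"
      unfolding * step2(2) qexp_minus by (simp add: field_simps)
    also have "qexp (- of_real (1 / 2 - v)) * qexp (of_real (of_int i * (1 / 2 - v)))
        = qexp (of_real (of_int (i - 1) * (1 / 2 - v)))"
      unfolding qexp_add [symmetric] of_real_add [symmetric] of_real_minus [symmetric] by (simp add: algebra_simps diff_divide_distrib)
    finally show ?case .
  qed simp
qed

text \<open>A power of q times a germ in q^(1/M) that does not vanish at 0. Working with the germ
  \<open>G\<close> instead of Fourier coefficients makes products and inverses immediate; the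
  rationality of \<open>A\<close> is kept because the expansion of a modular function must start at
  a rational exponent.\<close>

definition cusp_unit :: "(complex \<Rightarrow> complex) \<Rightarrow> real \<Rightarrow> bool" where
  "cusp_unit f A \<longleftrightarrow> A \<in> \<rat> \<and> (\<exists>M>0. \<exists>r>0. \<exists>G. G holomorphic_on ball 0 r \<and> G 0 \<noteq> 0 \<and>
     (\<exists>Y. \<forall>\<tau>. Im \<tau> > Y \<longrightarrow> f \<tau> = qpow A \<tau> * G (qpow (1 / real M) \<tau>)))"

section \<open>Closure properties of functions with a leading power\<close>

lemma cusp_unitI:
  assumes "A \<in> \<rat>" "M > 0" "r > 0" "G holomorphic_on ball 0 r" "G 0 \<noteq> 0"
    "\<And>\<tau>. Im \<tau> > Y \<Longrightarrow> f \<tau> = qpow A \<tau> * G (qpow (1 / real M) \<tau>)"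
  shows "cusp_unit f A"
  using assms unfolding cusp_unit_def by blast

lemma cusp_unitE:
  assumes "cusp_unit f A"
  obtains M r G Y where "A \<in> \<rat>" "M > 0" "r > 0" "G holomorphic_on ball 0 r" "G 0 \<noteq> 0"
    "\<And>\<tau>. Im \<tau> > Y \<Longrightarrow> f \<tau> = qpow A \<tau> * G (qpow (1 / real M) \<tau>)"
  using assms unfolding cusp_unit_def by blast

lemma qpow_add: "qpow (a + b) \<tau> = qpow a \<tau> * qpow b \<tau>"
  by (simp add: qpow_eq_qexp qexp_add ring_distribs)

lemma qpow_minus: "qpow (- a) \<tau> = inverse (qpow a \<tau>)"
  by (simp add: qpow_eq_qexp qexp_minus)

lemma qpow_nonzero [simp]: "qpow a \<tau> \<noteq> 0"
  by (simp add: qpow_eq_qexp)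

lemma qpow_power: "qpow a \<tau> ^ n = qpow (a * n) \<tau>"
  by (simp add: qpow_eq_qexp qexp_power mult_ac)

lemma holomorphic_on_ball_power:
  assumes "G holomorphic_on ball 0 r" "k > 0" "s \<le> r" "s \<le> 1"
  shows "(\<lambda>x. G (x ^ k)) holomorphic_on ball 0 s"
proof -
  have "x ^ k \<in> ball 0 r" if "x \<in> ball 0 s" for x :: complex
  proof -
    have "norm x ^ k \<le> norm x ^ 1"
      using that assms by (intro power_decreasing) auto
    then show ?thesis using that assms by (simp add: norm_power)
  qed
  then have "(G \<circ> (\<lambda>x. x ^ k)) holomorphic_on ball 0 s"
    by (intro holomorphic_on_compose_gen[OF _ assms(1)] holomorphic_intros) auto
  then show ?thesis by (simp add: o_def)
qed

lemma cusp_unit_mult: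
  assumes "cusp_unit f A" "cusp_unit g B"
  shows "cusp_unit (\<lambda>\<tau>. f \<tau> * g \<tau>) (A + B)"
proof -
  obtain M r G Y where f: "A \<in> \<rat>" "M > 0" "r > 0" "G holomorphic_on ball 0 r" "G 0 \<noteq> 0"
    "\<And>\<tau>. Im \<tau> > Y \<Longrightarrow> f \<tau> = qpow A \<tau> * G (qpow (1 / real M) \<tau>)"
    using assms(1) by (rule cusp_unitE) blast
  obtain M' r' G' Y' where g: "B \<in> \<rat>" "M' > 0" "r' > 0" "G' holomorphic_on ball 0 r'" "G' 0 \<noteq> 0"
    "\<And>\<tau>. Im \<tau> > Y' \<Longrightarrow> g \<tau> = qpow B \<tau> * G' (qpow (1 / real M') \<tau>)"
    using assms(2) by (rule cusp_unitE) blast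
  show ?thesis
  proof (rule cusp_unitI)
    \<comment> \<open>Both local parameters are powers of q^(1/(M M')); radius at most 1 ensures
      that taking powers does not leave the discs.\<close>
    show "(\<lambda>x. G (x ^ M') * G' (x ^ M)) holomorphic_on ball 0 (min 1 (min r r'))"
      using f g by (intro holomorphic_on_mult holomorphic_on_ball_power[of _ r] holomorphic_on_ball_power[of _ r']) auto
    show "f \<tau> * g \<tau> = qpow (A + B) \<tau> *
        (G (qpow (1 / real (M * M')) \<tau> ^ M') * G' (qpow (1 / real (M * M')) \<tau> ^ M))"
      if "Im \<tau> > max Y Y'" for \<tau>
      using that f g by (simp add: qpow_power qpow_add mult_ac)
  qed (use f g in \<open>auto simp: zero_power\<close>)
qed

lemma cusp_unit_inverse:
  assumes "cusp_unit f A"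
  shows "cusp_unit (\<lambda>\<tau>. inverse (f \<tau>)) (- A)"
proof -
  obtain M r G Y where f: "A \<in> \<rat>" "M > 0" "r > 0" "G holomorphic_on ball 0 r" "G 0 \<noteq> 0"
    "\<And>\<tau>. Im \<tau> > Y \<Longrightarrow> f \<tau> = qpow A \<tau> * G (qpow (1 / real M) \<tau>)"
    using assms by (rule cusp_unitE) blast
  have "continuous_on (ball 0 r) G"
    using f holomorphic_on_imp_continuous_on by blast
  then have "isCont G 0"
    using f by (simp add: continuous_on_eq_continuous_at)
  from tendsto_imp_eventually_ne[OF isContD[OF this] f(5)]
  obtain s where s: "s > 0" "\<And>x. x \<noteq> 0 \<Longrightarrow> norm x < s \<Longrightarrow> G x \<noteq> 0"
    by (auto simp: eventually_at)
  then have s0: "G x \<noteq> 0" if "norm x < s" for x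
    using that f(5) by (cases "x = 0") auto
  show ?thesis
  proof (rule cusp_unitI)
    show "(\<lambda>x. inverse (G x)) holomorphic_on ball 0 (min r s)"
      using f s0 by (intro holomorphic_on_inverse) (auto elim: holomorphic_on_subset)
    show "inverse (f \<tau>) = qpow (- A) \<tau> * inverse (G (qpow (1 / real M) \<tau>))" if "Im \<tau> > Y" for \<tau>
      using that f by (simp add: qpow_minus)
  qed (use f s in auto)
qed

lemma cusp_unit_const: "c \<noteq> 0 \<Longrightarrow> cusp_unit (\<lambda>_. c) 0"
  by (rule cusp_unitI[where M = 1 and r = 1 and G = "\<lambda>_. c" and Y = 0]) (auto simp: qpow_eq_qexp)

lemma cusp_unit_cmult:
  assumes "cusp_unit f A" "c \<noteq> 0"
  shows "cusp_unit (\<lambda>\<tau>. c * f \<tau>) A"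
  using cusp_unit_mult[OF cusp_unit_const[OF assms(2)] assms(1)] by simp

lemma cusp_unit_power:
  assumes "cusp_unit f A"
  shows "cusp_unit (\<lambda>\<tau>. f \<tau> ^ n) (real n * A)"
proof (induction n)
  case (Suc n)
  show ?case using cusp_unit_mult[OF assms Suc.IH] by (simp add: algebra_simps)
qed (simp add: cusp_unit_const)

lemma cusp_unit_powi:
  assumes "cusp_unit f A"
  shows "cusp_unit (\<lambda>\<tau>. f \<tau> powi n) (of_int n * A)"
proof (cases "n \<ge> 0")
  case True
  then show ?thesis using cusp_unit_power[OF assms, of "nat n"] by (simp add: power_int_def)
next
  case False
  then show ?thesis using cusp_unit_power[OF cusp_unit_inverse[OF assms], of "nat (- n)"]
    by (simp add: power_int_def)
qed

lemma cusp_unit_prod: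
  assumes "finite I" "\<And>i. i \<in> I \<Longrightarrow> \<exists>A. cusp_unit (f i) A"
  shows "\<exists>A. cusp_unit (\<lambda>\<tau>. \<Prod>i\<in>I. f i \<tau>) A"
  using assms
proof (induction rule: finite_induct)
  case empty
  then show ?case using cusp_unit_const[of 1] by auto
next
  case (insert i I)
  then obtain A B where "cusp_unit (f i) A" "cusp_unit (\<lambda>\<tau>. \<Prod>i\<in>I. f i \<tau>) B" by blast
  from cusp_unit_mult[OF this] insert.hyps show ?case by auto
qed

lemma cusp_unit_cong:
  assumes "cusp_unit f A" "\<And>\<tau>. Im \<tau> > 0 \<Longrightarrow> f \<tau> = g \<tau>"
  shows "cusp_unit g A"
proof -
  obtain M r G Y where f: "A \<in> \<rat>" "M > 0" "r > 0" "G holomorphic_on ball 0 r" "G 0 \<noteq> 0"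
    "\<And>\<tau>. Im \<tau> > Y \<Longrightarrow> f \<tau> = qpow A \<tau> * G (qpow (1 / real M) \<tau>)"
    using assms(1) by (rule cusp_unitE) blast
  then show ?thesis
    using assms(2) by (intro cusp_unitI[where M = M and r = r and G = G and Y = "max 0 Y"]) (auto simp flip: assms(2))
qed

text \<open>The action of the upper triangular matrices left over by
  \<open>scaled_mobius_decomposition\<close>: the exponent is scaled by p/t, and the translation by
  s/t contributes roots of unity that go into the germ.\<close>

lemma cusp_unit_affine:
  fixes s :: int
  assumes "cusp_unit f A" "p > 0" "t > 0"
  shows "cusp_unit (\<lambda>\<tau>. f ((of_nat p * \<tau> + of_int s) / of_nat t)) (A * real p / real t)"
proof -
  obtain M r G Y where f: "A \<in> \<rat>" "M > 0" "r > 0" "G holomorphic_on ball 0 r" "G 0 \<noteq> 0"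
    "\<And>\<tau>. Im \<tau> > Y \<Longrightarrow> f \<tau> = qpow A \<tau> * G (qpow (1 / real M) \<tau>)"
    using assms(1) by (rule cusp_unitE) blast
  define z where "z = qexp (of_int s / of_nat (M * t))"
  have z: "norm z = 1"
    by (simp add: z_def norm_qexp Im_divide)
  have shift: "qpow B ((of_nat p * \<tau> + of_int s) / of_nat t)
      = qexp (of_real (B * s / t)) * qpow (B * p / t) \<tau>" for B \<tau>
    unfolding qpow_eq_qexp qexp_add [symmetric] using assms
    by (intro arg_cong[where f = qexp]) (simp add: field_simps)
  show ?thesis
  proof (rule cusp_unitI)
    have "(\<lambda>y. G (z * y)) holomorphic_on ball 0 r"
    proof -
      have "(G \<circ> (\<lambda>y. z * y)) holomorphic_on ball 0 r"
        by (intro holomorphic_on_compose_gen[OF _ f(4)] holomorphic_intros) (auto simp: norm_mult z)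
      then show ?thesis by (simp add: o_def)
    qed
    then have "(\<lambda>x. G (z * x ^ p)) holomorphic_on ball 0 (min r 1)"
      using assms by (intro holomorphic_on_ball_power[of "\<lambda>y. G (z * y)"]) auto
    then show "(\<lambda>x. qexp (of_real (A * s / t)) * G (z * x ^ p)) holomorphic_on ball 0 (min r 1)"
      by (intro holomorphic_intros)
    show "f ((of_nat p * \<tau> + of_int s) / of_nat t) = qpow (A * p / t) \<tau> *
        (qexp (of_real (A * s / t)) * G (z * qpow (1 / real (M * t)) \<tau> ^ p))"
      if "Im \<tau> > Y * t / p" for \<tau>
    proof -
      have "Im ((of_nat p * \<tau> + of_int s) / of_nat t) = p * Im \<tau> / t"
        by (simp add: Im_divide power2_eq_square)
      then have "Im ((of_nat p * \<tau> + of_int s) / of_nat t) > Y"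
        using that assms by (simp add: field_simps)
      from f(6)[OF this] show ?thesis
        unfolding shift by (simp add: qpow_power z_def mult_ac)
    qed
    show "A * real p / real t \<in> \<rat>"
      using f by auto
  qed (use f assms in \<open>auto simp: zero_power\<close>)
qed

lemma qpow_small:
  assumes "r > 0" "M > 0"
  obtains Y where "Y > 0" "\<And>\<tau>. Im \<tau> > Y \<Longrightarrow> norm (qpow (1 / real M) \<tau>) < r"
proof
  define Y where "Y = max 1 (- ln r * M / (2 * pi))"
  show "Y > 0" by (simp add: Y_def)
  fix \<tau> assume "Im \<tau> > Y"
  then have "Im \<tau> > - ln r * M / (2 * pi)" by (simp add: Y_def)
  then have "- 2 * pi * Im \<tau> / M < ln r"
    using assms pi_gt_zero by (simp add: field_simps)
  then have "exp (- 2 * pi * Im \<tau> / M) < exp (ln r)" by (simp only: exp_less_cancel_iff)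
  then show "norm (qpow (1 / real M) \<tau>) < r"
    using assms by (simp add: qpow_eq_qexp norm_qexp Im_divide power2_eq_square)
qed

text \<open>\<open>modular_function_X0\<close> demands one denominator for the starting exponent and
  for the steps. Passing from q^(1/M) to q^(1/(M D)), with D the denominator of \<open>A\<close>,
  provides it.\<close>

lemma cusp_unit_imp_fourier:
  assumes "cusp_unit f A"
  obtains k :: int and M a where "A = of_int k / of_nat M" "has_fourier_expansion f A M a" "a 0 \<noteq> 0"
proof -
  obtain M r G Y where f: "A \<in> \<rat>" "M > 0" "r > 0" "G holomorphic_on ball 0 r" "G 0 \<noteq> 0"
    "\<And>\<tau>. Im \<tau> > Y \<Longrightarrow> f \<tau> = qpow A \<tau> * G (qpow (1 / real M) \<tau>)"
    using assms by (rule cusp_unitE) blast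
  obtain k d :: int where kd: "d > 0" "A = of_int k / of_int d"
    using f(1) by (metis Rats_cases')
  define D where "D = nat d"
  have D: "D > 0" "A = of_int k / of_nat D" using kd by (simp_all add: D_def)
  define G' where "G' x = G (x ^ D)" for x
  define s where "s = min r 1"
  have G': "G' holomorphic_on ball 0 s" "G' 0 \<noteq> 0" "s > 0"
    using f D unfolding G'_def [abs_def] s_def by (auto intro!: holomorphic_on_ball_power simp: zero_power)
  define a where "a n = (deriv ^^ n) G' 0 / fact n" for n
  obtain Y' where Y': "Y' > 0" "\<And>\<tau>. Im \<tau> > Y' \<Longrightarrow> norm (qpow (1 / real (M * D)) \<tau>) < s"
    using qpow_small[of s "M * D"] G' f D by auto
  have "(\<lambda>n. a n * qpow (A + real n / real (M * D)) \<tau>) sums f \<tau>" if "Im \<tau> > max Y Y'" for \<tau>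
  proof -
    define x where "x = qpow (1 / real (M * D)) \<tau>"
    have "(\<lambda>n. a n * x ^ n) sums G' x"
      using holomorphic_power_series[OF G'(1), of x] Y'(2)[of \<tau>] that by (simp add: a_def x_def)
    then have "(\<lambda>n. qpow A \<tau> * (a n * x ^ n)) sums (qpow A \<tau> * G' x)"
      by (rule sums_mult)
    moreover have "qpow A \<tau> * (a n * x ^ n) = a n * qpow (A + real n / real (M * D)) \<tau>" for n
      by (simp add: x_def qpow_power qpow_add)
    moreover have "qpow A \<tau> * G' x = f \<tau>"
      using f(6)[of \<tau>] that D by (simp add: G'_def x_def qpow_power)
    ultimately show ?thesis by simp
  qed
  then have "has_fourier_expansion f A (M * D) a"
    unfolding has_fourier_expansion_def using f D Y'(1) by (intro conjI exI[of _ "max Y Y'"]) auto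
  moreover have "A = of_int (k * int M) / of_nat (M * D)"
    using f D by simp
  moreover have "a 0 \<noteq> 0" using G' by (simp add: a_def)
  ultimately show ?thesis using that by blast
qed

section \<open>Uniqueness of the leading power and its relation to translations\<close>

lemma cusp_unit_imp_leading_power: "cusp_unit f A \<Longrightarrow> has_leading_power f A"
  by (metis cusp_unit_imp_fourier has_leading_power_def)

text \<open>The limit is the leading coefficient \<open>a 0\<close>, the same on every vertical
  line; this independence of \<open>x\<close> is what later detects translation multipliers.\<close>

lemma has_leading_power_tendsto:
  assumes "has_leading_power f A"
  obtains c where "c \<noteq> 0" "\<And>x. ((\<lambda>y. f (Complex x y) / qpow A (Complex x y)) \<longlongrightarrow> c) at_top"
proof -
  obtain M a Y where M: "M > 0" "Y > 0" "a 0 \<noteq> 0"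
      and sums: "\<And>\<tau>. Im \<tau> > Y \<Longrightarrow> (\<lambda>n. a n * qpow (A + real n / real M) \<tau>) sums f \<tau>"
    using assms unfolding has_leading_power_def has_fourier_expansion_def by blast
  define X where "X \<tau> = qpow (1 / real M) \<tau>" for \<tau>
  have sums': "(\<lambda>n. a n * X \<tau> ^ n) sums (f \<tau> / qpow A \<tau>)" if "Im \<tau> > Y" for \<tau>
  proof -
    have "(\<lambda>n. a n * qpow (A + real n / real M) \<tau> / qpow A \<tau>) sums (f \<tau> / qpow A \<tau>)"
      by (rule sums_divide[OF sums[OF that]])
    then show ?thesis by (simp add: qpow_add X_def qpow_power)
  qed
  \<comment> \<open>Convergence at one point of imaginary part Y + 1 gives the power series a
    positive radius of convergence, hence continuity at 0.\<close>
  define s where "s = norm (X (Complex 0 (Y + 1)))"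
  have "summable (\<lambda>n. a n * X (Complex 0 (Y + 1)) ^ n)"
    using sums'[of "Complex 0 (Y + 1)"] sums_summable by auto
  then have "(\<lambda>n. a n * x ^ n) sums (\<Sum>n. a n * x ^ n)" if "norm x < s" for x
    using that summable_sums[OF powser_inside] by (auto simp: s_def)
  moreover have "s > 0" by (simp add: s_def X_def)
  ultimately have lim: "((\<lambda>x. \<Sum>n. a n * x ^ n) \<longlongrightarrow> a 0) (at 0)"
    by (intro powser_limit_0)
  have "((\<lambda>y. f (Complex x y) / qpow A (Complex x y)) \<longlongrightarrow> a 0) at_top" for x
  proof -
    have "filterlim (\<lambda>y. X (Complex x y)) (at 0) at_top"
    proof (rule filterlim_atI)
      have "((\<lambda>y::real. exp (- (2 * pi / M) * y)) \<longlongrightarrow> 0) at_top"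
        using M pi_gt_zero by real_asymp
      then have "((\<lambda>y. norm (X (Complex x y))) \<longlongrightarrow> 0) at_top"
        using M by (simp add: X_def qpow_eq_qexp norm_qexp Im_divide power2_eq_square)
      then show "((\<lambda>y. X (Complex x y)) \<longlongrightarrow> 0) at_top"
        by (rule tendsto_norm_zero_cancel)
    qed (simp add: X_def)
    from filterlim_compose[OF lim this]
    have "((\<lambda>y. \<Sum>n. a n * X (Complex x y) ^ n) \<longlongrightarrow> a 0) at_top" .
    moreover have "eventually (\<lambda>y. (\<Sum>n. a n * X (Complex x y) ^ n) = f (Complex x y) / qpow A (Complex x y)) at_top"
      using eventually_gt_at_top[of Y] by eventually_elim (use sums_unique[OF sums'] in simp)
    ultimately show ?thesis
      by (rule Lim_transform_eventually)
  qed
  with M(3) show ?thesis using that by blast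
qed

lemma has_leading_power_unique:
  assumes "has_leading_power f A" "has_leading_power f B"
  shows "A = B"
proof -
  have False if A: "has_leading_power f A" and B: "has_leading_power f B" and less: "A < B" for A B
  proof -
    obtain c where c: "c \<noteq> 0" "((\<lambda>y. f (Complex 0 y) / qpow A (Complex 0 y)) \<longlongrightarrow> c) at_top"
      using has_leading_power_tendsto[OF A] by blast
    obtain d where d: "d \<noteq> 0" "((\<lambda>y. f (Complex 0 y) / qpow B (Complex 0 y)) \<longlongrightarrow> d) at_top"
      using has_leading_power_tendsto[OF B] by blast
    have "((\<lambda>y. qpow (B - A) (Complex 0 y)) \<longlongrightarrow> 0) at_top"
    proof (rule tendsto_norm_zero_cancel)
      have "((\<lambda>y::real. exp (- (2 * pi * (B - A)) * y)) \<longlongrightarrow> 0) at_top"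
        using less pi_gt_zero by real_asymp
      then show "((\<lambda>y. norm (qpow (B - A) (Complex 0 y))) \<longlongrightarrow> 0) at_top"
        by (simp add: qpow_eq_qexp norm_qexp mult_ac)
    qed
    from tendsto_mult[OF d(2) this]
    moreover have "f \<tau> / qpow B \<tau> * qpow (B - A) \<tau> = f \<tau> / qpow A \<tau>" for \<tau>
      using qpow_add[of B "- A" \<tau>] by (simp add: qpow_minus divide_inverse)
    ultimately have "((\<lambda>y. f (Complex 0 y) / qpow A (Complex 0 y)) \<longlongrightarrow> 0) at_top"
      by simp
    with c show False
      using tendsto_unique[OF trivial_limit_at_top_linorder] by blast
  qed
  with assms show ?thesis by (metis linorder_neqE)
qed

text \<open>The bridge from orders to multipliers: f/q^A has the same nonzero limit on the lines Re
  = 0 and Re = n, so the factor acquired by f must be the one acquired by q^A. An integral order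
  therefore means multiplier 1.\<close>

lemma has_leading_power_translation:
  assumes "has_leading_power f A" "\<And>\<tau>. Im \<tau> > 0 \<Longrightarrow> f (\<tau> + of_nat n) = \<epsilon> * f \<tau>"
  shows "\<epsilon> = qexp (of_real (A * n))"
proof -
  obtain c where c: "c \<noteq> 0" "\<And>x. ((\<lambda>y. f (Complex x y) / qpow A (Complex x y)) \<longlongrightarrow> c) at_top"
    using has_leading_power_tendsto[OF assms(1)] by blast
  have "eventually (\<lambda>y. f (Complex n y) / qpow A (Complex n y)
      = \<epsilon> / qexp (of_real (A * n)) * (f (Complex 0 y) / qpow A (Complex 0 y))) at_top"
    using eventually_gt_at_top[of 0]
  proof eventually_elim
    case (elim y)
    have eq: "Complex n y = Complex 0 y + of_nat n" by (simp add: complex_eq_iff)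
    have "qpow A (Complex n y) = qexp (of_real (A * n)) * qpow A (Complex 0 y)"
      unfolding eq by (simp add: qpow_eq_qexp ring_distribs qexp_add mult_ac)
    then show ?case
      using assms(2)[of "Complex 0 y"] elim by (simp add: eq)
  qed
  moreover have "((\<lambda>y. \<epsilon> / qexp (of_real (A * n)) * (f (Complex 0 y) / qpow A (Complex 0 y)))
      \<longlongrightarrow> \<epsilon> / qexp (of_real (A * n)) * c) at_top"
    by (intro tendsto_intros c)
  ultimately have "((\<lambda>y. f (Complex n y) / qpow A (Complex n y)) \<longlongrightarrow> \<epsilon> / qexp (of_real (A * n)) * c) at_top"
    by (simp add: filterlim_cong)
  with c(2)[of n] have "\<epsilon> / qexp (of_real (A * n)) * c = c"
    using tendsto_unique[OF trivial_limit_at_top_linorder] by blast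
  with c(1) show ?thesis by (simp add: field_simps)
qed

text \<open>Replacing \<open>u\<close> by its fractional part costs only a constant, and for 0 <= u
  < 1 both products involve nonnegative powers of q^(1/M) only.\<close>

lemma cusp_unit_siegel:
  assumes u: "u \<in> \<rat>" and uv: "\<not> (u \<in> \<int> \<and> v \<in> \<int>)"
  shows "cusp_unit (siegel u v) (B2 (frac u) / 2)"
proof -
  define w where "w = frac u"
  have w: "w \<in> \<rat>" "0 \<le> w" "w < 1"
    using u by (auto simp: w_def frac_lt_1)
  obtain k d :: int where kd: "d > 0" "w = of_int k / of_int d"
    using w(1) by (metis Rats_cases')
  define M K where "M = nat d" and "K = nat k"
  have MK: "M > 0" "w = of_nat K / of_nat M" "K < M"
  proof -
    have "real_of_int k = w * of_int d" using kd by simp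
    then have "0 \<le> real_of_int k" "real_of_int k < real_of_int d"
      using kd(1) w by (auto simp: mult_less_cancel_right2)
    then show "M > 0" "w = of_nat K / of_nat M" "K < M"
      using kd by (auto simp: M_def K_def)
  qed
  have 0: "K = 0 \<Longrightarrow> v \<notin> \<int>"
    using MK uv by (auto simp: w_def frac_eq_0_iff)
  define z where "z = qexp (of_real v)"
  have "cusp_unit (siegel w v) (B2 w / 2)"
  proof (rule cusp_unitI)
    show "(\<lambda>x. qpoch (z * x ^ K) (x ^ M) * qpoch (inverse z * x ^ (M - K)) (x ^ M)) holomorphic_on ball 0 1"
      using MK by (intro holomorphic_intros) (auto simp: norm_power power_less_one_iff)
    \<comment> \<open>Only for K = 0 does a factor survive at 0, namely 1 - z; then u is an integer,
      so v is not, and z differs from 1.\<close>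
    show "qpoch (z * 0 ^ K) (0 ^ M) * qpoch (inverse z * 0 ^ (M - K)) (0 ^ M) \<noteq> 0"
      using MK 0 by (cases "K = 0") (auto simp: z_def qexp_eq_1_iff eq_commute[of 1] zero_power)
    show "siegel w v \<tau> = qpow (B2 w / 2) \<tau> *
        (qpoch (z * qpow (1 / real M) \<tau> ^ K) (qpow (1 / real M) \<tau> ^ M) *
         qpoch (inverse z * qpow (1 / real M) \<tau> ^ (M - K)) (qpow (1 / real M) \<tau> ^ M))" for \<tau>
    proof -
      have 1: "qexp (of_real w * \<tau> + of_real v) = z * qpow (1 / real M) \<tau> ^ K"
        unfolding qpow_power by (simp add: qexp_add z_def qpow_eq_qexp MK)
      have 2: "qexp \<tau> = qpow (1 / real M) \<tau> ^ M"
        using MK by (simp add: qpow_power) (simp add: qpow_eq_qexp)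
      have "1 / real M * real (M - K) = 1 - w"
        using MK by (simp add: of_nat_diff field_simps)
      then have 3: "qexp (\<tau> - of_real w * \<tau> - of_real v) = inverse z * qpow (1 / real M) \<tau> ^ (M - K)"
        unfolding qpow_power by (simp add: qexp_diff qpow_eq_qexp z_def divide_inverse left_diff_distrib)
      show ?thesis
        unfolding siegel_def 1 2 3 by (simp add: qpow_eq_qexp)
    qed
  qed (use MK w in \<open>auto simp: B2_def\<close>)
  then have "cusp_unit (\<lambda>\<tau>. qexp (of_real (of_int \<lfloor>u\<rfloor> * (1 / 2 - v))) * siegel w v \<tau>) (B2 w / 2)"
    by (rule cusp_unit_cmult) simp
  then have "cusp_unit (siegel (w + of_int \<lfloor>u\<rfloor>) v) (B2 w / 2)"
    by (rule cusp_unit_cong) (rule siegel_add_int_left [symmetric])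
  then show ?thesis by (simp add: w_def frac_def)
qed

section \<open>Scaled Siegel functions at all cusps\<close>

lemma integral_vector_SL2Z:
  fixes a b c d :: int and u v :: real
  assumes "a * d - b * c = 1"
    and "u * of_int a + v * of_int c \<in> \<int>" "u * of_int b + v * of_int d \<in> \<int>"
  shows "u \<in> \<int> \<and> v \<in> \<int>"
proof -
  have 1: "real_of_int a * real_of_int d - real_of_int b * real_of_int c = 1"
    using assms by (simp flip: of_int_mult of_int_diff)
  have "u = u * (real_of_int a * real_of_int d - real_of_int b * real_of_int c)"
       "v = v * (real_of_int a * real_of_int d - real_of_int b * real_of_int c)"
    by (simp_all add: 1)
  then have "u = of_int d * (u * of_int a + v * of_int c) - of_int c * (u * of_int b + v * of_int d)"
    "v = of_int a * (u * of_int b + v * of_int d) - of_int b * (u * of_int a + v * of_int c)"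
    by (auto simp: algebra_simps)
  then show ?thesis
    using assms(2,3) by (metis Ints_diff Ints_mult Ints_of_int)
qed

text \<open>The Hermite normal form of diag(K, 1) times the given matrix. Its first column divided
  by its gcd \<open>g\<close> is primitive and is completed to a matrix of SL(2,Z) by Bezout; what
  remains is upper triangular with diagonal g, t, where g t = K by determinants.\<close>

lemma scaled_mobius_decomposition:
  fixes a b c d :: int and K :: nat
  assumes det: "a * d - b * c = 1" and K: "K > 0"
  obtains x y z w s :: int and p t :: nat where "x * w - y * z = 1" "p > 0" "t > 0"
    "\<And>\<tau>. Im \<tau> > 0 \<Longrightarrow> of_nat K * mobius a b c d \<tau> = mobius x y z w ((of_nat p * \<tau> + of_int s) / of_nat t)"
proof -
  define g where "g = gcd (int K * a) c"
  have "c \<noteq> 0 \<or> int K * a \<noteq> 0" using assms by auto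
  then have g: "g > 0" by (auto simp: g_def)
  obtain x z where xz: "int K * a = g * x" "c = g * z"
    unfolding g_def by (metis dvdE gcd_dvd1 gcd_dvd2)
  have "coprime x z"
    using g xz gcd_mult_left[of g x z] by (simp add: coprime_iff_gcd_eq_1 g_def [symmetric])
      (metis abs_of_pos g_def mult_cancel_left mult.right_neutral less_irrefl)
  then obtain w y' where "w * x + y' * z = 1"
    by (metis bezout_int coprime_imp_gcd_eq_1)
  define y where "y = - y'"
  have xyzw: "x * w - y * z = 1"
    using \<open>w * x + y' * z = 1\<close> by (simp add: y_def algebra_simps)
  define t where "t = x * d - int K * b * z"
  have Kt: "int K = g * t"
  proof -
    have "g * t = (int K * a) * d - int K * b * c"
      using xz by (simp add: t_def algebra_simps)
    also have "\<dots> = int K * (a * d - b * c)" by (simp add: algebra_simps)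
    finally show ?thesis using det by simp
  qed
  have t: "t > 0" using Kt K g by (metis of_nat_0_less_iff zero_less_mult_pos)
  define s where "s = w * (int K * b) - y * d"
  have e1: "x * s + y * t = int K * b"
  proof -
    have "x * s + y * t = (x * w - y * z) * (int K * b)" by (simp add: s_def t_def algebra_simps)
    then show ?thesis using xyzw by simp
  qed
  have e2: "z * s + w * t = d"
  proof -
    have "z * s + w * t = (x * w - y * z) * d" by (simp add: s_def t_def algebra_simps)
    then show ?thesis using xyzw by simp
  qed
  show ?thesis
  proof
    show "x * w - y * z = 1" by fact
    show "nat g > 0" "nat t > 0" using g t by auto
    fix \<tau> assume \<tau>: "Im \<tau> > 0"
    have t0: "(of_int t :: complex) \<noteq> 0" using t by simp
    have "of_int x * ((of_int g * \<tau> + of_int s) / of_int t) + of_int y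
        = (of_int (x * g) * \<tau> + of_int (x * s + y * t)) / of_int t"
      using t0 by (simp add: field_simps)
    also have "\<dots> = of_nat K * (of_int a * \<tau> + of_int b) / of_int t"
      unfolding e1 using xz(1) by (simp add: mult.commute[of x] flip: xz(1)) (simp add: algebra_simps)
    finally have 1: "of_int x * ((of_int g * \<tau> + of_int s) / of_int t) + of_int y
        = of_nat K * (of_int a * \<tau> + of_int b) / of_int t" .
    have "of_int z * ((of_int g * \<tau> + of_int s) / of_int t) + of_int w
        = (of_int (z * g) * \<tau> + of_int (z * s + w * t)) / of_int t"
      using t0 by (simp add: field_simps)
    also have "\<dots> = (of_int c * \<tau> + of_int d) / of_int t"
      unfolding e2 using xz(2) by (simp add: mult.commute)
    finally have 2: "of_int z * ((of_int g * \<tau> + of_int s) / of_int t) + of_int w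
        = (of_int c * \<tau> + of_int d) / of_int t" .
    show "of_nat K * mobius a b c d \<tau> = mobius x y z w ((of_nat (nat g) * \<tau> + of_int s) / of_nat (nat t))"
      using g t t0 1 2 by (simp add: mobius_def)
  qed
qed

text \<open>A modular unit without the invariance: zeros and poles may lie only at cusps. Excluding
  zeros keeps the class stable under negative powers, as the arbitrary exponents e_{m,h}
  require.\<close>

definition cuspidal_unit :: "(complex \<Rightarrow> complex) \<Rightarrow> bool" where
  "cuspidal_unit f \<longleftrightarrow> f holomorphic_on upper_half_plane \<and> (\<forall>\<tau>. Im \<tau> > 0 \<longrightarrow> f \<tau> \<noteq> 0) \<and>
     (\<forall>a b c d. a * d - b * c = 1 \<longrightarrow> (\<exists>A. cusp_unit (\<lambda>\<tau>. f (mobius a b c d \<tau>)) A))"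

lemma cuspidal_unit_siegel:
  assumes u: "u \<in> \<rat>" and v: "v \<in> \<rat>" and uv: "\<not> (u \<in> \<int> \<and> v \<in> \<int>)" and K: "K > 0"
  shows "cuspidal_unit (\<lambda>\<tau>. siegel u v (of_nat K * \<tau>))"
  unfolding cuspidal_unit_def
proof (intro conjI allI impI)
  have "(siegel u v \<circ> (\<lambda>\<tau>. of_nat K * \<tau>)) holomorphic_on upper_half_plane"
    by (intro holomorphic_on_compose_gen[OF _ holomorphic_on_siegel] holomorphic_intros) (use K in auto)
  then show "(\<lambda>\<tau>. siegel u v (of_nat K * \<tau>)) holomorphic_on upper_half_plane"
    by (simp add: o_def)
  show "siegel u v (of_nat K * \<tau>) \<noteq> 0" if "Im \<tau> > 0" for \<tau>
    using siegel_eq_0_iff[of "of_nat K * \<tau>" u v] that K uv by simp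
  fix a b c d :: int assume "a * d - b * c = 1"
  then obtain x y z w s p t where dec: "x * w - y * z = 1" "p > 0" "t > 0"
      "\<And>\<tau>. Im \<tau> > 0 \<Longrightarrow> of_nat K * mobius a b c d \<tau> = mobius x y z w ((of_nat p * \<tau> + of_int s) / of_nat t)"
    using scaled_mobius_decomposition[OF _ K] by (metis (no_types, lifting))
  define u' v' where "u' = u * of_int x + v * of_int z" and "v' = u * of_int y + v * of_int w"
  have "u' \<in> \<rat>" using u v by (simp add: u'_def)
  moreover have "\<not> (u' \<in> \<int> \<and> v' \<in> \<int>)"
    using integral_vector_SL2Z[OF dec(1)] uv unfolding u'_def v'_def by blast
  ultimately have "cusp_unit (siegel u' v') (B2 (frac u') / 2)"
    by (rule cusp_unit_siegel)
  then have "cusp_unit (\<lambda>\<tau>. siegel u' v' ((of_nat p * \<tau> + of_int s) / of_nat t)) (B2 (frac u') / 2 * p / t)"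
    by (rule cusp_unit_affine) (use dec in auto)
  then have "cusp_unit (\<lambda>\<tau>. qexp (of_real (siegel_exp x y z w u v)) * siegel u' v' ((of_nat p * \<tau> + of_int s) / of_nat t)) (B2 (frac u') / 2 * p / t)"
    by (rule cusp_unit_cmult) simp
  then have "cusp_unit (\<lambda>\<tau>. siegel u v (of_nat K * mobius a b c d \<tau>)) (B2 (frac u') / 2 * p / t)"
  proof (rule cusp_unit_cong)
    fix \<tau> assume \<tau>: "Im \<tau> > 0"
    then have "Im ((of_nat p * \<tau> + of_int s) / of_nat t) > 0"
      using dec by (simp add: Im_divide power2_eq_square)
    from siegel_mobius[OF dec(1) this] show "qexp (of_real (siegel_exp x y z w u v)) * siegel u' v' ((of_nat p * \<tau> + of_int s) / of_nat t)
        = siegel u v (of_nat K * mobius a b c d \<tau>)"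
      by (simp add: dec(4)[OF \<tau>] u'_def v'_def)
  qed
  then show "\<exists>A. cusp_unit (\<lambda>\<tau>. siegel u v (of_nat K * mobius a b c d \<tau>)) A" by blast
qed

lemma cuspidal_unit_cong:
  assumes "cuspidal_unit f" "\<And>\<tau>. Im \<tau> > 0 \<Longrightarrow> f \<tau> = g \<tau>"
  shows "cuspidal_unit g"
  unfolding cuspidal_unit_def
proof (intro conjI allI impI)
  show "g holomorphic_on upper_half_plane"
    by (rule holomorphic_transform[of f]) (use assms in \<open>auto simp: cuspidal_unit_def\<close>)
  show "g \<tau> \<noteq> 0" if "Im \<tau> > 0" for \<tau>
    using assms that by (metis cuspidal_unit_def)
  fix a b c d :: int assume det: "a * d - b * c = 1"
  with assms(1) obtain A where "cusp_unit (\<lambda>\<tau>. f (mobius a b c d \<tau>)) A"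
    unfolding cuspidal_unit_def by blast
  then have "cusp_unit (\<lambda>\<tau>. g (mobius a b c d \<tau>)) A"
    by (rule cusp_unit_cong) (use assms(2) Im_mobius_pos[OF det] in auto)
  then show "\<exists>A. cusp_unit (\<lambda>\<tau>. g (mobius a b c d \<tau>)) A" by blast
qed

lemma cuspidal_unit_powi:
  assumes "cuspidal_unit f"
  shows "cuspidal_unit (\<lambda>\<tau>. f \<tau> powi n)"
proof -
  have f: "f holomorphic_on upper_half_plane" "\<And>\<tau>. Im \<tau> > 0 \<Longrightarrow> f \<tau> \<noteq> 0"
    using assms by (auto simp: cuspidal_unit_def)
  then have "(\<lambda>\<tau>. f \<tau> powi n) holomorphic_on upper_half_plane"
    by (intro holomorphic_intros) auto
  with assms f(2) show ?thesis
    unfolding cuspidal_unit_def using cusp_unit_powi by (auto simp: power_int_not_zero) blast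
qed

lemma cuspidal_unit_power: "cuspidal_unit f \<Longrightarrow> cuspidal_unit (\<lambda>\<tau>. f \<tau> ^ n)"
  using cuspidal_unit_powi[of f "int n"] by simp

lemma cuspidal_unit_prod:
  assumes "finite I" "\<And>i. i \<in> I \<Longrightarrow> cuspidal_unit (f i)"
  shows "cuspidal_unit (\<lambda>\<tau>. \<Prod>i\<in>I. f i \<tau>)"
  unfolding cuspidal_unit_def
proof (intro conjI allI impI)
  show "(\<lambda>\<tau>. \<Prod>i\<in>I. f i \<tau>) holomorphic_on upper_half_plane"
    by (rule holomorphic_on_prod) (use assms in \<open>auto simp: cuspidal_unit_def\<close>)
  show "(\<Prod>i\<in>I. f i \<tau>) \<noteq> 0" if "Im \<tau> > 0" for \<tau>
    using assms that by (auto simp: cuspidal_unit_def)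
  show "\<exists>A. cusp_unit (\<lambda>\<tau>. \<Prod>i\<in>I. f i (mobius a b c d \<tau>)) A" if "a * d - b * c = 1" for a b c d
    by (rule cusp_unit_prod[OF assms(1)]) (use assms that in \<open>auto simp: cuspidal_unit_def\<close>)
qed

section \<open>Signs attached to representatives of units modulo sign\<close>

lemma unit_reps_mod_signD:
  assumes "unit_reps_mod_sign k S"
  shows "finite S" "\<And>s. s \<in> S \<Longrightarrow> 0 < s \<and> s < k" "\<And>s. s \<in> S \<Longrightarrow> coprime s k"
proof -
  have "S \<subseteq> {1..<k}" using assms by (simp add: unit_reps_mod_sign_def)
  then show "finite S" "\<And>s. s \<in> S \<Longrightarrow> 0 < s \<and> s < k"
    using finite_subset by fastforce+
  show "\<And>s. s \<in> S \<Longrightarrow> coprime s k"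
    using assms by (simp add: unit_reps_mod_sign_def)
qed

lemma unit_reps_mod_sign_ex:
  assumes "unit_reps_mod_sign k S" "coprime a (int k)"
  obtains s where "s \<in> S" "[int s = a] (mod int k) \<or> [int s = - a] (mod int k)"
  using assms unfolding unit_reps_mod_sign_def by meson

lemma unit_reps_mod_sign_unique:
  assumes S: "unit_reps_mod_sign k S" and s: "s \<in> S" "s' \<in> S"
    and "[int s = int s'] (mod int k) \<or> [int s = - int s'] (mod int k)"
  shows "s = s'"
proof -
  have "coprime (int s') (int k)"
    using unit_reps_mod_signD(3)[OF S s(2)] by simp
  with S have "\<exists>!s. s \<in> S \<and> ([int s = int s'] (mod int k) \<or> [int s = - int s'] (mod int k))"
    unfolding unit_reps_mod_sign_def by blast
  with assms show ?thesis by (metis cong_refl)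
qed

text \<open>The set-up of Gauss's lemma: multiplication by a unit permutes the classes modulo sign.
  Besides the sign \<open>t\<close> the quotient \<open>b\<close> is recorded, since shifting the
  first index of a Siegel function by \<open>b\<close> costs a further sign (-1)^b.\<close>

lemma unit_reps_permutation:
  fixes k :: nat and a :: int
  assumes S: "unit_reps_mod_sign k S" and a: "coprime a (int k)"
  obtains \<pi> t b where "bij_betw \<pi> S S" "\<And>\<alpha>. \<alpha> \<in> S \<Longrightarrow> t \<alpha> \<in> {1, -1}"
    "\<And>\<alpha>. \<alpha> \<in> S \<Longrightarrow> a * int \<alpha> = t \<alpha> * int (\<pi> \<alpha>) + int k * b \<alpha>"
proof -
  have "\<exists>s\<in>S. \<exists>t\<in>{1, -1}. \<exists>b. a * int \<alpha> = t * int s + int k * b" if "\<alpha> \<in> S" for \<alpha>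
  proof -
    have "coprime (a * int \<alpha>) (int k)"
      using a unit_reps_mod_signD(3)[OF S that] by simp
    then obtain s where s: "s \<in> S" "[int s = a * int \<alpha>] (mod int k) \<or> [int s = - (a * int \<alpha>)] (mod int k)"
      using unit_reps_mod_sign_ex[OF S] by blast
    from s(2) have "\<exists>t\<in>{1, -1}. \<exists>b. a * int \<alpha> = t * int s + int k * b"
    proof
      assume "[int s = a * int \<alpha>] (mod int k)"
      then obtain b where "a * int \<alpha> = 1 * int s + int k * b"
        by (metis cong_iff_lin mult_1)
      then show ?thesis by blast
    next
      assume "[int s = - (a * int \<alpha>)] (mod int k)"
      then have "- (a * int \<alpha>) = int s + int k * b" if "b = (- (a * int \<alpha>) - int s) div int k" for b
        using that by (simp add: cong_iff_dvd_diff dvd_diff_commute)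
      then obtain b where "- (a * int \<alpha>) = int s + int k * b" by blast
      then have "a * int \<alpha> = (-1) * int s + int k * (- b)" by simp
      then show ?thesis by blast
    qed
    with s(1) show ?thesis by blast
  qed
  then obtain \<pi> t b where *: "\<And>\<alpha>. \<alpha> \<in> S \<Longrightarrow> \<pi> \<alpha> \<in> S" "\<And>\<alpha>. \<alpha> \<in> S \<Longrightarrow> t \<alpha> \<in> {1, -1}"
    "\<And>\<alpha>. \<alpha> \<in> S \<Longrightarrow> a * int \<alpha> = t \<alpha> * int (\<pi> \<alpha>) + int k * b \<alpha>"
    by metis
  have "inj_on \<pi> S"
  proof (rule inj_onI)
    fix x y assume xy: "x \<in> S" "y \<in> S" "\<pi> x = \<pi> y"
    have eqs: "[a * int x = t x * int (\<pi> x)] (mod int k)" "[a * int y = t y * int (\<pi> x)] (mod int k)"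
      using *(3)[OF xy(1)] *(3)[OF xy(2)] xy(3) by (simp_all add: cong_iff_dvd_diff)
    have "t x = t y \<or> t x = - t y"
      using *(2)[OF xy(1)] *(2)[OF xy(2)] by auto
    then have "[a * int x = a * int y] (mod int k) \<or> [a * int x = a * (- int y)] (mod int k)"
    proof (elim disj_forward)
      assume "t x = t y"
      then show "[a * int x = a * int y] (mod int k)"
        using eqs by (metis cong_sym cong_trans)
    next
      assume "t x = - t y"
      moreover have "[- (a * int y) = - (t y * int (\<pi> x))] (mod int k)"
        using eqs(2) by (simp add: cong_minus_minus_iff)
      ultimately show "[a * int x = a * (- int y)] (mod int k)"
        using eqs(1) by (metis cong_sym cong_trans mult_minus_left mult_minus_right)
    qed
    then have "[int x = int y] (mod int k) \<or> [int x = - int y] (mod int k)"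
      using a by (simp only: cong_mult_lcancel)
    then show "x = y" using unit_reps_mod_sign_unique[OF S] xy by blast
  qed
  moreover have "\<pi> ` S \<subseteq> S" using *(1) by blast
  ultimately have "bij_betw \<pi> S S"
    using endo_inj_surj[OF unit_reps_mod_signD(1)[OF S]] by (simp add: bij_betw_def)
  with *(2,3) show ?thesis using that by blast
qed

text \<open>The units in 1..k are the disjoint union of S and k - S. A common element s would give k
  = 2s with s prime to k, so s = 1 and k = 2.\<close>

lemma card_unit_reps_mod_sign:
  assumes S: "unit_reps_mod_sign k S" and k: "k > 2"
  shows "2 * card S = totient k"
proof -
  note D = unit_reps_mod_signD[OF S]
  have disj: "S \<inter> (\<lambda>s. k - s) ` S = {}"
  proof safe
    fix s assume s: "s \<in> S" "k - s \<in> S"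
    have "[int (k - s) = - int s] (mod int k)"
      using D(2)[OF s(1)] by (simp add: cong_iff_dvd_diff of_nat_diff)
    then have "k - s = s"
      using unit_reps_mod_sign_unique[OF S s(2,1)] by blast
    then have "k = 2 * s" using D(2)[OF s(1)] by auto
    then have "s dvd k" by simp
    then have "s = 1" using D(3)[OF s(1)] by (metis coprime_common_divisor_nat dvd_refl)
    with \<open>k = 2 * s\<close> k show "k - s \<in> {}" by simp
  qed
  have un: "totatives k = S \<union> (\<lambda>s. k - s) ` S"
  proof (intro equalityI subsetI)
    fix x assume x: "x \<in> totatives k"
    then have x': "0 < x" "x < k" "coprime x k"
      using k totatives_less[OF x] by (auto simp: in_totatives_iff)
    then obtain s where s: "s \<in> S" "[int s = int x] (mod int k) \<or> [int s = - int x] (mod int k)"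
      using unit_reps_mod_sign_ex[OF S, of "int x"] by auto
    have sk: "0 < s" "s < k" using D(2)[OF s(1)] by auto
    from s(2) have "s = x \<or> x = k - s"
    proof
      assume "[int s = int x] (mod int k)"
      then show ?thesis using sk x' by (simp add: cong_int_iff cong_def)
    next
      assume "[int s = - int x] (mod int k)"
      then have "int k dvd int (s + x)" by (simp add: cong_iff_dvd_diff)
      then have "k dvd s + x" by presburger
      then obtain c where c: "s + x = k * c" by (elim dvdE)
      have "c = 1"
      proof (rule ccontr)
        assume "c \<noteq> 1"
        then have "c = 0 \<or> c \<ge> 2" by linarith
        then show False
        proof
          assume "c \<ge> 2"
          then have "k * 2 \<le> k * c" by simp
          then show False using c sk x' by linarith
        qed (use c sk in auto)
      qed
      then show ?thesis using c by auto
    qed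
    then show "x \<in> S \<union> (\<lambda>s. k - s) ` S" using s(1) by auto
  next
    fix x assume "x \<in> S \<union> (\<lambda>s. k - s) ` S"
    then obtain s where s: "s \<in> S" "x = s \<or> x = k - s" by blast
    have "coprime (k - s) k"
      using D(2,3)[OF s(1)] gcd_diff2_nat[of s k] by (metis coprime_iff_gcd_eq_1 less_imp_le)
    then show "x \<in> totatives k"
      using s D(2,3)[OF s(1)] by (auto simp: in_totatives_iff)
  qed
  have "inj_on (\<lambda>s. k - s) S"
    by (rule inj_onI) (use D(2) in \<open>fastforce\<close>)
  then have "card (totatives k) = card S + card S"
    unfolding un using D(1) disj by (simp add: card_Un_disjoint card_image)
  then show ?thesis by (simp add: totient_def)
qed

lemma minus_one_power_nat_abs_cong:
  fixes x y :: int
  assumes "even (x + y)"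
  shows "(- 1 :: 'a :: ring_1) ^ nat \<bar>x\<bar> = (- 1) ^ nat \<bar>y\<bar>"
proof -
  have "even (nat \<bar>x\<bar>) \<longleftrightarrow> even (nat \<bar>y\<bar>)"
    using assms by (simp add: even_nat_iff)
  then show ?thesis by (simp add: uminus_power_if)
qed

lemma prod_signs:
  assumes "\<And>x. x \<in> A \<Longrightarrow> f x \<in> {1, -1 :: int}"
  shows "(\<Prod>x\<in>A. f x) \<in> {1, -1}"
  using assms
proof (induction A rule: infinite_finite_induct)
  case (insert x A)
  then have "f x \<in> {1, -1}" "(\<Prod>x\<in>A. f x) \<in> {1, -1}" by auto
  then show ?case using insert.hyps by auto
qed auto

text \<open>Modulo 2 the defining equation says that b(\<alpha>) is \<alpha> + \<pi>(\<alpha>);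
  since \<pi> is a permutation, every parity is counted twice.\<close>

lemma permutation_carry_sign_odd:
  fixes k :: nat and a :: int
  assumes \<pi>: "bij_betw \<pi> S S" and t: "\<And>\<alpha>. \<alpha> \<in> S \<Longrightarrow> t \<alpha> \<in> {1, -1}"
    and b: "\<And>\<alpha>. \<alpha> \<in> S \<Longrightarrow> a * int \<alpha> = t \<alpha> * int (\<pi> \<alpha>) + int k * b \<alpha>"
    and odd: "odd k" "odd a"
  shows "(\<Prod>\<alpha>\<in>S. (-1 :: int) ^ nat \<bar>b \<alpha>\<bar>) = 1"
proof -
  have "(-1 :: int) ^ nat \<bar>b \<alpha>\<bar> = (-1) ^ \<alpha> * (-1) ^ \<pi> \<alpha>" if "\<alpha> \<in> S" for \<alpha>
  proof -
    have "odd (t \<alpha>)" using t[OF that] by auto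
    have "even (a * int \<alpha>) \<longleftrightarrow> even (t \<alpha> * int (\<pi> \<alpha>) + int k * b \<alpha>)"
      by (simp only: b[OF that])
    then have "even (b \<alpha> + int (\<alpha> + \<pi> \<alpha>))"
      using odd \<open>odd (t \<alpha>)\<close> by auto
    from minus_one_power_nat_abs_cong[OF this] show ?thesis
      by (simp add: power_add del: of_nat_add)
  qed
  then have "(\<Prod>\<alpha>\<in>S. (-1 :: int) ^ nat \<bar>b \<alpha>\<bar>) = (\<Prod>\<alpha>\<in>S. (-1) ^ \<alpha>) * (\<Prod>\<alpha>\<in>S. (-1) ^ \<pi> \<alpha>)"
    by (simp add: prod.distrib)
  also have "(\<Prod>\<alpha>\<in>S. (-1 :: int) ^ \<pi> \<alpha>) = (\<Prod>\<alpha>\<in>S. (-1) ^ \<alpha>)"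
    by (rule prod.reindex_bij_betw[OF \<pi>])
  also have "(\<Prod>\<alpha>\<in>S. (-1 :: int) ^ \<alpha>) * (\<Prod>\<alpha>\<in>S. (-1) ^ \<alpha>) = 1"
    by (simp flip: prod.distrib power_add mult_2)
  finally show ?thesis .
qed

text \<open>For k twice an odd number, the combined sign \<epsilon> of \<alpha> can be seen modulo
  4: \<alpha> is congruent to \<epsilon> \<pi>(\<alpha>). Multiplying over S and cancelling the odd
  product leaves 1 congruent to the product of the signs.\<close>

lemma permutation_sign_even:
  fixes k :: nat and a :: int
  assumes \<pi>: "bij_betw \<pi> S S" and t: "\<And>\<alpha>. \<alpha> \<in> S \<Longrightarrow> t \<alpha> \<in> {1, -1}"
    and b: "\<And>\<alpha>. \<alpha> \<in> S \<Longrightarrow> a * int \<alpha> = t \<alpha> * int (\<pi> \<alpha>) + int k * b \<alpha>"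
    and S: "\<And>\<alpha>. \<alpha> \<in> S \<Longrightarrow> odd \<alpha>" and k: "k = 2 * u" "odd u" and a: "[a = 1] (mod 4)"
  shows "(\<Prod>\<alpha>\<in>S. t \<alpha> * (-1) ^ nat \<bar>b \<alpha>\<bar>) = 1"
proof -
  define \<epsilon> where "\<epsilon> \<alpha> = t \<alpha> * (-1) ^ nat \<bar>b \<alpha>\<bar>" for \<alpha>
  have \<epsilon>: "\<epsilon> \<alpha> \<in> {1, -1}" if "\<alpha> \<in> S" for \<alpha>
    using t[OF that] by (auto simp: \<epsilon>_def uminus_power_if)
  have "[int \<alpha> = \<epsilon> \<alpha> * int (\<pi> \<alpha>)] (mod 4)" if \<alpha>: "\<alpha> \<in> S" for \<alpha>
  proof -
    have "\<pi> \<alpha> \<in> S" using \<pi> \<alpha> by (auto simp: bij_betw_def)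
    then have odd: "odd (int (\<pi> \<alpha>))" using S by auto
    have "[1 * int \<alpha> = a * int \<alpha>] (mod 4)"
      using a by (intro cong_mult cong_refl) (rule cong_sym)
    also have "a * int \<alpha> = t \<alpha> * int (\<pi> \<alpha>) + 2 * (int u * b \<alpha>)"
      using b[OF \<alpha>] k by simp
    also have "[t \<alpha> * int (\<pi> \<alpha>) + 2 * (int u * b \<alpha>) = \<epsilon> \<alpha> * int (\<pi> \<alpha>)] (mod 4)"
    proof (cases "even (b \<alpha>)")
      case True
      then obtain c where "b \<alpha> = 2 * c" by (elim evenE)
      then show ?thesis using True by (simp add: \<epsilon>_def cong_iff_dvd_diff even_nat_iff)
    next
      case False
      \<comment> \<open>Adding twice an odd number to an odd number negates it modulo 4, so an odd
        carry acts exactly as its sign (-1)^b.\<close>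
      with k have "odd (int u * b \<alpha>)" by simp
      then obtain c where c: "int u * b \<alpha> = 2 * c + 1" by (elim oddE)
      obtain d where d: "int (\<pi> \<alpha>) = 2 * d + 1" using odd by (elim oddE)
      have "\<epsilon> \<alpha> = - t \<alpha>" using False by (simp add: \<epsilon>_def uminus_power_if even_nat_iff)
      moreover have "t \<alpha> = 1 \<or> t \<alpha> = -1" using t[OF \<alpha>] by auto
      ultimately show ?thesis unfolding c d cong_iff_dvd_diff by auto
    qed
    finally show ?thesis by simp
  qed
  then have "[(\<Prod>\<alpha>\<in>S. int \<alpha>) = (\<Prod>\<alpha>\<in>S. \<epsilon> \<alpha> * int (\<pi> \<alpha>))] (mod 4)"
    by (intro cong_prod)
  also have "(\<Prod>\<alpha>\<in>S. \<epsilon> \<alpha> * int (\<pi> \<alpha>)) = (\<Prod>\<alpha>\<in>S. \<epsilon> \<alpha>) * (\<Prod>\<alpha>\<in>S. int \<alpha>)"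
    using prod.reindex_bij_betw[OF \<pi>, of int] by (simp add: prod.distrib)
  finally have *: "[1 * (\<Prod>\<alpha>\<in>S. int \<alpha>) = (\<Prod>\<alpha>\<in>S. \<epsilon> \<alpha>) * (\<Prod>\<alpha>\<in>S. int \<alpha>)] (mod 4)"
    by simp
  have "coprime (int \<alpha>) 4" if "\<alpha> \<in> S" for \<alpha>
  proof -
    have "coprime (int \<alpha>) 2" using S[OF that] by simp
    then have "coprime (int \<alpha>) (2 ^ 2)" by (rule coprime_power_right_iff[THEN iffD2, OF disjI1])
    then show ?thesis by (simp del: coprime_power_right_iff)
  qed
  then have "coprime (\<Prod>\<alpha>\<in>S. int \<alpha>) 4"
    by (intro prod_coprime_left) auto
  with * have "[1 = (\<Prod>\<alpha>\<in>S. \<epsilon> \<alpha>)] (mod 4)"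
    using cong_mult_rcancel by blast
  moreover have "(\<Prod>\<alpha>\<in>S. \<epsilon> \<alpha>) \<in> {1, -1}"
    by (rule prod_signs[OF \<epsilon>])
  ultimately show ?thesis by (auto simp: \<epsilon>_def [symmetric] cong_def)
qed

text \<open>Gauss's lemma: multiply the defining equations over S modulo k and cancel the product of
  the representatives.\<close>

lemma permutation_sign_cong:
  fixes k :: nat and a :: int
  assumes \<pi>: "bij_betw \<pi> S S"
    and b: "\<And>\<alpha>. \<alpha> \<in> S \<Longrightarrow> a * int \<alpha> = t \<alpha> * int (\<pi> \<alpha>) + int k * b \<alpha>"
    and S: "\<And>\<alpha>. \<alpha> \<in> S \<Longrightarrow> coprime \<alpha> k"
  shows "[a ^ card S = (\<Prod>\<alpha>\<in>S. t \<alpha>)] (mod int k)"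
proof -
  have "[(\<Prod>\<alpha>\<in>S. a * int \<alpha>) = (\<Prod>\<alpha>\<in>S. t \<alpha> * int (\<pi> \<alpha>))] (mod int k)"
    by (intro cong_prod) (simp add: b cong_iff_dvd_diff)
  moreover have "(\<Prod>\<alpha>\<in>S. a * int \<alpha>) = a ^ card S * (\<Prod>\<alpha>\<in>S. int \<alpha>)"
    by (simp add: prod.distrib)
  moreover have "(\<Prod>\<alpha>\<in>S. t \<alpha> * int (\<pi> \<alpha>)) = (\<Prod>\<alpha>\<in>S. t \<alpha>) * (\<Prod>\<alpha>\<in>S. int \<alpha>)"
    using prod.reindex_bij_betw[OF \<pi>, of int] by (simp add: prod.distrib)
  moreover have "coprime (\<Prod>\<alpha>\<in>S. int \<alpha>) (int k)"
    using S by (intro prod_coprime_left) auto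
  ultimately show ?thesis using cong_mult_rcancel by metis
qed

lemma euler_theorem_int:
  fixes a :: int
  assumes "coprime a (int n)" "n > 0"
  shows "[a ^ totient n = 1] (mod int n)"
proof -
  define A where "A = nat (a mod int n)"
  have A: "[int A = a] (mod int n)" using assms(2) by (simp add: A_def)
  have "coprime A n"
    using cong_imp_coprime[OF cong_sym[OF A] assms(1)] by simp
  then have "[int (A ^ totient n) = int 1] (mod int n)"
    unfolding cong_int_iff by (rule euler_theorem)
  moreover have "[int (A ^ totient n) = a ^ totient n] (mod int n)"
    using cong_pow[OF A] by simp
  ultimately show ?thesis by (metis cong_sym cong_trans of_nat_1)
qed

text \<open>As phi(v) is even for v > 2, half of phi(uv) is a multiple of phi(u), and symmetrically
  of phi(v). Euler's theorem modulo u and modulo v then combines by coprimality.\<close>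

lemma half_totient_power_mult:
  fixes a :: int
  assumes u: "u > 2" and v: "v > 2" and uv: "coprime u v" and a: "coprime a (int (u * v))"
    and n: "2 * n = totient (u * v)"
  shows "[a ^ n = 1] (mod int (u * v))"
proof -
  have *: "[a ^ n = 1] (mod int u)"
    if u: "u > 2" and v: "v > 2" and uv: "coprime u v" and a: "coprime a (int (u * v))"
      and n: "2 * n = totient (u * v)" for u v
  proof -
    have "even (totient v)" using v totient_even by simp
    then obtain w where w: "totient v = 2 * w" by (elim evenE)
    have "n = totient u * w"
      using n w totient_mult_coprime[OF uv] by simp
    moreover have "[(a ^ totient u) ^ w = 1 ^ w] (mod int u)"
      using a u by (intro cong_pow euler_theorem_int) auto
    ultimately show ?thesis by (simp add: power_mult)
  qed
  have "[a ^ n = 1] (mod int u)"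
    by (rule * [OF u v uv a n])
  moreover have "[a ^ n = 1] (mod int v)"
    using uv a n by (intro * [OF v u]) (auto simp: coprime_commute mult.commute)
  ultimately show ?thesis
    using uv by (simp add: coprime_cong_mult)
qed

lemma not_primepow_decompose:
  fixes k :: nat
  assumes "k > 1" "\<not> (\<exists>p r. prime p \<and> k = p ^ r)"
  obtains u v where "k = u * v" "coprime u v" "u > 1" "v > 1"
proof -
  obtain p where p: "prime p" "p dvd k"
    using assms(1) prime_factor_nat[of k] by auto
  obtain v where v: "k = p ^ multiplicity p k * v" "\<not> p dvd v"
  proof -
    have "k \<noteq> 0" "\<not> is_unit p" using assms(1) p by auto
    from multiplicity_decompose'[OF this] show ?thesis using that by blast
  qed
  have "multiplicity p k > 0"
    using p assms(1) by (simp add: prime_multiplicity_gt_zero_iff)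
  then have 1: "p ^ multiplicity p k > 1"
    using one_less_power[OF prime_gt_1_nat[OF p(1)]] by blast
  have 2: "v > 1"
  proof (rule ccontr)
    assume "\<not> v > 1"
    then have "v = 0 \<or> v = 1" by auto
    with v assms p show False by auto
  qed
  have "coprime (p ^ multiplicity p k) v"
    using v(2) p by (simp add: prime_imp_coprime)
  with 1 2 v that show ?thesis by blast
qed

lemma Legendre_cases:
  assumes "\<not> p dvd a"
  shows "Legendre a p \<in> {1, -1}"
  using assms by (auto simp: Legendre_def cong_0_iff)

text \<open>For odd k the carries cancel and the product of the signs is congruent to a^(phi(k)/2)
  modulo k. Euler's criterion identifies it when k is a prime power; otherwise k splits into coprime
  factors greater than 2 and the power is 1. An even k is twice an odd number, where signs and
  carries must be treated together modulo 4.\<close>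

lemma permutation_sign:
  fixes k :: nat and a :: int
  assumes S: "unit_reps_mod_sign k S" and k: "k > 2" "\<not> 4 dvd k" and a: "coprime a (int k)" "[a = 1] (mod 4)"
    and \<pi>: "bij_betw \<pi> S S" and t: "\<And>\<alpha>. \<alpha> \<in> S \<Longrightarrow> t \<alpha> \<in> {1, -1}"
    and b: "\<And>\<alpha>. \<alpha> \<in> S \<Longrightarrow> a * int \<alpha> = t \<alpha> * int (\<pi> \<alpha>) + int k * b \<alpha>"
  shows "\<And>p r. prime p \<Longrightarrow> odd p \<Longrightarrow> k = p ^ r \<Longrightarrow> (\<Prod>\<alpha>\<in>S. t \<alpha> * (-1) ^ nat \<bar>b \<alpha>\<bar>) = Legendre a (int p)"
    and "\<not> (\<exists>p r. prime p \<and> odd p \<and> k = p ^ r) \<Longrightarrow> (\<Prod>\<alpha>\<in>S. t \<alpha> * (-1) ^ nat \<bar>b \<alpha>\<bar>) = 1"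
proof -
  have odd_a: "odd a" using a(2) by (auto simp: cong_iff_dvd_diff) presburger
  have odd_case: "(\<Prod>\<alpha>\<in>S. t \<alpha> * (-1) ^ nat \<bar>b \<alpha>\<bar>) = (\<Prod>\<alpha>\<in>S. t \<alpha>)" if "odd k"
    using permutation_carry_sign_odd[OF \<pi> t b that odd_a] by (simp add: prod.distrib)
  have sgn: "(\<Prod>\<alpha>\<in>S. t \<alpha>) \<in> {1, -1}" by (rule prod_signs[OF t])
  have cong: "[a ^ card S = (\<Prod>\<alpha>\<in>S. t \<alpha>)] (mod int k)"
    by (rule permutation_sign_cong[OF \<pi> b]) (use unit_reps_mod_signD[OF S] in auto)
  have card: "2 * card S = totient k" by (rule card_unit_reps_mod_sign[OF S k(1)])
  show "(\<Prod>\<alpha>\<in>S. t \<alpha> * (-1) ^ nat \<bar>b \<alpha>\<bar>) = Legendre a (int p)"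
    if p: "prime p" "odd p" and kp: "k = p ^ r" for p r
  proof -
    have p2: "p > 2" using p prime_ge_2_nat[of p] by (cases "p = 2") auto
    have "r > 0" using kp k by (cases r) auto
    then obtain r' where r': "r = Suc r'" by (cases r) auto
    obtain w where "p = 2 * w + 1" using p(2) by (elim oddE)
    then have w: "p - 1 = 2 * w" by simp
    have "totient k = p ^ r' * (p - 1)"
      unfolding kp r' using p(1) by (rule totient_prime_power_Suc)
    then have cS: "card S = w * p ^ r'" using card w by simp
    have "[Legendre a (int p) = a ^ ((p - 1) div 2)] (mod int p)"
      using euler_criterion[of p a] p p2 by simp
    then have "[Legendre a (int p) = a ^ w] (mod int p)" using w by simp
    \<comment> \<open>Half of phi(p^r) is ((p - 1)/2) p^(r-1); the extra exponent is odd and does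
      not change a sign.\<close>
    then have "[Legendre a (int p) ^ (p ^ r') = (a ^ w) ^ (p ^ r')] (mod int p)"
      by (rule cong_pow)
    moreover have "\<not> int p dvd a"
      using a(1) p kp r' by (metis coprime_common_divisor dvd_refl dvd_triv_left int_dvd_int_iff not_prime_unit of_nat_power power_Suc prime_nat_int_transfer)
    then have L: "Legendre a (int p) \<in> {1, -1}" by (rule Legendre_cases)
    then have "Legendre a (int p) ^ (p ^ r') = Legendre a (int p)"
      using p by auto
    moreover have "[a ^ card S = (\<Prod>\<alpha>\<in>S. t \<alpha>)] (mod int p)"
      using cong by (rule cong_dvd_modulus) (simp add: kp r')
    ultimately have "[Legendre a (int p) = (\<Prod>\<alpha>\<in>S. t \<alpha>)] (mod int p)"
      by (metis cS cong_trans power_mult)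
    then have "int p dvd Legendre a (int p) - (\<Prod>\<alpha>\<in>S. t \<alpha>)"
      by (simp add: cong_iff_dvd_diff)
    \<comment> \<open>Two signs differ by 0, 2 or -2, and p > 2.\<close>
    then have "Legendre a (int p) - (\<Prod>\<alpha>\<in>S. t \<alpha>) = 0"
      using L sgn p2 zdvd_not_zless[of 2 "int p"] by (auto simp: dvd_imp_le)
    moreover have "odd k" using kp p by simp
    ultimately show ?thesis using odd_case by simp
  qed
  show "(\<Prod>\<alpha>\<in>S. t \<alpha> * (-1) ^ nat \<bar>b \<alpha>\<bar>) = 1" if nopp: "\<not> (\<exists>p r. prime p \<and> odd p \<and> k = p ^ r)"
  proof (cases "odd k")
    case True
    have "\<not> (\<exists>p r. prime p \<and> k = p ^ r)"
    proof safe
      fix p r assume p: "prime p" "k = p ^ r"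
      then have "r \<noteq> 0" using k by (intro notI) simp
      with p True have "odd p" by simp
      with p nopp show False by blast
    qed
    moreover have "k > 1" using k by simp
    ultimately obtain u v where uv: "k = u * v" "coprime u v" "u > 1" "v > 1"
      using not_primepow_decompose by blast
    have "odd u" "odd v" using uv True by auto
    have "u \<noteq> 2" "v \<noteq> 2" using \<open>odd u\<close> \<open>odd v\<close> by auto
    with uv have "u > 2" "v > 2" by auto
    then have "[a ^ card S = 1] (mod int k)"
      using half_totient_power_mult[of u v a "card S"] uv a card by simp
    with cong have "[1 = (\<Prod>\<alpha>\<in>S. t \<alpha>)] (mod int k)"
      by (metis cong_sym cong_trans)
    then have "int k dvd 1 - (\<Prod>\<alpha>\<in>S. t \<alpha>)" by (simp add: cong_iff_dvd_diff)
    then have "(\<Prod>\<alpha>\<in>S. t \<alpha>) = 1"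
      using sgn k zdvd_not_zless[of 2 "int k"] by auto
    then show ?thesis using odd_case[OF True] by simp
  next
    case False
    then have "even k" by simp
    then obtain u where u: "k = 2 * u" by (elim evenE)
    have "odd u" using u k(2) by auto
    have "odd \<alpha>" if "\<alpha> \<in> S" for \<alpha>
      using unit_reps_mod_signD(3)[OF S that] u by (auto simp: coprime_commute)
    then show ?thesis
      using permutation_sign_even[OF \<pi> t b _ u \<open>odd u\<close> a(2)] by blast
  qed
qed

section \<open>Siegel functions of a fixed level\<close>

text \<open>The maximum is taken by size, but divisibility is needed to get that l(m) divides L. If
  two squares divide n, so does the square of the lcm of their roots, here g a b; maximality forces
  a = 1.\<close>

lemma max_square_root_divisor:
  assumes "n > 0"
  shows "(max_square_root_divisor n)\<^sup>2 dvd n" and "l\<^sup>2 dvd n \<Longrightarrow> l dvd max_square_root_divisor n"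
proof -
  define A where "A = {l. l\<^sup>2 dvd n}"
  have A: "l\<^sup>2 dvd n" if "l \<in> A" for l
    using that by (simp add: A_def)
  have "l \<le> n" if "l \<in> A" for l
  proof -
    have "l\<^sup>2 \<le> n" using that assms by (auto simp: A_def intro: dvd_imp_le)
    moreover have "l \<le> l\<^sup>2" by (simp add: power2_eq_square)
    ultimately show ?thesis by linarith
  qed
  then have "finite A" by (meson finite_nat_set_iff_bounded_le)
  moreover have "1 \<in> A" by (simp add: A_def)
  ultimately have Max: "Max A \<in> A" "\<And>l. l \<in> A \<Longrightarrow> l \<le> Max A" by (auto intro: Max_in)
  have M: "max_square_root_divisor n = Max A" by (simp add: max_square_root_divisor_def A_def)
  show "(max_square_root_divisor n)\<^sup>2 dvd n"
    using Max(1) unfolding M by (simp add: A_def)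
  assume "l\<^sup>2 dvd n"
  define g where "g = gcd l (Max A)"
  have "l > 0" using \<open>l\<^sup>2 dvd n\<close> assms by (cases "l = 0") auto
  then have g: "g > 0" by (simp add: g_def)
  obtain a b where ab: "l = g * a" "Max A = g * b" "coprime a b"
    unfolding g_def using gcd_coprime_exists[of l "Max A"] \<open>l > 0\<close> by (metis gcd_pos_nat less_irrefl mult.commute)
  have "g\<^sup>2 dvd n"
    using \<open>l\<^sup>2 dvd n\<close> ab(1) by (metis dvd_mult_left power_mult_distrib)
  then obtain n' where n': "n = g\<^sup>2 * n'" by (elim dvdE)
  have "(g * a)\<^sup>2 dvd g\<^sup>2 * n'" "(g * b)\<^sup>2 dvd g\<^sup>2 * n'"
    using \<open>l\<^sup>2 dvd n\<close> A[OF Max(1)] unfolding ab(1,2) n' by simp_all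
  then have "a\<^sup>2 dvd n'" "b\<^sup>2 dvd n'"
    using g by (simp_all add: power_mult_distrib)
  then have "a\<^sup>2 * b\<^sup>2 dvd n'"
    using ab(3) by (intro divides_mult) simp_all
  then have "g * a * b \<in> A"
    by (simp add: A_def n' power_mult_distrib mult.assoc)
  then have "g * a * b \<le> g * b" using Max(2) ab(2) by metis
  moreover have "b > 0" using Max(2)[OF \<open>1 \<in> A\<close>] ab(2) by (cases "b = 0") auto
  ultimately have "a = 1" using g \<open>l > 0\<close> ab(1) by (cases a) auto
  then show "l dvd max_square_root_divisor n" unfolding M ab by simp
qed

text \<open>\<open>l\<close>, \<open>k\<close> and \<open>N'\<close> stand for $\ell(m)$, $m''$ and $N'$.\<close>

locale level =
  fixes N m l k N' :: nat
  assumes N_pos: "N > 0" and N_eq: "N = m * l * k" and N'_eq: "N' = m * k"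
    and l_dvd_k: "l dvd k" and k_gt_1: "k > 1"
begin

lemma pos: "m > 0" "l > 0" "k > 0" "N' > 0"
  using N_pos N_eq N'_eq by auto

lemma N_eq': "N = l * N'"
  by (simp add: N_eq N'_eq)

text \<open>Translation by N' moves the second index by N' \<alpha>/k = m \<alpha>, an
  integer.\<close>

lemma siegel_scaled_translate:
  fixes \<alpha> :: int
  obtains c where "c \<noteq> 0"
    "\<And>\<tau>. siegel (real_of_int \<alpha> / real k) v (of_nat N' * (\<tau> + 1))
       = c * siegel (real_of_int \<alpha> / real k) v (of_nat N' * \<tau>)"
proof
  fix \<tau> :: complex
  have 1: "of_nat N' * (\<tau> + 1) = of_nat N' * \<tau> + of_int (int N')"
    by (simp add: algebra_simps)
  have 2: "v + of_int (int N') * (real_of_int \<alpha> / real k) = v + of_int (int m * \<alpha>)"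
    using pos by (simp add: N'_eq)
  show "siegel (real_of_int \<alpha> / real k) v (of_nat N' * (\<tau> + 1))
      = qexp (of_real (of_int (int N') * B2 (real_of_int \<alpha> / real k) / 2)) * siegel (real_of_int \<alpha> / real k) v (of_nat N' * \<tau>)"
    unfolding 1 siegel_translate 2 by (simp only: siegel_add_int_right)
qed simp

text \<open>After inversion the variable is tau/N', so translation by N = l N' becomes translation
  by l; it moves the second index by l (x/l) = x.\<close>

lemma siegel_scaled_inversion_translate:
  fixes x :: int and u :: real
  assumes \<tau>: "Im \<tau> > 0"
  shows "siegel u (x / l) (of_nat N' * (- 1 / (\<tau> + of_nat N)))
     = qexp (of_real (l * B2 (x / l) / 2)) * siegel u (x / l) (of_nat N' * (- 1 / \<tau>))"
proof -
  define v where "v = real_of_int x / real l"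
  have \<tau>': "Im (\<tau> / of_nat N') > 0" using \<tau> pos by simp
  have \<tau>'': "Im (\<tau> / of_nat N' + of_int (int l)) > 0" using \<tau>' by simp
  have 1: "of_nat N' * (- 1 / \<tau>) = - 1 / (\<tau> / of_nat N')" by simp
  have "(\<tau> + of_nat N) / of_nat N' = \<tau> / of_nat N' + of_int (int l)"
    using pos by (simp add: N_eq' field_simps)
  then have 2: "of_nat N' * (- 1 / (\<tau> + of_nat N)) = - 1 / (\<tau> / of_nat N' + of_int (int l))"
    by (metis (no_types, lifting) divide_divide_eq_right mult.commute times_divide_eq_right)
  have 3: "- u + of_int (int l) * v = - u + of_int x"
    using pos by (simp add: v_def)
  have 4: "siegel v (- u) (\<tau> / of_nat N' + of_int (int l)) =
      qexp (of_real (l * B2 v / 2)) * siegel v (- u) (\<tau> / of_nat N')"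
    unfolding siegel_translate 3 siegel_add_int_right by simp
  show ?thesis
    unfolding v_def [symmetric] 1 2 siegel_inversion[OF \<tau>'] siegel_inversion[OF \<tau>''] 4
    by (simp only: mult_ac)
qed

text \<open>The 12 clears the constant term of B2/2, and \<open>L\<close> the remaining denominator
  l.\<close>

lemma qexp_translate_power:
  fixes x :: int
  assumes "l dvd L"
  shows "qexp (of_real (l * B2 (x / l) / 2)) ^ (12 * L) = 1"
proof -
  obtain j where L: "L = l * j" using assms by (elim dvdE)
  have "of_nat (12 * L) * of_real (l * B2 (x / l) / 2)
      = (of_int (6 * int j * x * x - 6 * int L * x + int L * int l) :: complex)"
    using pos unfolding L B2_def by (simp add: field_simps power2_eq_square)
  then show ?thesis unfolding qexp_power by (simp only: qexp_of_int)
qed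

text \<open>Conjugation by tau -> N' tau gives the matrix (a, B; C, d), to which
  \<open>siegel_mobius\<close> applies. The off-diagonal entries move the index only by integers and
  contribute integers to the exponent, so all that survives is the linear term in the change of the
  second index from x/l to xd/l.\<close>

lemma siegel_normalised:
  fixes a b c d \<alpha> x :: int
  assumes det: "a * d - b * c = 1" and a: "[a = 1] (mod 4)" and d: "[d = 1] (mod 4)"
    and b: "24 * int N dvd b" and c: "24 * int N * int N dvd c" and \<tau>: "Im \<tau> > 0"
  shows "siegel (real_of_int \<alpha> / real k) (x / l) (of_nat N' * mobius a b c d \<tau>)
     = qexp (of_real (x / l * (1 - d) / 2)) * siegel (\<alpha> * a / k) (x * d / l) (of_nat N' * \<tau>)"
proof -
  obtain b' where b': "b = 24 * int N * b'" using b by (elim dvdE)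
  obtain c' where c': "c = 24 * int N * int N * c'" using c by (elim dvdE)
  obtain d' where d': "d = 1 + 4 * d'" using d by (metis cong_iff_lin cong_sym mult.commute)
  define B C where "B = b * int N'" and "C = 24 * int N * int l * c'"
  have CN: "C * int N' = c" by (simp add: C_def c' N_eq' algebra_simps)
  have det': "a * d - B * C = 1"
  proof -
    have "B * C = b * (C * int N')" by (simp add: B_def)
    then show ?thesis using det CN by simp
  qed
  have N'\<tau>: "Im (of_nat N' * \<tau>) > 0" using \<tau> pos by simp
  have mob: "of_nat N' * mobius a b c d \<tau> = mobius a B C d (of_nat N' * \<tau>)"
    unfolding mobius_def B_def by (simp add: CN [symmetric] algebra_simps)
  \<comment> \<open>The contributions of the off-diagonal entries to the two indices; N = l N' and
    N' = m k make them integers.\<close>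
  define n1 n2 where "n1 = x * 24 * int N' * int l * c'" and "n2 = \<alpha> * int m * b"
  have u': "\<alpha> / k * of_int a + x / l * of_int C = \<alpha> * a / k + of_int n1"
    using pos by (simp add: C_def n1_def N_eq' field_simps)
  have v': "\<alpha> / k * of_int B + x / l * of_int d = x * d / l + of_int n2"
    using pos by (simp add: B_def n2_def N'_eq field_simps)
  have B24: "B = 12 * (2 * int N * b' * int N')" by (simp add: B_def b' algebra_simps)
  have C24: "C = 12 * (2 * int N * int l * c')" by (simp add: C_def algebra_simps)
  have "\<exists>y. eta_exp a B C d = 12 * y"
  proof -
    \<comment> \<open>With B and C divisible by 12 the eta exponent reduces to 3(1 - d), which is 0
      modulo 12 because d is 1 modulo 4.\<close>
    have "[eta_exp a B C d = eta_exp a 0 0 d] (mod 12)"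
      by (intro eta_exp_cong cong_refl) (simp_all add: B24 C24 cong_0_iff)
    also have "eta_exp a 0 0 d = - 12 * d'" by (simp add: eta_exp_def d')
    finally have "12 dvd eta_exp a B C d"
      by (metis cong_0_iff cong_dvd_iff dvd_minus_iff dvd_triv_left mult_minus_left)
    then show ?thesis by (elim dvdE) blast
  qed
  then obtain y where y: "eta_exp a B C d = 12 * y" by blast
  have "siegel_exp a B C d (real_of_int \<alpha> / real k) (x / l) - x / l * (1 - d) / 2 \<in> \<int>"
  proof -
    have 1: "\<alpha> * a / k * of_int n2 = of_int (\<alpha> * a * \<alpha> * int m * int m * int l * 24 * b')"
      using pos by (simp add: n2_def b' N_eq field_simps)
    have 2: "of_int n1 * (x * d / l) = of_int (x * 24 * int N' * c' * x * d)"
      using pos by (simp add: n1_def field_simps)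
    have adBC: "real_of_int a * d = 1 + B * C"
      using det' by (metis add_diff_cancel_right' diff_add_cancel of_int_1 of_int_add of_int_mult)
    have "\<alpha> * a / k * (x * d / l) - \<alpha> / k * (x / l) = \<alpha> / k * (x / l) * (real_of_int a * d - 1)"
      by (simp add: right_diff_distrib diff_divide_distrib mult_ac)
    also have "\<dots> = of_int (\<alpha> * x * b * 24 * int N * int m * c')"
      unfolding adBC using pos by (simp add: B_def C_def N'_eq field_simps)
    finally have 3: "\<alpha> * a / k * (x * d / l) - \<alpha> / k * (x / l) = of_int (\<alpha> * x * b * 24 * int N * int m * c')" .
    have "siegel_exp a B C d (real_of_int \<alpha> / real k) (x / l) - x / l * (1 - d) / 2
       = of_int y + ((\<alpha> * a / k * (x * d / l) - \<alpha> / k * (x / l)) + \<alpha> * a / k * of_int n2 + of_int n1 * (x * d / l)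
            + of_int n1 * of_int n2 - of_int n2) / 2"
    proof -
      have V: "x / l * (1 - d) / 2 = (x / l - x * d / l) / 2"
        by (simp add: right_diff_distrib diff_divide_distrib)
      have "Y + ((U1 + r1) * (V1 + r2) - UV + V - (V1 + r2)) / 2 - (V - V1) / 2
          = Y + ((U1 * V1 - UV) + U1 * r2 + r1 * V1 + r1 * r2 - r2) / 2"
        for Y U1 V1 UV V r1 r2 :: real
        by (simp add: field_simps)
      moreover have "real_of_int (12 * y) / 12 = of_int y" by simp
      ultimately show ?thesis
        unfolding siegel_exp_def u' v' y V by (simp only:)
    qed
    also have "\<dots> = of_int (y + 12 * \<alpha> * x * b * int N * int m * c' + \<alpha> * a * \<alpha> * int m * int m * int l * 12 * b'
          + x * 12 * int N' * c' * x * d + x * 12 * int N' * int l * c' * n2 - \<alpha> * int m * 12 * int N * b')"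
      unfolding 1 2 3 by (simp add: n1_def n2_def b' field_simps)
    finally show ?thesis by (simp only: Ints_of_int)
  qed
  then have "of_real (siegel_exp a B C d (real_of_int \<alpha> / real k) (x / l)) - of_real (x / l * (1 - d) / 2) \<in> (\<int> :: complex set)"
    by (metis Ints_of_real of_real_diff)
  then have e: "qexp (of_real (siegel_exp a B C d (real_of_int \<alpha> / real k) (x / l))) = qexp (of_real (x / l * (1 - d) / 2))"
    by (simp only: qexp_eq_iff)
  have "siegel (\<alpha> * a / k + of_int n1) (x * d / l + of_int n2) (of_nat N' * \<tau>)
      = qexp (of_real (of_int n1 * (1 / 2 - x * d / l))) * siegel (\<alpha> * a / k) (x * d / l) (of_nat N' * \<tau>)"
    unfolding siegel_add_int_right by (rule siegel_add_int_left[OF N'\<tau>])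
  also have "of_int n1 * (1 / 2 - x * d / l) = of_int (x * 12 * int N' * int l * c' - x * 24 * int N' * c' * x * d)"
    using pos by (simp add: n1_def field_simps)
  finally have "siegel (\<alpha> * a / k + of_int n1) (x * d / l + of_int n2) (of_nat N' * \<tau>)
      = siegel (\<alpha> * a / k) (x * d / l) (of_nat N' * \<tau>)"
    by (simp only: of_real_of_int_eq qexp_of_int mult_1)
  then show ?thesis
    unfolding mob siegel_mobius[OF det' N'\<tau>] u' v' e by simp
qed

text \<open>One step of the permutation of factors. Three constants arise: from
  \<open>siegel_normalised\<close>, from the shift of the first index by the carry, and from the
  sign change of the index. Each is an l-th root of unity times a sign, and l divides L, so only
  (-1)^\<beta> and t remain in the L-th power.\<close>

lemma siegel_power_normalised:
  fixes a b c d \<alpha> \<delta> s \<delta>' t \<beta> h :: int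
  assumes det: "a * d - b * c = 1" and a: "[a = 1] (mod 4)" and d: "[d = 1] (mod 4)"
    and b: "24 * int N dvd b" and c: "24 * int N * int N dvd c" and \<tau>: "Im \<tau> > 0"
    and L: "l dvd L" and t: "t \<in> {1, -1}" and eq: "a * \<alpha> = t * s + int k * \<beta>"
    and \<delta>: "[\<alpha> * \<delta> = 1] (mod int k)" and \<delta>': "[s * \<delta>' = 1] (mod int k)"
  shows "siegel (\<alpha> / k) (of_int (\<delta> * h) / l) (of_nat N' * mobius a b c d \<tau>) ^ L
     = of_int (t * (-1) ^ nat \<bar>\<beta>\<bar>) ^ L * siegel (s / k) (of_int (\<delta>' * h) / l) (of_nat N' * \<tau>) ^ L"
proof -
  have N'\<tau>: "Im (of_nat N' * \<tau>) > 0" using \<tau> pos by simp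
  obtain j where j: "L = l * j" using L by (elim dvdE)
  obtain i where i: "k = l * i" using l_dvd_k by (elim dvdE)
  obtain d' where d': "d = 1 + 4 * d'" using d by (metis cong_iff_lin cong_sym mult.commute)
  have "int k dvd int N" by (simp add: N_eq)
  also have "int N dvd c" using c by (meson dvd_mult_right)
  finally have k_c: "int k dvd c" .
  have ad: "[a * d = 1] (mod int k)"
    using det k_c by (metis cong_iff_dvd_diff dvd_mult add_diff_cancel_left' diff_add_cancel add.commute diff_diff_eq2)
  have tt: "t * t = 1" using t by auto
  \<comment> \<open>The second index follows the permutation: \<delta> d is t \<delta>' modulo k, as
    ad is 1 there and t s is a \<alpha>. Because l divides k, the difference becomes an integer
    after multiplication by h/l.\<close>
  have "[\<delta> * d * 1 = \<delta> * d * (s * \<delta>')] (mod int k)"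
    by (intro cong_mult cong_refl cong_sym[OF \<delta>'])
  also have "\<delta> * d * (s * \<delta>') = \<delta> * d * \<delta>' * t * (t * s)"
    using tt by (simp add: mult_ac)
  also have "t * s = a * \<alpha> - int k * \<beta>" using eq by simp
  also have "[\<delta> * d * \<delta>' * t * (a * \<alpha> - int k * \<beta>) = \<delta> * d * \<delta>' * t * (a * \<alpha>)] (mod int k)"
    by (intro cong_mult cong_refl) (simp add: cong_iff_dvd_diff)
  also have "\<delta> * d * \<delta>' * t * (a * \<alpha>) = (a * d) * (\<alpha> * \<delta>) * (t * \<delta>')" by simp
  also have "[(a * d) * (\<alpha> * \<delta>) * (t * \<delta>') = 1 * 1 * (t * \<delta>')] (mod int k)"
    by (intro cong_mult cong_refl ad \<delta>)
  finally have "[\<delta> * d = t * \<delta>'] (mod int k)" by simp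
  then obtain \<epsilon> where \<epsilon>: "\<delta> * d = t * \<delta>' + int k * \<epsilon>"
    by (metis cong_iff_lin cong_sym)
  define v where "v = real_of_int (\<delta>' * h) / l"
  have v: "real_of_int (\<delta> * h * d) / l = t * v + of_int (int i * \<epsilon> * h)"
  proof -
    have "\<delta> * h * d = t * \<delta>' * h + int k * \<epsilon> * h"
      using arg_cong[OF \<epsilon>, of "\<lambda>x. x * h"] by (simp add: algebra_simps)
    then show ?thesis using pos by (simp only: v_def) (simp add: i field_simps)
  qed
  have u: "real_of_int \<alpha> * a / k = t * s / k + of_int \<beta>"
  proof -
    have "real_of_int \<alpha> * a = t * s + k * \<beta>"
      using arg_cong[OF eq, of real_of_int] by (simp add: mult.commute)
    then show ?thesis using pos by (simp add: field_simps)
  qed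
  have 1: "qexp (of_real (real_of_int (\<delta> * h) / l * (1 - of_int d) / 2)) ^ L = 1"
  proof -
    have "of_nat L * of_real (real_of_int (\<delta> * h) / l * (1 - of_int d) / 2) = (of_int (- 2 * int j * \<delta> * h * d') :: complex)"
      using pos by (simp add: j d' field_simps)
    then show ?thesis unfolding qexp_power by (simp only: qexp_of_int)
  qed
  have 2: "qexp (of_real (of_int \<beta> * (1 / 2 - t * v))) ^ L = of_int ((-1) ^ nat \<bar>\<beta>\<bar>) ^ L"
  proof -
    have "of_nat L * of_real (of_int \<beta> * (1 / 2 - t * v))
        = of_nat L * (of_int \<beta> / 2) - (of_int (int j * \<beta> * t * \<delta>' * h) :: complex)"
      using pos by (simp add: j v_def field_simps)
    then show ?thesis
      unfolding qexp_power qexp_diff by (simp only: qexp_diff qexp_of_int qexp_power [symmetric] qexp_half_int) simp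
  qed
  have 3: "siegel (t * s / k) (t * v) (of_nat N' * \<tau>) ^ L = of_int t ^ L * siegel (s / k) v (of_nat N' * \<tau>) ^ L"
  proof (cases "t = 1")
    case False
    with t have [simp]: "t = -1" by auto
    have "qexp (- of_real v) ^ L = 1"
    proof -
      have "of_nat L * - of_real v = (of_int (- int j * \<delta>' * h) :: complex)"
        using pos by (simp add: j v_def field_simps)
      then show ?thesis unfolding qexp_power by (simp only: qexp_of_int)
    qed
    moreover have "siegel (t * s / k) (t * v) (of_nat N' * \<tau>)
        = (- 1) * (qexp (- of_real v) * siegel (s / k) v (of_nat N' * \<tau>))"
      using siegel_minus[OF N'\<tau>, of "s / k" v] by simp
    ultimately show ?thesis by (simp only: power_mult_distrib) simp
  qed simp
  have "siegel (\<alpha> / k) (of_int (\<delta> * h) / l) (of_nat N' * mobius a b c d \<tau>)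
     = qexp (of_real (real_of_int (\<delta> * h) / l * (1 - of_int d) / 2)) *
       siegel (real_of_int \<alpha> * a / k) (real_of_int (\<delta> * h) * d / l) (of_nat N' * \<tau>)"
    using siegel_normalised[OF det a d b c \<tau>, of \<alpha> "\<delta> * h"] by simp
  also have "siegel (real_of_int \<alpha> * a / k) (real_of_int (\<delta> * h) * d / l) (of_nat N' * \<tau>)
      = siegel (t * s / k + of_int \<beta>) (t * v) (of_nat N' * \<tau>)"
  proof -
    have "real_of_int (\<delta> * h) * d / l = t * v + of_int (int i * \<epsilon> * h)"
      using v by simp
    then show ?thesis by (simp only: u siegel_add_int_right)
  qed
  also have "\<dots> = qexp (of_real (of_int \<beta> * (1 / 2 - t * v))) * siegel (t * s / k) (t * v) (of_nat N' * \<tau>)"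
    by (rule siegel_add_int_left[OF N'\<tau>])
  finally have "siegel (\<alpha> / k) (of_int (\<delta> * h) / l) (of_nat N' * mobius a b c d \<tau>) ^ L
     = (qexp (of_real (real_of_int (\<delta> * h) / l * (1 - of_int d) / 2)) ^ L *
        qexp (of_real (of_int \<beta> * (1 / 2 - t * v))) ^ L) * siegel (t * s / k) (t * v) (of_nat N' * \<tau>) ^ L"
    by (simp only: power_mult_distrib mult_ac)
  also have "\<dots> = of_int (t * (-1) ^ nat \<bar>\<beta>\<bar>) ^ L * siegel (s / k) v (of_nat N' * \<tau>) ^ L"
    unfolding 1 2 3 by (simp add: power_mult_distrib)
  finally show ?thesis by (simp only: v_def)
qed

text \<open>For k = 2, l divides 2, so h/l is half an integer; the congruences modulo 4 then make
  every exponent integral, and invariance holds without taking a power.\<close>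

lemma siegel_half_normalised:
  fixes a b c d h :: int
  assumes det: "a * d - b * c = 1" and a: "[a = 1] (mod 4)" and d: "[d = 1] (mod 4)"
    and b: "24 * int N dvd b" and c: "24 * int N * int N dvd c" and \<tau>: "Im \<tau> > 0"
    and k: "k = 2"
  shows "siegel (1 / 2) (h / l) (of_nat N' * mobius a b c d \<tau>) = siegel (1 / 2) (h / l) (of_nat N' * \<tau>)"
proof -
  have N'\<tau>: "Im (of_nat N' * \<tau>) > 0" using \<tau> pos by simp
  obtain a' where a': "a = 1 + 4 * a'" using a by (metis cong_iff_lin cong_sym mult.commute)
  obtain d' where d': "d = 1 + 4 * d'" using d by (metis cong_iff_lin cong_sym mult.commute)
  obtain i where i: "2 = l * i" using l_dvd_k k by (elim dvdE) auto
  then have i': "2 = real l * real i" by (metis of_nat_mult of_nat_numeral)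
  have h2: "real_of_int h / l * 2 = of_int (h * int i)"
    using pos by (simp only: i') simp
  have 1: "real_of_int h / l * (1 - d) / 2 = of_int (- d' * h * int i)"
  proof -
    have "real_of_int h / l * (1 - d) / 2 = - d' * (real_of_int h / l * 2)"
      by (simp add: d')
    then show ?thesis unfolding h2 by simp
  qed
  have 2: "real_of_int h * d / l = h / l + of_int (2 * d' * h * int i)"
  proof -
    have "real_of_int h * d / l = h / l + 2 * d' * (real_of_int h / l * 2)"
      using pos by (simp add: d' field_simps)
    then show ?thesis unfolding h2 by simp
  qed
  have 3: "of_int (2 * a') * (1 / 2 - real_of_int h / l) = of_int (a' - a' * h * int i)"
  proof -
    have "of_int (2 * a') * (1 / 2 - real_of_int h / l) = a' - a' * (real_of_int h / l * 2)"
      by (simp add: algebra_simps)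
    then show ?thesis unfolding h2 by simp
  qed
  have 4: "real_of_int a / 2 = 1 / 2 + of_int (2 * a')" by (simp add: a')
  have "siegel (1 / 2) (h / l) (of_nat N' * mobius a b c d \<tau>)
      = qexp (of_real (real_of_int h / l * (1 - d) / 2)) * siegel (real_of_int a / 2) (real_of_int h * d / l) (of_nat N' * \<tau>)"
    using siegel_normalised[OF det a d b c \<tau>, of 1 h] k by simp
  also have "\<dots> = siegel (1 / 2 + of_int (2 * a')) (h / l) (of_nat N' * \<tau>)"
    unfolding 1 2 4 siegel_add_int_right by (simp only: of_real_of_int_eq qexp_of_int mult_1)
  also have "\<dots> = siegel (1 / 2) (h / l) (of_nat N' * \<tau>)"
    unfolding siegel_add_int_left[OF N'\<tau>] 3 by (simp only: of_real_of_int_eq qexp_of_int mult_1)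
  finally show ?thesis .
qed

end

text \<open>Writing N/m = l^2 s gives m'' = l s and N' = m l s, so l divides m''. As m differs from
  N, the product l s is not 1.\<close>

lemma level_proper_divisor:
  assumes N: "N > 0" and m: "m \<in> proper_divisors N"
  shows "level N m (ell N m) (mdd N m) (Nd N m)" and "(ell N m)\<^sup>2 dvd N"
proof -
  define n where "n = N div m"
  have n: "N = m * n" "m > 0" "n > 0" "n \<noteq> 1"
    using m N by (auto simp: proper_divisors_def n_def)
  define l where "l = ell N m"
  have "l\<^sup>2 dvd n"
    using max_square_root_divisor(1)[OF n(3)] by (simp add: l_def ell_def n_def)
  then obtain s where s: "n = l\<^sup>2 * s" by (elim dvdE)
  have pos: "l > 0" "s > 0" using n(3) s by (auto intro: gr0I)
  have mdd: "mdd N m = l * s"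
    using n(2) pos by (simp add: mdd_def flip: l_def) (simp add: n(1) s power2_eq_square)
  have Nd: "Nd N m = m * (l * s)"
    using n(2) pos by (simp add: Nd_def flip: l_def) (simp add: n(1) s power2_eq_square)
  have "l * s \<noteq> 1" using s n(4) by auto
  then have "l * s > 1" using pos by (metis One_nat_def Suc_lessI nat_0_less_mult_iff)
  then show "level N m (ell N m) (mdd N m) (Nd N m)"
    unfolding l_def [symmetric] mdd Nd by unfold_locales (use N n(1) s in \<open>auto simp: power2_eq_square\<close>)
  have "l\<^sup>2 dvd N" unfolding n(1) s by simp
  then show "(ell N m)\<^sup>2 dvd N" by (simp only: l_def)
qed

section \<open>The functions F_{m,h} in terms of Siegel functions\<close>

lemma qpoch_split:
  assumes "norm p < 1"
  shows "qpoch x p = qpoch x (p\<^sup>2) * qpoch (x * p) (p\<^sup>2)"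
proof -
  have p2: "norm (p\<^sup>2) < 1"
    using assms by (simp add: norm_power power_less_one_iff)
  have fin: "(\<Prod>n<2*N. 1 - x * p ^ n) = (\<Prod>n<N. 1 - x * (p\<^sup>2) ^ n) * (\<Prod>n<N. 1 - x * p * (p\<^sup>2) ^ n)" for N
    by (induction N) (simp_all add: power_mult [symmetric] mult_ac)
  have "(\<lambda>N. \<Prod>n<2*N. 1 - x * p ^ n) \<longlonglongrightarrow> qpoch x p"
    using LIMSEQ_subseq_LIMSEQ[OF qpoch_LIMSEQ[OF assms], of "\<lambda>N. 2 * N" x] by (simp add: strict_mono_def o_def)
  moreover have "(\<lambda>N. (\<Prod>n<N. 1 - x * (p\<^sup>2) ^ n) * (\<Prod>n<N. 1 - x * p * (p\<^sup>2) ^ n))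
      \<longlonglongrightarrow> qpoch x (p\<^sup>2) * qpoch (x * p) (p\<^sup>2)"
    by (intro tendsto_mult qpoch_LIMSEQ p2)
  ultimately show ?thesis
    unfolding fin by (rule LIMSEQ_unique)
qed

lemma qexp_two_torsion:
  fixes h :: int
  assumes "l dvd 2" "l > 0"
  shows "qexp (of_real (h / real l)) * qexp (of_real (h / real l)) = 1"
proof -
  obtain i where "2 = l * i" using assms(1) by (elim dvdE)
  then have i': "2 = real l * real i" by (metis of_nat_mult of_nat_numeral)
  have "h / real l + h / real l = of_int (h * int i)"
    using assms(2) arg_cong[OF i', of "\<lambda>x. h * x / real l"] by (simp add: mult.commute)
  then show ?thesis
    unfolding qexp_add [symmetric] of_real_add [symmetric] by (simp only: of_real_of_int_eq qexp_of_int)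
qed

context
  fixes N m :: nat and S :: "nat \<Rightarrow> nat set"
  assumes N_pos: "N > 0" and m: "m \<in> proper_divisors N"
begin

interpretation level N m "ell N m" "mdd N m" "Nd N m"
  by (rule level_proper_divisor(1)[OF N_pos m])

lemma Ffun_eq_prod_siegel:
  assumes "mdd N m \<noteq> 2" "Im \<tau> > 0"
  shows "Ffun N S m h \<tau> = (\<Prod>\<alpha>\<in>S (mdd N m).
     siegel (real_of_int (int \<alpha>) / real (mdd N m))
       (real_of_int (modular_inverse (int (mdd N m)) (int \<alpha>) * h) / real (ell N m)) (of_nat (Nd N m) * \<tau>))"
proof -
  have 0: "Im (of_nat (Nd N m) * \<tau>) > 0" using assms pos by simp
  have 1: "real_of_int (int (\<alpha> * m * ell N m)) / real N = real_of_int (int \<alpha>) / real (mdd N m)" for \<alpha>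
    using pos arg_cong[OF N_eq, of real] by (simp add: field_simps)
  have 2: "real_of_int (x * h * int (Nd N m)) / real N = real_of_int (x * h) / real (ell N m)" for x
    using pos arg_cong[OF N_eq', of real] by (simp add: field_simps)
  show ?thesis
    unfolding Ffun_def Efun_eq_siegel[OF 0] 1 2 using assms by simp
qed

text \<open>Here l divides 2, so z = zeta_l^h is its own inverse and the two products of the Siegel
  function of index 1/2 coincide, which gives the square. Splitting (xz; x^2) with x = q^(N'/2) into
  even and odd terms gives base x^4 and arguments xz and x^3 z, which belong to first index 1/4 at
  2N' tau; the exponents agree since B2(1/4) N' = -N'/48.\<close>

lemma Ffun_eq_siegel_quarter:
  assumes k: "mdd N m = 2" and \<tau>: "Im \<tau> > 0"
  shows "Ffun N S m h \<tau> = siegel (1 / 4) (real_of_int h / real (ell N m)) (of_nat (2 * Nd N m) * \<tau>)"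
    and "Ffun N S m h \<tau> ^ 2 = siegel (1 / 2) (real_of_int h / real (ell N m)) (of_nat (Nd N m) * \<tau>)"
proof -
  let ?v = "real_of_int h / real (ell N m)" and ?w = "of_nat (Nd N m) * \<tau>"
  define z x where "z = qexp (of_real ?v)" and "x = qexp (?w / 2)"
  have zz: "z * z = 1"
    unfolding z_def using qexp_two_torsion l_dvd_k k pos by simp
  then have z': "inverse z = z" by (simp add: z_def inverse_unique)
  have x2: "qexp ?w = x\<^sup>2"
    by (simp add: x_def qexp_power)
  have "Im ?w > 0" using \<tau> pos by simp
  then have less: "norm (x\<^sup>2) < 1" by (simp add: norm_qexp_less_1_iff flip: x2)
  have "zeta_pow (ell N m) h * qpow (real (Nd N m) * (real n + 1 / 2)) \<tau> = x * z * (x\<^sup>2) ^ n" for n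
    unfolding x2 [symmetric] qexp_power zeta_pow_eq_qexp qpow_eq_qexp x_def z_def qexp_add [symmetric]
    by (rule arg_cong[where f = qexp]) (simp add: field_simps)
  then have F: "Ffun N S m h \<tau> = qexp (of_real (- real (Nd N m) / 48) * \<tau>) * qpoch (x * z) (x\<^sup>2)"
    using k by (simp add: Ffun_def qpow_eq_qexp qpoch_def)
  have half: "qexp (of_real (1 / 2) * ?w + of_real ?v) = x * z"
    by (simp add: qexp_add z_def x_def)
  have "qexp (?w - of_real (1 / 2) * ?w - of_real ?v)
      = x * inverse z"
    unfolding z_def x_def qexp_minus [symmetric] qexp_add [symmetric]
    by (rule arg_cong[where f = qexp]) (simp add: field_simps)
  then have half': "qexp (?w - of_real (1 / 2) * ?w - of_real ?v)
      = x * z" by (simp add: z')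
  have "siegel (1 / 2) ?v ?w
      = qexp (of_real (B2 (1 / 2) / 2) * ?w) * qpoch (x * z) (x\<^sup>2) * qpoch (x * z) (x\<^sup>2)"
    unfolding siegel_def half half' x2 ..
  also have "qexp (of_real (B2 (1 / 2) / 2) * ?w) = qexp (of_real (- real (Nd N m) / 48) * \<tau>) ^ 2"
    unfolding qexp_power by (rule arg_cong[where f = qexp]) (simp add: B2_def power2_eq_square)
  finally show "Ffun N S m h \<tau> ^ 2 = siegel (1 / 2) ?v ?w"
    by (simp only: F power2_eq_square mult_ac)
  have q: "qexp (of_real (1 / 4) * (of_nat (2 * Nd N m) * \<tau>) + of_real ?v) = x * z"
    by (simp add: qexp_add z_def x_def mult.commute)
  have q4: "qexp (of_nat (2 * Nd N m) * \<tau>) = (x\<^sup>2)\<^sup>2"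
    unfolding x2 [symmetric] qexp_power by (simp add: mult.assoc)
  have "qexp (of_nat (2 * Nd N m) * \<tau> - of_real (1 / 4) * (of_nat (2 * Nd N m) * \<tau>) - of_real ?v)
      = x * inverse z * x\<^sup>2"
    unfolding z_def x_def qexp_minus [symmetric] qexp_add [symmetric] qexp_power
    by (rule arg_cong[where f = qexp]) (simp add: field_simps)
  then have q': "qexp (of_nat (2 * Nd N m) * \<tau> - of_real (1 / 4) * (of_nat (2 * Nd N m) * \<tau>) - of_real ?v)
      = x * z * x\<^sup>2" by (simp only: z')
  have B: "qexp (of_real (B2 (1 / 4) / 2) * (of_nat (2 * Nd N m) * \<tau>)) = qexp (of_real (- real (Nd N m) / 48) * \<tau>)"
    by (rule arg_cong[where f = qexp]) (simp add: B2_def power2_eq_square)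
  show "Ffun N S m h \<tau> = siegel (1 / 4) ?v (of_nat (2 * Nd N m) * \<tau>)"
    unfolding siegel_def q q' B q4 F by (simp only: qpoch_split[OF less, of "x * z"] mult.assoc)
qed

lemma cuspidal_unit_Ffun:
  assumes S: "unit_reps_mod_sign (mdd N m) (S (mdd N m))"
  shows "cuspidal_unit (Ffun N S m h)"
proof (cases "mdd N m = 2")
  case True
  have "(1 / 4 :: real) \<notin> \<int>"
  proof
    assume "(1 / 4 :: real) \<in> \<int>"
    then obtain n :: int where "1 / 4 = real_of_int n" by (elim Ints_cases)
    then have "real_of_int 1 = real_of_int (4 * n)" by simp
    then have "1 = 4 * n" by (simp only: of_int_eq_iff)
    then show False by presburger
  qed
  then have "cuspidal_unit (\<lambda>\<tau>. siegel (1 / 4) (real_of_int h / real (ell N m)) (of_nat (2 * Nd N m) * \<tau>))"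
    using pos by (intro cuspidal_unit_siegel) auto
  then show ?thesis
    by (rule cuspidal_unit_cong) (simp only: Ffun_eq_siegel_quarter(1)[OF True])
next
  case False
  let ?s = "\<lambda>\<alpha>. siegel (real_of_int (int \<alpha>) / real (mdd N m))
       (real_of_int (modular_inverse (int (mdd N m)) (int \<alpha>) * h) / real (ell N m))"
  have "cuspidal_unit (\<lambda>\<tau>. \<Prod>\<alpha>\<in>S (mdd N m). ?s \<alpha> (of_nat (Nd N m) * \<tau>))"
  proof (intro cuspidal_unit_prod cuspidal_unit_siegel)
    fix \<alpha> assume \<alpha>: "\<alpha> \<in> S (mdd N m)"
    have "real_of_int (int \<alpha>) / real (mdd N m) \<notin> \<int>"
    proof
      assume "real_of_int (int \<alpha>) / real (mdd N m) \<in> \<int>"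
      then obtain n :: int where "real_of_int (int \<alpha>) / real (mdd N m) = real_of_int n" by (elim Ints_cases)
      then have "real_of_int (int \<alpha>) = real_of_int (n * int (mdd N m))"
        using pos by (simp add: field_simps)
      then have "int \<alpha> = n * int (mdd N m)" by (simp only: of_int_eq_iff)
      then have "int (mdd N m) dvd int \<alpha>" by simp
      then have "mdd N m \<le> \<alpha>" using unit_reps_mod_signD(2)[OF S \<alpha>] by (simp add: dvd_imp_le)
      then show False using unit_reps_mod_signD(2)[OF S \<alpha>] by simp
    qed
    then show "\<not> (real_of_int (int \<alpha>) / real (mdd N m) \<in> \<int> \<and>
        real_of_int (modular_inverse (int (mdd N m)) (int \<alpha>) * h) / real (ell N m) \<in> \<int>)" by blast
  qed (use unit_reps_mod_signD[OF S] pos in auto)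
  then show ?thesis
    by (rule cuspidal_unit_cong) (simp only: Ffun_eq_prod_siegel[OF False])
qed

lemma Ffun_translate:
  "\<exists>c. c \<noteq> 0 \<and> (\<forall>\<tau>. Im \<tau> > 0 \<longrightarrow> Ffun N S m h (\<tau> + 1) = c * Ffun N S m h \<tau>)"
proof (cases "mdd N m = 2")
  case True
  define c where "c = qexp (of_real (of_int (int (2 * Nd N m)) * B2 (1 / 4) / 2))"
  have "Ffun N S m h (\<tau> + 1) = c * Ffun N S m h \<tau>" if \<tau>: "Im \<tau> > 0" for \<tau>
  proof -
    have 1: "of_nat (2 * Nd N m) * (\<tau> + 1) = of_nat (2 * Nd N m) * \<tau> + of_int (int (2 * Nd N m))"
      by (simp add: algebra_simps)
    have 2: "real_of_int h / real (ell N m) + of_int (int (2 * Nd N m)) * (1 / 4)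
        = real_of_int h / real (ell N m) + of_int (int m)"
      by (simp add: N'_eq True)
    have \<tau>': "Im (\<tau> + 1) > 0" using \<tau> by simp
    show ?thesis
      unfolding Ffun_eq_siegel_quarter(1)[OF True \<tau>'] Ffun_eq_siegel_quarter(1)[OF True \<tau>] 1 siegel_translate 2
        siegel_add_int_right c_def ..
  qed
  moreover have "c \<noteq> 0" by (simp add: c_def)
  ultimately show ?thesis by blast
next
  case False
  let ?s = "\<lambda>\<alpha>. siegel (real_of_int (int \<alpha>) / real (mdd N m))
       (real_of_int (modular_inverse (int (mdd N m)) (int \<alpha>) * h) / real (ell N m))"
  have "\<exists>c. c \<noteq> 0 \<and> (\<forall>\<tau>. ?s \<alpha> (of_nat (Nd N m) * (\<tau> + 1)) = c * ?s \<alpha> (of_nat (Nd N m) * \<tau>))" for \<alpha>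
    by (rule siegel_scaled_translate[of "int \<alpha>"]) blast
  then obtain c where c: "\<And>\<alpha>. c \<alpha> \<noteq> 0"
      "\<And>\<alpha> \<tau>. ?s \<alpha> (of_nat (Nd N m) * (\<tau> + 1)) = c \<alpha> * ?s \<alpha> (of_nat (Nd N m) * \<tau>)"
    by metis
  have "Ffun N S m h (\<tau> + 1) = (\<Prod>\<alpha>\<in>S (mdd N m). c \<alpha>) * Ffun N S m h \<tau>" if \<tau>: "Im \<tau> > 0" for \<tau>
  proof -
    have \<tau>': "Im (\<tau> + 1) > 0" using \<tau> by simp
    show ?thesis
      unfolding Ffun_eq_prod_siegel[OF False \<tau>'] Ffun_eq_prod_siegel[OF False \<tau>] c(2) prod.distrib ..
  qed
  moreover have "(\<Prod>\<alpha>\<in>S (mdd N m). c \<alpha>) \<noteq> 0"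
    using c(1) by (cases "finite (S (mdd N m))") auto
  ultimately show ?thesis by blast
qed

end

text \<open>Meant for m'' = 2 and the parabolic element fixing 0: in the form with index 1/4 at 2N'
  tau, translation by N turns into translation by l/2, possibly not an integer, so only the square
  has an explicit multiplier. The quotient is continuous on a connected set with at most two values,
  hence constant.\<close>

lemma multiplier_of_square:
  fixes f :: "complex \<Rightarrow> complex"
  assumes f: "f holomorphic_on upper_half_plane" "\<And>\<tau>. Im \<tau> > 0 \<Longrightarrow> f \<tau> \<noteq> 0"
    and \<phi>: "continuous_on upper_half_plane \<phi>" "\<And>\<tau>. Im \<tau> > 0 \<Longrightarrow> Im (\<phi> \<tau>) > 0"
    and \<psi>: "continuous_on upper_half_plane \<psi>" "\<And>\<tau>. Im \<tau> > 0 \<Longrightarrow> Im (\<psi> \<tau>) > 0"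
    and c: "\<And>\<tau>. Im \<tau> > 0 \<Longrightarrow> f (\<phi> \<tau>) ^ 2 = c * f (\<psi> \<tau>) ^ 2"
  obtains c' where "c'\<^sup>2 = c" "\<And>\<tau>. Im \<tau> > 0 \<Longrightarrow> f (\<phi> \<tau>) = c' * f (\<psi> \<tau>)"
proof -
  define r where "r \<tau> = f (\<phi> \<tau>) / f (\<psi> \<tau>)" for \<tau>
  have r: "r \<tau> ^ 2 = c" if "Im \<tau> > 0" for \<tau>
    using c[OF that] f(2)[OF \<psi>(2)[OF that]] by (simp add: r_def power_divide)
  have cf: "continuous_on upper_half_plane f"
    using f(1) by (rule holomorphic_on_imp_continuous_on)
  have "continuous_on upper_half_plane (\<lambda>\<tau>. f (\<phi> \<tau>))" "continuous_on upper_half_plane (\<lambda>\<tau>. f (\<psi> \<tau>))"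
    by (rule continuous_on_compose2[OF cf]; use \<phi> \<psi> in auto)+
  then have "continuous_on upper_half_plane r"
    unfolding r_def by (intro continuous_intros) (use f(2) \<psi>(2) in auto)
  moreover have "connected upper_half_plane"
    unfolding upper_half_plane_def by (intro convex_connected convex_halfspace_Im_gt)
  moreover have "finite (r ` upper_half_plane)"
    by (rule finite_subset[of _ "{z. z ^ 2 = c}"]) (auto simp: r intro: finite_nth_roots)
  ultimately have "r constant_on upper_half_plane"
    using continuous_finite_range_constant by blast
  then obtain c' where c': "\<And>\<tau>. Im \<tau> > 0 \<Longrightarrow> r \<tau> = c'"
    unfolding constant_on_def by auto
  show ?thesis
  proof
    show "c'\<^sup>2 = c" using r[of \<i>] c'[of \<i>] by simp
    show "f (\<phi> \<tau>) = c' * f (\<psi> \<tau>)" if "Im \<tau> > 0" for \<tau>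
      using c'[OF that] f(2)[OF \<psi>(2)[OF that]] by (simp add: r_def field_simps)
  qed
qed

text \<open>For odd L the power 12 L of the multiplier separates the factors: it is 1 except for m''
  = 2, where the square root leaves -1. This is what later makes the exponent of that factor
  even.\<close>

lemma Ffun_inversion_translate:
  assumes N: "N > 0" and m: "m \<in> proper_divisors N" and S: "unit_reps_mod_sign (mdd N m) (S (mdd N m))"
    and L: "ell N m dvd L"
  shows "\<exists>c. c \<noteq> 0 \<and> (\<forall>\<tau>. Im \<tau> > 0 \<longrightarrow>
      Ffun N S m h (- 1 / (\<tau> + of_nat N)) = c * Ffun N S m h (- 1 / \<tau>)) \<and>
    (odd L \<longrightarrow> c ^ (12 * L) = (if mdd N m = 2 then - 1 else 1))"
proof -
  interpret level N m "ell N m" "mdd N m" "Nd N m"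
    by (rule level_proper_divisor(1)[OF N m])
  have Im1: "Im (- 1 / \<tau>) > 0" and Im2: "Im (- 1 / (\<tau> + of_nat N)) > 0" if "Im \<tau> > 0" for \<tau>
    using that by (intro Im_minus_inverse_pos; simp)+
  show ?thesis
  proof (cases "mdd N m = 2")
    case True
    define d where "d = qexp (of_real (ell N m * B2 (real_of_int h / ell N m) / 2))"
    have cusp: "cuspidal_unit (Ffun N S m h)" by (rule cuspidal_unit_Ffun[where S = S, OF N m S])
    obtain c where c: "c\<^sup>2 = d"
        "\<And>\<tau>. Im \<tau> > 0 \<Longrightarrow> Ffun N S m h (- 1 / (\<tau> + of_nat N)) = c * Ffun N S m h (- 1 / \<tau>)"
    proof (rule multiplier_of_square[of "Ffun N S m h" "\<lambda>\<tau>. - 1 / (\<tau> + of_nat N)" "\<lambda>\<tau>. - 1 / \<tau>" d])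
      show "Ffun N S m h (- 1 / (\<tau> + of_nat N)) ^ 2 = d * Ffun N S m h (- 1 / \<tau>) ^ 2" if \<tau>: "Im \<tau> > 0" for \<tau>
        unfolding Ffun_eq_siegel_quarter(2)[OF N m True Im1[OF \<tau>]] Ffun_eq_siegel_quarter(2)[OF N m True Im2[OF \<tau>]]
          d_def by (rule siegel_scaled_inversion_translate[OF \<tau>])
      have "\<tau> + of_nat N \<noteq> 0" if "Im \<tau> > 0" for \<tau>
      proof
        assume "\<tau> + of_nat N = 0"
        from arg_cong[OF this, of Im] that show False by simp
      qed
      then show "continuous_on upper_half_plane (\<lambda>\<tau>. - 1 / (\<tau> + of_nat N))"
        by (intro continuous_intros) auto
      show "continuous_on upper_half_plane (\<lambda>\<tau>. - 1 / \<tau>)"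
        by (intro continuous_intros) auto
    qed (use cusp Im1 Im2 in \<open>auto simp: cuspidal_unit_def\<close>)
    have "c \<noteq> 0" using c(1) by (auto simp: d_def)
    moreover have "c ^ (12 * L) = - 1" if "odd L"
    proof -
      \<comment> \<open>l divides both 2 and the odd L, so l = 1.\<close>
      have "ell N m dvd 2" using l_dvd_k True by simp
      moreover have "odd (ell N m)" using L that by (meson dvd_trans)
      then have "ell N m \<noteq> 2" by auto
      ultimately have l1: "ell N m = 1"
        using pos(2) dvd_imp_le[of "ell N m" 2] by simp
      have "c ^ (12 * L) = d ^ (6 * L)" by (simp flip: c(1) power_mult)
      also have "\<dots> = qexp (of_nat (6 * L) * of_real (B2 (real_of_int h) / 2))"
        by (simp add: d_def l1 qexp_power)
      \<comment> \<open>The constant 1/6 of B2 leaves L/2, a half-integer for odd L.\<close>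
      also have "of_nat (6 * L) * of_real (B2 (real_of_int h) / 2)
          = of_int (3 * int L * h * (h - 1)) + (of_int (int L) / 2 :: complex)"
        by (simp add: B2_def field_simps power2_eq_square)
      also have "qexp \<dots> = - 1"
        unfolding qexp_add qexp_of_int qexp_half_int using that by simp
      finally show ?thesis .
    qed
    ultimately show ?thesis using c(2) True by auto
  next
    case False
    let ?x = "\<lambda>\<alpha>. modular_inverse (int (mdd N m)) (int \<alpha>) * h"
    define c where "c \<alpha> = qexp (of_real (ell N m * B2 (real_of_int (?x \<alpha>) / ell N m) / 2))" for \<alpha>
    have "Ffun N S m h (- 1 / (\<tau> + of_nat N)) = (\<Prod>\<alpha>\<in>S (mdd N m). c \<alpha>) * Ffun N S m h (- 1 / \<tau>)"
      if \<tau>: "Im \<tau> > 0" for \<tau>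
      unfolding Ffun_eq_prod_siegel[OF N m False Im1[OF \<tau>]] Ffun_eq_prod_siegel[OF N m False Im2[OF \<tau>]]
        siegel_scaled_inversion_translate[OF \<tau>] prod.distrib c_def ..
    moreover have "(\<Prod>\<alpha>\<in>S (mdd N m). c \<alpha>) \<noteq> 0"
      using unit_reps_mod_signD(1)[OF S] by (simp add: c_def)
    moreover have "(\<Prod>\<alpha>\<in>S (mdd N m). c \<alpha>) ^ (12 * L) = 1"
      unfolding prod_power_distrib c_def qexp_translate_power[OF L] by simp
    ultimately show ?thesis using False by auto
  qed
qed

section \<open>Reduction to normalised matrices\<close>

lemma coprime_det:
  fixes a b c d :: int
  assumes "a * d - b * c = 1" "n dvd c"
  shows "coprime a n" "coprime d n"
proof -
  have "coprime a c"
  proof (rule coprimeI)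
    fix z assume "z dvd a" "z dvd c"
    then have "z dvd a * d - b * c" by (intro dvd_diff dvd_mult2 dvd_mult)
    then show "is_unit z" using assms(1) by simp
  qed
  moreover have "coprime d c"
  proof (rule coprimeI)
    fix z assume "z dvd d" "z dvd c"
    then have "z dvd a * d - b * c" by (intro dvd_diff dvd_mult)
    then show "is_unit z" using assms(1) by simp
  qed
  ultimately show "coprime a n" "coprime d n"
    using coprime_divisors[OF dvd_refl assms(2)] by blast+
qed

lemma Ffun_square_normalised:
  assumes N: "N > 0" and m: "m \<in> proper_divisors N" and k: "mdd N m = 2"
    and det: "a * d - b * c = 1" and a: "[a = 1] (mod 4)" and d: "[d = 1] (mod 4)"
    and b: "24 * int N dvd b" and c: "24 * int N * int N dvd c" and \<tau>: "Im \<tau> > 0"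
  shows "Ffun N S m h (mobius a b c d \<tau>) ^ 2 = Ffun N S m h \<tau> ^ 2"
proof -
  interpret level N m "ell N m" "mdd N m" "Nd N m"
    by (rule level_proper_divisor(1)[OF N m])
  show ?thesis
    unfolding Ffun_eq_siegel_quarter(2)[OF N m k \<tau>] Ffun_eq_siegel_quarter(2)[OF N m k Im_mobius_pos[OF det \<tau>]]
    by (rule siegel_half_normalised[OF det a d b c \<tau> k])
qed

text \<open>The factors of F are permuted by \<open>\<pi>\<close>, and the signs of the single
  factors multiply to \<open>\<sigma>\<close>. Its value is determined only if 4 does not divide
  m''; otherwise 2 divides L and the sign disappears in the L-th power.\<close>

lemma Ffun_power_normalised:
  assumes N: "N > 0" and m: "m \<in> proper_divisors N" and S: "unit_reps_mod_sign (mdd N m) (S (mdd N m))"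
    and L: "ell N m dvd L" and k: "mdd N m \<noteq> 2"
    and det: "a * d - b * c = 1" and a: "[a = 1] (mod 4)" and d: "[d = 1] (mod 4)"
    and b: "24 * int N dvd b" and c: "24 * int N * int N dvd c"
  obtains \<sigma> :: int where "\<sigma> \<in> {1, -1}"
    "\<And>\<tau>. Im \<tau> > 0 \<Longrightarrow> Ffun N S m h (mobius a b c d \<tau>) ^ L = of_int \<sigma> ^ L * Ffun N S m h \<tau> ^ L"
    "\<And>p r. \<not> 4 dvd mdd N m \<Longrightarrow> prime p \<Longrightarrow> odd p \<Longrightarrow> mdd N m = p ^ r \<Longrightarrow> \<sigma> = Legendre a (int p)"
    "\<not> 4 dvd mdd N m \<Longrightarrow> \<not> (\<exists>p r. prime p \<and> odd p \<and> mdd N m = p ^ r) \<Longrightarrow> \<sigma> = 1"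
proof -
  interpret level N m "ell N m" "mdd N m" "Nd N m"
    by (rule level_proper_divisor(1)[OF N m])
  let ?k = "mdd N m"
  have k2: "?k > 2" using k k_gt_1 by simp
  have "int ?k dvd int N" using N_eq by (metis dvd_triv_right int_dvd_int_iff)
  also have "int N dvd c" using c by (meson dvd_mult_right)
  finally have "int ?k dvd c" .
  then have a_k: "coprime a (int ?k)"
    by (rule coprime_det(1)[OF det])
  obtain \<pi> t \<beta> where \<pi>: "bij_betw \<pi> (S ?k) (S ?k)" and t: "\<And>\<alpha>. \<alpha> \<in> S ?k \<Longrightarrow> t \<alpha> \<in> {1, -1}"
    and \<beta>: "\<And>\<alpha>. \<alpha> \<in> S ?k \<Longrightarrow> a * int \<alpha> = t \<alpha> * int (\<pi> \<alpha>) + int ?k * \<beta> \<alpha>"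
    using unit_reps_permutation[OF S a_k] by blast
  define \<epsilon> where "\<epsilon> \<alpha> = t \<alpha> * (-1) ^ nat \<bar>\<beta> \<alpha>\<bar>" for \<alpha>
  have \<epsilon>: "\<epsilon> \<alpha> \<in> {1, -1}" if "\<alpha> \<in> S ?k" for \<alpha>
    using t[OF that] by (auto simp: \<epsilon>_def uminus_power_if)
  let ?x = "\<lambda>\<alpha>. modular_inverse (int ?k) (int \<alpha>)"
  let ?s = "\<lambda>\<alpha>. siegel (real_of_int (int \<alpha>) / real ?k) (real_of_int (?x \<alpha> * h) / real (ell N m))"
  have inv: "[int \<alpha> * ?x \<alpha> = 1] (mod int ?k)" if "\<alpha> \<in> S ?k" for \<alpha>
    using unit_reps_mod_signD(3)[OF S that] by (intro cong_modular_inverse1) simp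
  have step: "?s \<alpha> (of_nat (Nd N m) * mobius a b c d \<tau>) ^ L = of_int (\<epsilon> \<alpha>) ^ L * ?s (\<pi> \<alpha>) (of_nat (Nd N m) * \<tau>) ^ L"
    if \<alpha>: "\<alpha> \<in> S ?k" and \<tau>: "Im \<tau> > 0" for \<alpha> \<tau>
  proof -
    have "\<pi> \<alpha> \<in> S ?k" using \<pi> \<alpha> by (auto simp: bij_betw_def)
    from siegel_power_normalised[OF det a d b c \<tau> L t[OF \<alpha>] \<beta>[OF \<alpha>] inv[OF \<alpha>] inv[OF this]]
    show ?thesis unfolding \<epsilon>_def .
  qed
  show ?thesis
  proof
    show "(\<Prod>\<alpha>\<in>S ?k. \<epsilon> \<alpha>) \<in> {1, -1}" by (rule prod_signs[OF \<epsilon>])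
    show "Ffun N S m h (mobius a b c d \<tau>) ^ L = of_int (\<Prod>\<alpha>\<in>S ?k. \<epsilon> \<alpha>) ^ L * Ffun N S m h \<tau> ^ L"
      if \<tau>: "Im \<tau> > 0" for \<tau>
    proof -
      have "Ffun N S m h (mobius a b c d \<tau>) ^ L
          = (\<Prod>\<alpha>\<in>S ?k. of_int (\<epsilon> \<alpha>) ^ L * ?s (\<pi> \<alpha>) (of_nat (Nd N m) * \<tau>) ^ L)"
        unfolding Ffun_eq_prod_siegel[OF N m k Im_mobius_pos[OF det \<tau>]] prod_power_distrib
        by (intro prod.cong refl step \<tau>)
      also have "\<dots> = of_int (\<Prod>\<alpha>\<in>S ?k. \<epsilon> \<alpha>) ^ L * (\<Prod>\<alpha>\<in>S ?k. ?s (\<pi> \<alpha>) (of_nat (Nd N m) * \<tau>) ^ L)"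
        by (simp add: prod.distrib prod_power_distrib)
      also have "(\<Prod>\<alpha>\<in>S ?k. ?s (\<pi> \<alpha>) (of_nat (Nd N m) * \<tau>) ^ L) = (\<Prod>\<alpha>\<in>S ?k. ?s \<alpha> (of_nat (Nd N m) * \<tau>) ^ L)"
        by (rule prod.reindex_bij_betw[OF \<pi>])
      also have "\<dots> = Ffun N S m h \<tau> ^ L"
        unfolding Ffun_eq_prod_siegel[OF N m k \<tau>] prod_power_distrib ..
      finally show ?thesis .
    qed
    show "(\<Prod>\<alpha>\<in>S ?k. \<epsilon> \<alpha>) = Legendre a (int p)"
      if "\<not> 4 dvd ?k" "prime p" "odd p" "?k = p ^ r" for p r
      unfolding \<epsilon>_def by (rule permutation_sign(1)[OF S k2 that(1) a_k a \<pi> t \<beta> that(2-4)])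
    show "(\<Prod>\<alpha>\<in>S ?k. \<epsilon> \<alpha>) = 1"
      if "\<not> 4 dvd ?k" "\<not> (\<exists>p r. prime p \<and> odd p \<and> ?k = p ^ r)"
      unfolding \<epsilon>_def by (rule permutation_sign(2)[OF S k2 that(1) a_k a \<pi> t \<beta> that(2)])
  qed
qed

lemma mobius_mobius:
  assumes \<tau>: "Im \<tau> > 0" and det: "a' * d' - b' * c' = 1"
  shows "mobius a b c d (mobius a' b' c' d' \<tau>)
     = mobius (a * a' + b * c') (a * b' + b * d') (c * a' + d * c') (c * b' + d * d') \<tau>"
proof -
  have "c' \<noteq> 0 \<or> d' \<noteq> 0" using det by auto
  from mobius_denominator_nonzero[OF \<tau> this] have nz: "of_int c' * \<tau> + of_int d' \<noteq> 0" .
  have "of_int x * mobius a' b' c' d' \<tau> + of_int y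
      = (of_int (x * a' + y * c') * \<tau> + of_int (x * b' + y * d')) / (of_int c' * \<tau> + of_int d')" for x y
  proof -
    have "x * (A / D) + y = (x * A + y * D) / D" if "D \<noteq> 0" for x y A D :: complex
      using that by (simp add: field_simps)
    from this[OF nz] have "of_int x * mobius a' b' c' d' \<tau> + of_int y = (of_int x * (of_int a' * \<tau> + of_int b')
        + of_int y * (of_int c' * \<tau> + of_int d')) / (of_int c' * \<tau> + of_int d')"
      unfolding mobius_def .
    then show ?thesis by (simp add: algebra_simps)
  qed
  then show ?thesis
    unfolding mobius_def[of a b c d] using nz by (simp add: mobius_def)
qed

lemma exists_multiple_dvd_add:
  fixes x y n :: int
  assumes "coprime x n"
  obtains k where "n dvd y + k * x"
proof -
  obtain z where "[x * z = 1] (mod n)"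
    using cong_solve_coprime_int[OF assms] by blast
  then have "n dvd 1 - x * z" by (metis cong_iff_dvd_diff cong_sym)
  then have "n dvd y * (1 - x * z)" by (rule dvd_mult)
  also have "y * (1 - x * z) = y + (- y * z) * x" by (simp add: algebra_simps)
  finally show ?thesis using that by blast
qed

text \<open>Multiplication on the right by powers of the two parabolic matrices fixing \<open>\<infinity>\<close> and \<open>0\<close>,
  and by \<open>-1\<close>, makes the off-diagonal entries of a matrix in \<open>\<Gamma>\<^sub>0(N)\<close> highly divisible.\<close>

lemma Gamma0_normalise:
  fixes a b c d :: int
  assumes N: "N > 0" and det: "a * d - b * c = 1" and N_c: "int N dvd c"
    and T: "\<And>a b c d k. a * d - b * c = 1 \<Longrightarrow> P a (b + k * a) c (d + k * c) \<Longrightarrow> P a b c d"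
    and U: "\<And>a b c d k. a * d - b * c = 1 \<Longrightarrow> P (a + k * int N * b) b (c + k * int N * d) d \<Longrightarrow> P a b c d"
    and neg: "\<And>a b c d. a * d - b * c = 1 \<Longrightarrow> P (- a) (- b) (- c) (- d) \<Longrightarrow> P a b c d"
    and base: "\<And>a b c d. a * d - b * c = 1 \<Longrightarrow> [a = 1] (mod 4) \<Longrightarrow> [d = 1] (mod 4) \<Longrightarrow>
       24 * int N dvd b \<Longrightarrow> 24 * int N * int N dvd c \<Longrightarrow> P a b c d"
  shows "P a b c d"
proof -
  have 1: "P a b c d"
    if det: "a * d - b * c = 1" and c: "24 * int N * int N dvd c" and b: "24 * int N dvd b" for a b c d
  proof -
    obtain x where "b = 24 * int N * x" using b by (elim dvdE)
    then obtain b' where b': "b = 4 * b'" using that[of "6 * int N * x"] by simp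
    have ad: "a * d = 1 + 4 * (b' * c)" using det b' by simp
    have "odd (1 + 4 * (b' * c))" by simp
    then have odd: "odd a" unfolding ad [symmetric] by simp
    show ?thesis
    proof (cases "[a = 1] (mod 4)")
      case True
      have "[a * d = 1 * d] (mod 4)" using True by (intro cong_mult cong_refl)
      moreover have "[a * d = 1] (mod 4)" by (simp add: ad cong_iff_dvd_diff)
      ultimately have "[d = 1] (mod 4)" by (metis cong_sym cong_trans mult_1)
      then show ?thesis by (intro base det True b c)
    next
      case False
      then have a: "[- a = 1] (mod 4)"
        using odd unfolding cong_iff_dvd_diff by presburger
      have "[(- a) * (- d) = 1 * (- d)] (mod 4)" using a by (intro cong_mult cong_refl)
      moreover have "[(- a) * (- d) = 1] (mod 4)" by (simp add: ad cong_iff_dvd_diff)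
      ultimately have "[- d = 1] (mod 4)" by (metis cong_sym cong_trans mult_1)
      with a show ?thesis using det b c by (intro neg[OF det] base) auto
    qed
  qed
  \<comment> \<open>A translation changes \<open>b\<close> and \<open>d\<close> but not
    \<open>c\<close>, so \<open>b\<close> is adjusted after \<open>c\<close>. The entry
    \<open>a\<close> is prime to 24N because it is prime to \<open>c\<close>.\<close>
  have 2: "P a b c d"
    if det: "a * d - b * c = 1" and c: "24 * int N * int N dvd c" for a b c d
  proof -
    have "24 * int N dvd c" using c by (meson dvd_mult_left)
    then have "coprime a (24 * int N)"
      by (rule coprime_det(1)[OF det])
    then obtain k where "24 * int N dvd b + k * a"
      using exists_multiple_dvd_add by blast
    then have "P a (b + k * a) c (d + k * c)"
      using det c by (intro 1) (auto simp: algebra_simps)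
    then show ?thesis by (rule T[OF det])
  qed
  \<comment> \<open>The parabolic element fixing 0 changes c/N by multiples of \<open>d\<close>, so
    divisibility of c/N by 24N can be reached as soon as \<open>d\<close> is prime to 24N.\<close>
  have 3: "P a b c d"
    if det: "a * d - b * c = 1" and N_c: "int N dvd c" and d: "coprime d (24 * int N)" for a b c d
  proof -
    obtain c0 where c0: "c = int N * c0" using N_c by (elim dvdE)
    obtain k where "24 * int N dvd c0 + k * d"
      using exists_multiple_dvd_add[OF d] by blast
    then have "24 * int N * int N dvd (c0 + k * d) * int N" by (rule mult_dvd_mono) simp
    also have "(c0 + k * d) * int N = c + k * int N * d" by (simp add: c0 algebra_simps)
    finally have "P (a + k * int N * b) b (c + k * int N * d) d"
      using det by (intro 2) (auto simp: algebra_simps)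
    then show ?thesis by (rule U[OF det])
  qed
  \<comment> \<open>3 is odd and divisible by 3, while 4 is even and 1 modulo 3: each summand
    repairs one of the primes 2, 3 in \<open>d\<close> without affecting the other. The entry
    \<open>d\<close> is prime to N in any case.\<close>
  define k :: int where "k = (if even d then 3 else 0) + (if 3 dvd d then 4 else 0)"
  have "\<not> (even c \<and> even d)" "\<not> (3 dvd c \<and> 3 dvd d)"
  proof -
    have "\<not> (p dvd c \<and> p dvd d)" if "\<not> p dvd 1" for p :: int
      using det that by (metis dvd_diff dvd_mult)
    from this[of 2] this[of 3] show "\<not> (even c \<and> even d)" "\<not> (3 dvd c \<and> 3 dvd d)" by auto
  qed
  then have "odd (d + k * c)" "\<not> 3 dvd d + k * c"
    unfolding k_def by (cases "even d"; cases "3 dvd d"; simp; presburger)+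
  then have "coprime (d + k * c) 2" "coprime (d + k * c) 3"
    using prime_imp_coprime[of "3 :: int" "d + k * c"] by (auto simp: coprime_commute)
  then have "coprime (d + k * c) (2 * (2 * (2 * 3)))"
    by (intro coprime_mult_right_iff[THEN iffD2] conjI)
  moreover have det': "a * (d + k * c) - (b + k * a) * c = 1"
    using det by (simp add: algebra_simps)
  then have "coprime (d + k * c) (int N)"
    using N_c by (rule coprime_det(2))
  ultimately have "coprime (d + k * c) (24 * int N)"
    by simp
  then have "P a (b + k * a) c (d + k * c)"
    using 3 det' N_c by blast
  then show ?thesis by (rule T[OF det])
qed

text \<open>Shows that the definite description in \<open>cusp_order\<close> denotes: matrices with
  first column (1, c) differ from the one with rows (1, 0), (c, 1) by an integer translation, and
  leading powers are unique.\<close>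

lemma cusp_order_eq:
  assumes "cuspidal_unit f"
  obtains A where "cusp_unit (\<lambda>\<tau>. f (mobius 1 0 (int c) 1 \<tau>)) A"
    "cusp_order N f 1 c = real N / real (gcd (c\<^sup>2) N) * A"
proof -
  obtain A where A: "cusp_unit (\<lambda>\<tau>. f (mobius 1 0 (int c) 1 \<tau>)) A"
  proof -
    have "(1 :: int) * 1 - 0 * int c = 1" by simp
    with assms show ?thesis using that unfolding cuspidal_unit_def by blast
  qed
  have "has_leading_power (\<lambda>\<tau>. f (mobius 1 b (int c) d \<tau>)) A" if "1 * d - b * int c = 1" for b d
  proof -
    have "cusp_unit (\<lambda>\<tau>. f (mobius 1 0 (int c) 1 ((of_nat 1 * \<tau> + of_int b) / of_nat 1))) (A * real 1 / real 1)"
      by (rule cusp_unit_affine[OF A]) auto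
    moreover have "d = 1 + b * int c" using that by simp
    then have "mobius 1 0 (int c) 1 ((of_nat 1 * \<tau> + of_int b) / of_nat 1) = mobius 1 b (int c) d \<tau>" for \<tau>
      by (simp add: mobius_def algebra_simps)
    ultimately show ?thesis
      by (simp add: cusp_unit_imp_leading_power)
  qed
  moreover have "A' = A" if "\<forall>b d. 1 * d - b * int c = 1 \<longrightarrow>
      has_leading_power (\<lambda>\<tau>. f (mobius 1 b (int c) d \<tau>)) A'" for A'
  proof -
    have "has_leading_power (\<lambda>\<tau>. f (mobius 1 0 (int c) 1 \<tau>)) A'"
      using that by (elim allE[of _ 0] allE[of _ 1]) simp
    then show ?thesis
      using has_leading_power_unique cusp_unit_imp_leading_power[OF A] by blast
  qed
  ultimately have "(THE A. \<forall>b d. 1 * d - b * int c = 1 \<longrightarrow>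
               has_leading_power (\<lambda>\<tau>. f (mobius 1 b (int c) d \<tau>)) A) = A"
    by (intro the_equality) blast+
  then have "cusp_order N f 1 c = real N / real (gcd (c\<^sup>2) N) * A"
    by (simp add: cusp_order_def)
  with A show ?thesis using that by blast
qed

section \<open>Multipliers of the product and invariance under Gamma_0(N)\<close>

lemma power_int_sum:
  fixes x :: "'a :: field"
  assumes "x \<noteq> 0"
  shows "(\<Prod>i\<in>A. x powi f i) = x powi (\<Sum>i\<in>A. f i)"
  using assms by (induction A rule: infinite_finite_induct) (simp_all add: power_int_add)

lemma power_int_even_sign:
  fixes x :: "'a :: field"
  assumes "x * x = 1" "even n"
  shows "x powi n = 1"
proof -
  obtain n' where "n = 2 * n'" using assms(2) by (elim evenE)
  then show ?thesis using assms(1) by (simp add: power_int_mult power2_eq_square)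
qed

lemma Fprod_multiplier:
  assumes "\<And>m h. m \<in> proper_divisors N \<Longrightarrow> h < ell N m \<Longrightarrow> Ffun N S m (int h) \<tau> = c m h * Ffun N S m (int h) \<tau>'"
  shows "Fprod N S e \<tau> = (\<Prod>m\<in>proper_divisors N. \<Prod>h<ell N m. c m h powi e m h) * Fprod N S e \<tau>'"
proof -
  have "Fprod N S e \<tau> = (\<Prod>m\<in>proper_divisors N. \<Prod>h<ell N m. c m h powi e m h * Ffun N S m (int h) \<tau>' powi e m h)"
    unfolding Fprod_def by (intro prod.cong refl) (simp add: assms power_int_mult_distrib)
  then show ?thesis by (simp add: prod.distrib Fprod_def)
qed

lemma Fprod_power:
  "Fprod N S e \<tau> ^ L = (\<Prod>m\<in>proper_divisors N. \<Prod>h<ell N m. (Ffun N S m (int h) \<tau> ^ L) powi e m h)"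
  by (simp add: Fprod_def prod_power_distrib power_int_power power_int_power' mult.commute)

lemma finite_proper_divisors: "N > 0 \<Longrightarrow> finite (proper_divisors N)"
  by (rule finite_subset[of _ "{..N}"]) (auto simp: proper_divisors_def dvd_imp_le)

lemma translation_invariant_int:
  assumes per: "\<And>\<tau>. Im \<tau> > 0 \<Longrightarrow> g (\<tau> + of_nat n) = g \<tau>" and \<tau>: "Im \<tau> > 0"
  shows "g (\<tau> + of_int (k * int n)) = g \<tau>"
proof (induction k rule: int_induct[where k = 0])
  case (step1 i)
  then show ?case using per[of "\<tau> + of_int (i * int n)"] \<tau> by (simp add: algebra_simps)
next
  case (step2 i)
  then show ?case using per[of "\<tau> + of_int ((i - 1) * int n)"] \<tau> by (simp add: algebra_simps)
qed simp

text \<open>Discharges the closure conditions of \<open>Gamma0_normalise\<close>. The element fixing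
  0 enters through g(-1/tau), where it is a translation by N.\<close>

lemma Gamma0_invariant_if_normalised_invariant:
  fixes g :: "complex \<Rightarrow> complex" and a b c d :: int
  assumes N: "N > 0" and T: "\<And>\<tau>. Im \<tau> > 0 \<Longrightarrow> g (\<tau> + 1) = g \<tau>"
    and I: "\<And>\<tau>. Im \<tau> > 0 \<Longrightarrow> g (- 1 / (\<tau> + of_nat N)) = g (- 1 / \<tau>)"
    and base: "\<And>a b c d \<tau>. a * d - b * c = 1 \<Longrightarrow> [a = 1] (mod 4) \<Longrightarrow> [d = 1] (mod 4) \<Longrightarrow>
       24 * int N dvd b \<Longrightarrow> 24 * int N * int N dvd c \<Longrightarrow> Im \<tau> > 0 \<Longrightarrow> g (mobius a b c d \<tau>) = g \<tau>"
    and det: "a * d - b * c = 1" and c: "int N dvd c" and \<tau>: "Im \<tau> > 0"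
  shows "g (mobius a b c d \<tau>) = g \<tau>"
proof -
  have T': "g (\<tau> + of_int k) = g \<tau>" if "Im \<tau> > 0" for k \<tau>
    using translation_invariant_int[of g 1 \<tau> k] T that by simp
  have U': "g (mobius 1 0 (k * int N) 1 \<tau>) = g \<tau>" if \<tau>: "Im \<tau> > 0" for k \<tau>
  proof -
    have \<tau>0: "\<tau> \<noteq> 0" using \<tau> by auto
    \<comment> \<open>Conjugating translation by -kN with inversion gives the lower triangular
      matrix with entry kN.\<close>
    have "g (- 1 / (- 1 / \<tau> + of_int (- k * int N))) = g (- 1 / (- 1 / \<tau>))"
      by (rule translation_invariant_int[of "\<lambda>\<tau>. g (- 1 / \<tau>)"]) (use I Im_minus_inverse_pos[OF \<tau>] in auto)
    moreover have "- 1 / (- 1 / \<tau> + of_int (- k * int N)) = mobius 1 0 (k * int N) 1 \<tau>"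
    proof -
      have "- 1 / \<tau> + of_int (- k * int N) = - ((of_int (k * int N) * \<tau> + 1) / \<tau>)"
        using \<tau>0 by (simp add: field_simps)
      then show ?thesis by (simp add: mobius_def)
    qed
    ultimately show ?thesis by simp
  qed
  have "\<forall>\<tau>. Im \<tau> > 0 \<longrightarrow> g (mobius a b c d \<tau>) = g \<tau>"
    using N det c
  proof (rule Gamma0_normalise[where P = "\<lambda>a b c d. \<forall>\<tau>. Im \<tau> > 0 \<longrightarrow> g (mobius a b c d \<tau>) = g \<tau>"])
    fix a b c d k :: int
    assume IH: "\<forall>\<tau>. Im \<tau> > 0 \<longrightarrow> g (mobius a (b + k * a) c (d + k * c) \<tau>) = g \<tau>"
    show "\<forall>\<tau>. Im \<tau> > 0 \<longrightarrow> g (mobius a b c d \<tau>) = g \<tau>"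
    proof (intro allI impI)
      fix \<tau> assume \<tau>: "Im \<tau> > 0"
      have "mobius a b c d \<tau> = mobius a (b + k * a) c (d + k * c) (\<tau> + of_int (- k))"
        by (simp add: mobius_def algebra_simps)
      then show "g (mobius a b c d \<tau>) = g \<tau>"
        using IH[rule_format, of "\<tau> + of_int (- k)"] T'[OF \<tau>, of "- k"] \<tau> by simp
    qed
  next
    fix a b c d k :: int
    assume IH: "\<forall>\<tau>. Im \<tau> > 0 \<longrightarrow> g (mobius (a + k * int N * b) b (c + k * int N * d) d \<tau>) = g \<tau>"
    show "\<forall>\<tau>. Im \<tau> > 0 \<longrightarrow> g (mobius a b c d \<tau>) = g \<tau>"
    proof (intro allI impI)
      fix \<tau> assume \<tau>: "Im \<tau> > 0"
      have "Im (mobius 1 0 (- k * int N) 1 \<tau>) > 0"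
        by (rule Im_mobius_pos) (use \<tau> in auto)
      moreover have "mobius (a + k * int N * b) b (c + k * int N * d) d (mobius 1 0 (- k * int N) 1 \<tau>)
          = mobius a b c d \<tau>"
        by (subst mobius_mobius[OF \<tau>]) (simp_all add: algebra_simps)
      ultimately show "g (mobius a b c d \<tau>) = g \<tau>"
        using IH U'[OF \<tau>, of "- k"] by metis
    qed
  next
    fix a b c d :: int
    assume "\<forall>\<tau>. Im \<tau> > 0 \<longrightarrow> g (mobius (- a) (- b) (- c) (- d) \<tau>) = g \<tau>"
    moreover have "mobius (- a) (- b) (- c) (- d) \<tau> = mobius a b c d \<tau>" for \<tau>
      using minus_divide_divide[of "of_int a * \<tau> + of_int b" "of_int c * \<tau> + of_int d"]
      by (simp add: mobius_def)
    ultimately show "\<forall>\<tau>. Im \<tau> > 0 \<longrightarrow> g (mobius a b c d \<tau>) = g \<tau>" by simp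
  qed (use base in blast)
  with \<tau> show ?thesis by blast
qed

lemma even_if_minus_one_power_int:
  assumes "(- 1 :: 'a :: {field_char_0}) powi n = 1"
  shows "even n"
proof (rule ccontr)
  assume "odd n"
  then obtain j where "n = 2 * j + 1" by (elim oddE)
  then have "(- 1 :: 'a) powi n = (- 1) powi (2 * j) * (- 1)"
    by (simp add: power_int_add)
  also have "(- 1 :: 'a) powi (2 * j) = 1"
    by (rule power_int_even_sign) auto
  finally show False using assms by simp
qed

theorem theorem1p11:
  fixes N L :: nat
    and S :: "nat \<Rightarrow> nat set"
    and e :: "nat \<Rightarrow> nat \<Rightarrow> int"
    and f :: "complex \<Rightarrow> complex"
  assumes "N > 0"
    and "L = max_square_root_divisor N"
    and "\<forall>m\<in>proper_divisors N. unit_reps_mod_sign (mdd N m) (S (mdd N m))"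
    and "f = Fprod N S e"
    and "cusp_order N f 1 N \<in> \<int>"
    and "cusp_order N f 1 1 \<in> \<int>"
    and "cusp_order N f 1 (odd_part N) \<in> \<int>"
    and "\<forall>p. prime p \<longrightarrow> odd p \<longrightarrow> p dvd N \<longrightarrow>
           [(\<Sum>m | m \<in> proper_divisors N \<and> (\<exists>r. mdd N m = p ^ r). \<Sum>h<ell N m. e m h) = 0] (mod 2)"
  shows "modular_function_X0 N (\<lambda>\<tau>. f \<tau> ^ L)"
proof -
  let ?D = "proper_divisors N" and ?F = "\<lambda>m h. Ffun N S m (int h)"
  note N = assms(1)
  have S: "unit_reps_mod_sign (mdd N m) (S (mdd N m))" if "m \<in> ?D" for m
    using assms(3) that by blast
  have ell_L: "ell N m dvd L" if "m \<in> ?D" for m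
    unfolding assms(2) using max_square_root_divisor(2)[OF N] level_proper_divisor(2)[OF N that] by blast
  have fin: "finite (?D)" by (rule finite_proper_divisors[OF N])
  have f_unit: "cuspidal_unit f"
  proof -
    have "cuspidal_unit (\<lambda>\<tau>. \<Prod>m\<in>?D. \<Prod>h<ell N m. ?F m h \<tau> powi e m h)"
      by (intro cuspidal_unit_prod cuspidal_unit_powi cuspidal_unit_Ffun fin N S) auto
    then show ?thesis by (simp add: assms(4) Fprod_def [abs_def])
  qed

  obtain t where t: "\<And>m h. m \<in> ?D \<Longrightarrow> t m h \<noteq> 0 \<and>
      (\<forall>\<tau>. Im \<tau> > 0 \<longrightarrow> ?F m h (\<tau> + 1) = t m h * ?F m h \<tau>)"
  proof -
    have "\<forall>m h. \<exists>c. m \<in> ?D \<longrightarrow> c \<noteq> 0 \<and>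
      (\<forall>\<tau>. Im \<tau> > 0 \<longrightarrow> ?F m h (\<tau> + 1) = c * ?F m h \<tau>)"
      using Ffun_translate[OF N] by blast
    then show ?thesis using that by metis
  qed
  define T where "T = (\<Prod>m\<in>?D. \<Prod>h<ell N m. t m h powi e m h)"
  have T: "f (\<tau> + 1) = T * f \<tau>" if "Im \<tau> > 0" for \<tau>
    unfolding assms(4) T_def by (rule Fprod_multiplier) (use t that in blast)

  obtain i where i: "\<And>m h. m \<in> ?D \<Longrightarrow> i m h \<noteq> 0 \<and>
      (\<forall>\<tau>. Im \<tau> > 0 \<longrightarrow> ?F m h (- 1 / (\<tau> + of_nat N)) = i m h * ?F m h (- 1 / \<tau>)) \<and>
      (odd L \<longrightarrow> i m h ^ (12 * L) = (if mdd N m = 2 then - 1 else 1))"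
  proof -
    have "\<forall>m h. \<exists>c. m \<in> ?D \<longrightarrow> c \<noteq> 0 \<and>
      (\<forall>\<tau>. Im \<tau> > 0 \<longrightarrow> ?F m h (- 1 / (\<tau> + of_nat N)) = c * ?F m h (- 1 / \<tau>)) \<and>
      (odd L \<longrightarrow> c ^ (12 * L) = (if mdd N m = 2 then - 1 else 1))"
      using Ffun_inversion_translate[where S = S, OF N _ S ell_L] by blast
    then show ?thesis using that by metis
  qed
  define I where "I = (\<Prod>m\<in>?D. \<Prod>h<ell N m. i m h powi e m h)"
  have I: "f (- 1 / (\<tau> + of_nat N)) = I * f (- 1 / \<tau>)" if "Im \<tau> > 0" for \<tau>
    unfolding assms(4) I_def by (rule Fprod_multiplier) (use i that in blast)

  \<comment> \<open>The matrix with rows (1, 0), (1, 1) applied to tau - 1 gives 1 - 1/tau, so up to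
    the constant \<open>T\<close> the expansion at 0 is that of f(-1/tau). The cusp has width N:
    translation by N multiplies by the exponential of the order, an integer.\<close>
  have I1: "I = 1"
  proof -
    obtain A where A: "cusp_unit (\<lambda>\<tau>. f (mobius 1 0 (int 1) 1 \<tau>)) A"
        "cusp_order N f 1 1 = real N / real (gcd (1\<^sup>2) N) * A"
      using cusp_order_eq[OF f_unit] by blast
    have "cusp_unit (\<lambda>\<tau>. f (mobius 1 0 (int 1) 1 (\<tau> - 1))) A"
      using cusp_unit_affine[OF A(1), of 1 1 "- 1"] by simp
    then have "cusp_unit (\<lambda>\<tau>. T * f (- 1 / \<tau>)) A"
    proof (rule cusp_unit_cong)
      fix \<tau> :: complex assume \<tau>: "Im \<tau> > 0"
      then have "\<tau> \<noteq> 0" by auto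
      then have "mobius 1 0 (int 1) 1 (\<tau> - 1) = - 1 / \<tau> + 1"
        by (simp add: mobius_def diff_divide_distrib)
      then show "f (mobius 1 0 (int 1) 1 (\<tau> - 1)) = T * f (- 1 / \<tau>)"
        using T[OF Im_minus_inverse_pos[OF \<tau>]] by simp
    qed
    then have "has_leading_power (\<lambda>\<tau>. T * f (- 1 / \<tau>)) A"
      by (rule cusp_unit_imp_leading_power)
    from has_leading_power_translation[OF this, of N I]
    have "I = qexp (of_real (A * real N))" using I by simp
    moreover have "A * real N \<in> \<int>" using A(2) assms(6) by (simp add: mult.commute)
    ultimately show ?thesis by (simp add: qexp_Ints Ints_of_real del: of_real_mult)
  qed

  have f_inv: "f (- 1 / (\<tau> + of_nat N)) = f (- 1 / \<tau>)" if "Im \<tau> > 0" for \<tau>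
    using I[OF that] I1 by simp
  \<comment> \<open>The prescribed matrix with rows (1, 0), (N, 1) fixes 0, so \<open>f_inv\<close>
    shows that it may be dropped; the order at infinity, of width 1, is then the leading exponent of
    f itself.\<close>
  have T1: "T = 1"
  proof -
    obtain A where A: "cusp_unit (\<lambda>\<tau>. f (mobius 1 0 (int N) 1 \<tau>)) A"
        "cusp_order N f 1 N = real N / real (gcd (N\<^sup>2) N) * A"
      using cusp_order_eq[OF f_unit] by blast
    have "cusp_unit f A"
    proof (rule cusp_unit_cong[OF A(1)])
      fix \<tau> :: complex assume \<tau>: "Im \<tau> > 0"
      define w where "w = mobius 1 0 (int N) 1 \<tau>"
      have w: "Im w > 0" unfolding w_def by (rule Im_mobius_pos) (use \<tau> in auto)
      have \<tau>0: "\<tau> \<noteq> 0" using \<tau> by auto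
      have nz: "of_nat N * \<tau> + 1 \<noteq> 0"
        using mobius_denominator_nonzero[OF \<tau>, of "int N" 1] by simp
      have "- 1 / w + of_nat N = - 1 / \<tau>"
        using \<tau>0 nz by (simp add: w_def mobius_def field_simps)
      moreover have "w \<noteq> 0" using w by auto
      ultimately show "f (mobius 1 0 (int N) 1 \<tau>) = f \<tau>"
        using f_inv[OF Im_minus_inverse_pos[OF w]] \<tau>0 by (simp add: w_def [symmetric])
    qed
    then have "has_leading_power f A" by (rule cusp_unit_imp_leading_power)
    from has_leading_power_translation[OF this, of 1 T]
    have "T = qexp (of_real A)" using T by simp
    moreover have "A \<in> \<int>" using A(2) assms(1,5) by (simp add: power2_eq_square)
    ultimately show ?thesis by (simp add: qexp_Ints Ints_of_real)
  qed

  \<comment> \<open>For odd L only m = N/2 can have m'' = 2, and its only index is h = 0; hence a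
    single exponent is at stake.\<close>
  have level2: "ell N m = 1 \<and> N = 2 * m" if "odd L" "m \<in> ?D" "mdd N m = 2" for m
  proof -
    interpret level N m "ell N m" "mdd N m" "Nd N m"
      by (rule level_proper_divisor(1)[OF N that(2)])
    have "odd (ell N m)" using ell_L[OF that(2)] that(1) by (meson dvd_trans)
    then have "ell N m \<noteq> 2" by auto
    then have "ell N m = 1"
      using pos(2) dvd_imp_le[OF l_dvd_k] that(3) by simp
    then show ?thesis using N_eq that(3) by simp
  qed
  txt \<open>\<open>I = 1\<close>, but \<open>I ^ (12 * L)\<close> is \<open>- 1\<close> to the exponent of the function with \<open>mdd N m = 2\<close>.\<close>
  have e_even: "even (e m 0)" if L: "odd L" and m: "m \<in> ?D" "mdd N m = 2" for m
  proof -
    define X :: "nat \<Rightarrow> complex" where "X m = (\<Prod>h<ell N m. (i m h ^ (12 * L)) powi e m h)" for m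
    have "I ^ (12 * L) = (\<Prod>m\<in>?D. X m)"
      by (simp add: I_def X_def prod_power_distrib power_int_power power_int_power' mult.commute)
    also have "\<dots> = X m * (\<Prod>m'\<in>?D - {m}. X m')"
      by (rule prod.remove[OF fin m(1)])
    also have "(\<Prod>m'\<in>?D - {m}. X m') = 1"
    proof (rule prod.neutral, rule ballI)
      fix m' assume m': "m' \<in> ?D - {m}"
      have "mdd N m' \<noteq> 2"
        using level2[OF L, of m'] level2[OF L m] m' by auto
      then show "X m' = 1" using i m' L by (simp add: X_def)
    qed
    also have "X m = (- 1) powi e m 0"
      unfolding X_def conjunct1[OF level2[OF L m]] using i[OF m(1), of 0] L m(2) by simp
    finally show ?thesis
      using even_if_minus_one_power_int[of "e m 0"] by (simp add: I1)
  qed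

  have normalised: "f (mobius a b c d \<tau>) ^ L = f \<tau> ^ L"
    if det: "a * d - b * c = 1" and a: "[a = 1] (mod 4)" and d: "[d = 1] (mod 4)"
      and b: "24 * int N dvd b" and c: "24 * int N * int N dvd c" and \<tau>: "Im \<tau> > 0" for a b c d \<tau>
  proof -
    note sq = Ffun_square_normalised[OF N _ _ det a d b c \<tau>]
    note pow = Ffun_power_normalised[where S = S, OF N _ S ell_L _ det a d b c]
    show ?thesis
    proof (cases "even L")
      case True
      have "?F m h (mobius a b c d \<tau>) ^ L = ?F m h \<tau> ^ L"
        if m: "m \<in> ?D" for m h
      proof (cases "mdd N m = 2")
        case k: True
        obtain j where "L = 2 * j" using True by (elim evenE)
        then show ?thesis by (simp only: power_mult sq[OF m k])
      next
        case k: False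
        obtain \<sigma> :: int where "\<sigma> \<in> {1, -1}" "?F m h (mobius a b c d \<tau>) ^ L = of_int \<sigma> ^ L * ?F m h \<tau> ^ L"
          using pow[OF m m m k] \<tau> by metis
        then show ?thesis using True by auto
      qed
      then show ?thesis unfolding assms(4) Fprod_power by simp
    next
      case L: False
      \<comment> \<open>On prime powers the choice is forced, and the sign attached to m depends on
        m only through this prime.\<close>
      define pr where "pr m = (SOME p. prime p \<and> p dvd mdd N m)" for m
      define ppow where "ppow m \<longleftrightarrow> (\<exists>p r. prime p \<and> odd p \<and> mdd N m = p ^ r)" for m
      define \<sigma> :: "nat \<Rightarrow> complex" where "\<sigma> m = (if ppow m then of_int (Legendre a (int (pr m))) else 1)" for m
      \<comment> \<open>If 4 divided N, then 2 would divide L. Thus 4 divides no m'', and every sign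
        is known.\<close>
      have not4: "\<not> 4 dvd N"
      proof
        assume "4 dvd N"
        then have "2\<^sup>2 dvd N" by simp
        then have "2 dvd L" unfolding assms(2) by (rule max_square_root_divisor(2)[OF N])
        with L show False by simp
      qed
      have mdd: "mdd N m > 1" "mdd N m dvd N" if m: "m \<in> ?D" for m
      proof -
        interpret level N m "ell N m" "mdd N m" "Nd N m"
          by (rule level_proper_divisor(1)[OF N m])
        show "mdd N m > 1" by (rule k_gt_1)
        show "mdd N m dvd N" using N_eq by (metis dvd_triv_right)
      qed
      have pr: "pr m = p" if m: "m \<in> ?D" and p: "prime p" "mdd N m = p ^ r" for m p r
      proof -
        have "\<exists>p. prime p \<and> p dvd mdd N m"
          using mdd(1)[OF m] prime_factor_nat[of "mdd N m"] by auto
        then have "prime (pr m)" "pr m dvd p ^ r"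
          unfolding pr_def using someI_ex p(2) by (metis (mono_tags, lifting))+
        then show ?thesis using p(1) by (metis prime_dvd_power primes_dvd_imp_eq)
      qed
      have step: "(?F m h (mobius a b c d \<tau>) ^ L) powi e m h
          = \<sigma> m powi e m h * (?F m h \<tau> ^ L) powi e m h"
        if m: "m \<in> ?D" and h: "h < ell N m" for m h
      proof (cases "mdd N m = 2")
        case k: True
        have h0: "h = 0" using h conjunct1[OF level2[OF L m k]] by simp
        have "\<not> ppow m"
        proof
          assume "ppow m"
          then obtain p r :: nat where p: "prime p" "odd p" "2 = p ^ r" unfolding ppow_def k by blast
          have "odd (p ^ r)" using p(2) by simp
          with p(3) show False by (metis even_numeral)
        qed
        then have "\<sigma> m = 1" by (simp add: \<sigma>_def)
        \<comment> \<open>The even exponent turns the factor into a power of its square, which is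
          invariant.\<close>
        moreover obtain j where j: "e m h = 2 * j"
          using e_even[OF L m k] unfolding h0 by (elim evenE)
        then have "(x ^ L) powi e m h = (x\<^sup>2) powi (int L * j)" for x :: complex
          by (simp add: power_int_power mult_ac)
        ultimately show ?thesis by (simp only: sq[OF m k] power_int_1_left mult_1)
      next
        case k: False
        have n4: "\<not> 4 dvd mdd N m" using not4 mdd(2)[OF m] dvd_trans by blast
        obtain s :: int where s: "s \<in> {1, -1}"
            "?F m h (mobius a b c d \<tau>) ^ L = of_int s ^ L * ?F m h \<tau> ^ L"
            "\<And>p r. prime p \<Longrightarrow> odd p \<Longrightarrow> mdd N m = p ^ r \<Longrightarrow> s = Legendre a (int p)"
            "\<not> ppow m \<Longrightarrow> s = 1"
          unfolding ppow_def using pow[OF m m m k] \<tau> n4 by metis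
        have "\<sigma> m = of_int s"
        proof (cases "ppow m")
          case True
          then obtain p r where p: "prime p" "odd p" "mdd N m = p ^ r" by (auto simp: ppow_def)
          then show ?thesis using True s(3)[OF p] pr[OF m p(1,3)] by (simp add: \<sigma>_def)
        qed (use s(4) in \<open>simp add: \<sigma>_def\<close>)
        moreover have "(of_int s :: complex) ^ L = of_int s" using s(1) L by auto
        ultimately show ?thesis by (simp only: s(2) power_int_mult_distrib)
      qed
      define E where "E m = (\<Sum>h<ell N m. e m h)" for m
      have \<sigma>_sq: "\<sigma> m * \<sigma> m = 1" if m: "m \<in> ?D" for m
      proof (cases "ppow m")
        case True
        then obtain p r where p: "prime p" "odd p" "mdd N m = p ^ r" by (auto simp: ppow_def)
        have "r > 0" using p(3) mdd(1)[OF m] by (cases r) auto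
        then have "int p dvd int (mdd N m)" unfolding p(3) by (simp add: dvd_power)
        also have "int (mdd N m) dvd int N" using mdd(2)[OF m] by simp
        also have "int N dvd c" using c by (meson dvd_mult_right)
        finally have "coprime a (int p)" by (rule coprime_det(1)[OF det])
        then have "\<not> int p dvd a"
          using p(1) by (metis coprime_common_divisor dvd_refl not_prime_unit prime_nat_int_transfer)
        then have "Legendre a (int p) \<in> {1, -1}" by (rule Legendre_cases)
        then show ?thesis using True pr[OF m p(1,3)] by (auto simp: \<sigma>_def)
      qed (simp add: \<sigma>_def)
      have \<sigma>_nz: "\<sigma> m \<noteq> 0" if "m \<in> ?D" for m
        using \<sigma>_sq[OF that] by auto
      define D where "D = {m \<in> ?D. ppow m}"
      have "(\<Prod>m\<in>?D. \<sigma> m powi E m) = (\<Prod>m\<in>D. \<sigma> m powi E m)"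
        by (rule prod.mono_neutral_right) (use fin in \<open>auto simp: D_def \<sigma>_def\<close>)
      \<comment> \<open>Grouping by primes: for fixed p the signs are one and the same Legendre
        symbol, raised to the sum of exponents in condition (4), which is even.\<close>
      also have "\<dots> = (\<Prod>p\<in>pr ` D. \<Prod>m | m \<in> D \<and> pr m = p. \<sigma> m powi E m)"
        by (rule prod.group [symmetric]) (use fin in \<open>auto simp: D_def\<close>)
      also have "\<dots> = 1"
      proof (rule prod.neutral, rule ballI)
        fix p assume "p \<in> pr ` D"
        then obtain m0 where m0: "m0 \<in> ?D" "ppow m0" "p = pr m0" by (auto simp: D_def)
        then obtain q r where q: "prime q" "odd q" "mdd N m0 = q ^ r" by (auto simp: ppow_def)
        then have p: "prime p" "odd p" "mdd N m0 = p ^ r" using pr[OF m0(1) q(1,3)] m0(3) by auto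
        have "r > 0" using p(3) mdd(1)[OF m0(1)] by (cases r) auto
        then have "p dvd N" using mdd(2)[OF m0(1)] p(3) by (metis dvd_power dvd_trans)
        have D_eq: "{m. m \<in> D \<and> pr m = p} = {m. m \<in> ?D \<and> (\<exists>r. mdd N m = p ^ r)}"
          unfolding D_def ppow_def using pr p by auto
        have "(\<Prod>m | m \<in> D \<and> pr m = p. \<sigma> m powi E m) = (\<Prod>m | m \<in> D \<and> pr m = p. \<sigma> m0 powi E m)"
          by (intro prod.cong refl) (use m0 in \<open>auto simp: D_def \<sigma>_def\<close>)
        also have "\<dots> = \<sigma> m0 powi (\<Sum>m | m \<in> D \<and> pr m = p. E m)"
          by (rule power_int_sum[OF \<sigma>_nz[OF m0(1)]])
        also have "\<dots> = 1"
        proof (rule power_int_even_sign[OF \<sigma>_sq[OF m0(1)]])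
          show "even (\<Sum>m | m \<in> D \<and> pr m = p. E m)"
            using assms(8) p \<open>p dvd N\<close> unfolding D_eq E_def by (simp add: cong_0_iff)
        qed
        finally show "(\<Prod>m | m \<in> D \<and> pr m = p. \<sigma> m powi E m) = 1" .
      qed
      finally have prod1: "(\<Prod>m\<in>?D. \<sigma> m powi E m) = 1" .
      have "f (mobius a b c d \<tau>) ^ L = (\<Prod>m\<in>?D. \<Prod>h<ell N m.
          \<sigma> m powi e m h * (?F m h \<tau> ^ L) powi e m h)"
        unfolding assms(4) Fprod_power by (intro prod.cong refl step) auto
      also have "\<dots> = (\<Prod>m\<in>?D. \<Prod>h<ell N m. \<sigma> m powi e m h) * f \<tau> ^ L"
        by (simp add: prod.distrib assms(4) Fprod_power)
      also have "(\<Prod>m\<in>?D. \<Prod>h<ell N m. \<sigma> m powi e m h) = (\<Prod>m\<in>?D. \<sigma> m powi E m)"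
        unfolding E_def by (intro prod.cong refl power_int_sum \<sigma>_nz)
      finally show ?thesis by (simp add: prod1)
    qed
  qed

  show ?thesis
    unfolding modular_function_X0_def
  proof (intro conjI allI impI ballI)
    have fL: "cuspidal_unit (\<lambda>\<tau>. f \<tau> ^ L)" by (rule cuspidal_unit_power[OF f_unit])
    then have "(\<lambda>\<tau>. f \<tau> ^ L) holomorphic_on upper_half_plane" by (simp add: cuspidal_unit_def)
    then show "(\<lambda>\<tau>. f \<tau> ^ L) nicely_meromorphic_on upper_half_plane"
      by (intro analytic_on_imp_nicely_meromorphic_on) (simp add: analytic_on_open open_upper_half_plane)
    show "f (mobius a b c d \<tau>) ^ L = f \<tau> ^ L"
      if "a * d - b * c = 1" "int N dvd c" "\<tau> \<in> upper_half_plane" for a b c d \<tau>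
      by (rule Gamma0_invariant_if_normalised_invariant[OF N, of "\<lambda>\<tau>. f \<tau> ^ L"])
         (use T T1 f_inv normalised that in auto)
    fix a b c d :: int assume "a * d - b * c = 1"
    with fL obtain A where "cusp_unit (\<lambda>\<tau>. f (mobius a b c d \<tau>) ^ L) A"
      unfolding cuspidal_unit_def by blast
    then obtain k :: int and M u where "A = of_int k / of_nat M"
        "has_fourier_expansion (\<lambda>\<tau>. f (mobius a b c d \<tau>) ^ L) A M u"
      using cusp_unit_imp_fourier by metis
    then show "\<exists>(k::int) M u. has_fourier_expansion (\<lambda>\<tau>. f (mobius a b c d \<tau>) ^ L) (of_int k / of_nat M) M u"
      by blast
  qed
qed

end
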